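(* Fix $D\ge1$ and $0<r<1/2$. Let $T_{n,D}(r)$ be the number of adjacent twin pairs in $G_D(n;r)$. Then, as $n\to\infty$, $$\mathbb E\,T_{n,D}(r)\sim 2^{D-1-D^2}\,r^{-D(D-1)}\,n^{2-D}.$$ In particular, for $D=2$, $$T_{n,2}(r)\xrightarrow{d}\operatorname{Poisson}\left(\frac1{8r^2}\right).$$ Consequently, $G_2(n;r)$ does not satisfy a first-order zero-one law for any fixed $0<r<1/2$. For every fixed $D\ge3$, $T_{n,D}(r)\to0$ in probability.
   Context: Let $\mathbb T^D=(\mathbb R/\mathbb Z)^D$, with torus $L^\infty$ metric $d_\infty(x,y)=\max_{1\le i\le D}\|x_i-y_i\|_{\mathbb T}$, where $\|t\|_{\mathbb T}=\min_{m\in\mathbb Z}|t-m|$. Let $X_1,\dots,X_n$ be independent uniform random points of $\mathbb T^D$. For $0\le r\le1/2$, $G_D(n;r)$ is the simple graph on $[n]=\{1,\dots,n\}$ in which distinct $i,j$ are adjacent iff $d_\infty(X_i,X_j)\le r$. Two adjacent vertices $x,y$ of a graph are adjacent twins if they have the same neighbors outside the pair $\{x,y\}$; the number of adjacent twin pairs is the number of unordered pairs $\{x,y\}$ of adjacent twins. Graphs are finite, simple, undirected, and regarded as structures in the first-order language with equality and one binary relation symbol $E$. A sequence of random graphs satisfies a first-order zero-one law if, for every first-order graph sentence, the probability that the sentence holds tends to either $0$ or $1$ as $n\to\infty$. $f(n)\sim g(n)$ means $f(n)/g(n)\to1$. $\operatorname{Poisson}(\lambda)$ is the Poisson distribution with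 mean $\lambda$. *)

theory Defs
  imports "HOL-Probability.Probability" "HOL-Library.Landau_Symbols"
begin

section \<open>The torus\<close>

quotient_type circle = real / "\<lambda>x y :: real. x - y \<in> \<int>"
proof (rule equivpI)
  show "reflp (\<lambda>x y :: real. x - y \<in> \<int>)"
    by (simp add: reflp_def)
  show "symp (\<lambda>x y :: real. x - y \<in> \<int>)"
    by (auto intro!: sympI dest: Ints_minus)
  show "transp (\<lambda>x y :: real. x - y \<in> \<int>)"
    by (rule transpI) (use Ints_add in fastforce)
qed

instantiation circle :: ab_group_add
begin

lift_definition zero_circle :: circle is 0 .

lift_definition plus_circle :: "circle \<Rightarrow> circle \<Rightarrow> circle" is "(+)"
  using Ints_add by (simp add: add_diff_add)

lift_definition uminus_circle :: "circle \<Rightarrow> circle" is uminus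
  using Ints_minus by fastforce

lift_definition minus_circle :: "circle \<Rightarrow> circle \<Rightarrow> circle" is "(-)"
proof -
  fix a b c d :: real
  assume "a - b \<in> \<int>" "c - d \<in> \<int>"
  then have "(a - b) - (c - d) \<in> \<int>"
    by (rule Ints_diff)
  then show "a - c - (b - d) \<in> \<int>"
    by (simp add: algebra_simps)
qed

instance
  by standard (transfer; simp)+

end

text \<open>The quotient topology, so that \<^term>\<open>borel\<close> is the Borel sigma-algebra of the circle.\<close>

instantiation circle :: topological_space
begin

definition open_circle :: "circle set \<Rightarrow> bool" where
  "open_circle U \<longleftrightarrow> open (abs_circle -` U)"

instance
  by standard (auto simp: open_circle_def vimage_Union vimage_Int)

end

lemma continuous_on_abs_circle: "continuous_on UNIV abs_circle"
  by (simp add: continuous_on_open_vimage open_circle_def)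

lift_definition circle_norm :: "circle \<Rightarrow> real" is "\<lambda>t. INF m::int. \<bar>t - of_int m\<bar>"
proof -
  fix s t :: real
  assume "s - t \<in> \<int>"
  then obtain k :: int where k: "s = t + of_int k"
    by (metis Ints_cases add.commute diff_add_cancel)
  have "range (\<lambda>m::int. \<bar>s - of_int m\<bar>) = range (\<lambda>m::int. \<bar>t - of_int m\<bar>)"
  proof (intro equalityI image_subsetI)
    fix m :: int
    show "\<bar>s - of_int m\<bar> \<in> range (\<lambda>m::int. \<bar>t - of_int m\<bar>)"
      by (rule image_eqI[of _ _ "m - k"]) (simp_all add: k algebra_simps)
    show "\<bar>t - of_int m\<bar> \<in> range (\<lambda>m::int. \<bar>s - of_int m\<bar>)"
      by (rule image_eqI[of _ _ "m + k"]) (simp_all add: k algebra_simps)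
  qed
  then show "(INF m::int. \<bar>s - of_int m\<bar>) = (INF m::int. \<bar>t - of_int m\<bar>)"
    by simp
qed

lemma circle_norm_attained:
  "\<exists>m::int. circle_norm (abs_circle t) = \<bar>t - of_int m\<bar> \<and> (\<forall>k::int. \<bar>t - of_int m\<bar> \<le> \<bar>t - of_int k\<bar>)"
proof -
  define m where "m = round t"
  have le: "\<bar>t - of_int m\<bar> \<le> \<bar>t - of_int k\<bar>" for k :: int
    unfolding m_def by (rule round_diff_minimal)
  have "(INF m::int. \<bar>t - of_int m\<bar>) = \<bar>t - of_int m\<bar>"
    by (rule cInf_eq_minimum) (use le in auto)
  with le show ?thesis
    by (auto simp: circle_norm.abs_eq)
qed

text \<open>A point of the \<open>D\<close>-dimensional torus is a function on the coordinates \<open>{1..D}\<close>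
  (with the library's dummy value elsewhere).\<close>

definition torus_dist :: "nat \<Rightarrow> (nat \<Rightarrow> circle) \<Rightarrow> (nat \<Rightarrow> circle) \<Rightarrow> real" where
  "torus_dist D x y = Max ((\<lambda>i. circle_norm (x i - y i)) ` {1..D})"

definition circle_uniform :: "circle measure" where
  "circle_uniform = distr (uniform_measure lborel {0..<1::real}) borel abs_circle"

definition torus_uniform :: "nat \<Rightarrow> (nat \<Rightarrow> circle) measure" where
  "torus_uniform D = PiM {1..D} (\<lambda>_. circle_uniform)"

lemma prob_space_torus_uniform: "prob_space (torus_uniform D)"
proof -
  have 1: "prob_space (uniform_measure lborel {0..<1::real})"
    by (rule prob_space_uniform_measure) auto
  have "abs_circle \<in> uniform_measure lborel {0..<1::real} \<rightarrow>\<^sub>M borel"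
    using borel_measurable_continuous_onI[OF continuous_on_abs_circle]
    by (simp add: measurable_cong_sets[OF sets_uniform_measure refl])
  then have "prob_space circle_uniform"
    unfolding circle_uniform_def by (rule prob_space.prob_space_distr[OF 1])
  then show ?thesis
    unfolding torus_uniform_def by (intro prob_space_PiM)
qed

locale uniform_torus_points = prob_space M
  for M :: "'a measure" and D n :: nat and X :: "nat \<Rightarrow> 'a \<Rightarrow> (nat \<Rightarrow> circle)" +
  assumes indep: "indep_vars (\<lambda>_. torus_uniform D) X {1..n}"
    and uniform: "\<And>i. i \<in> {1..n} \<Longrightarrow> distr M (torus_uniform D) (X i) = torus_uniform D"

lemma uniform_torus_points_canonical:
  "uniform_torus_points (PiM {1..n} (\<lambda>_. torus_uniform D)) D n (\<lambda>i \<omega>. \<omega> i)"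
proof -
  let ?M = "PiM {1..n} (\<lambda>_. torus_uniform D)"
  interpret prob_space ?M
    by (intro prob_space_PiM prob_space_torus_uniform)
  have comp: "distr ?M (torus_uniform D) (\<lambda>\<omega>. \<omega> i) = torus_uniform D" if "i \<in> {1..n}" for i
    using that by (intro distr_PiM_component prob_space_torus_uniform)
  have "distr ?M ?M (\<lambda>x. \<lambda>i\<in>{1..n}. x i) = distr ?M ?M (\<lambda>x. x)"
    by (rule distr_cong) (auto simp: space_PiM PiE_restrict)
  also have "\<dots> = PiM {1..n} (\<lambda>i. distr ?M (torus_uniform D) (\<lambda>\<omega>. \<omega> i))"
    unfolding distr_id by (intro PiM_cong refl) (simp only: comp)
  finally have eq: "distr ?M ?M (\<lambda>x. \<lambda>i\<in>{1..n}. x i)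
      = PiM {1..n} (\<lambda>i. distr ?M (torus_uniform D) (\<lambda>\<omega>. \<omega> i))" .
  have "indep_vars (\<lambda>_. torus_uniform D) (\<lambda>i \<omega>. \<omega> i) {1..n}"
  proof (cases "n = 0")
    case True
    then show ?thesis
      unfolding indep_vars_def indep_sets_def by simp
  next
    case False
    then have ne: "{1..n} \<noteq> {}"
      by simp
    have rv: "random_variable (torus_uniform D) (\<lambda>\<omega>. \<omega> i)" if "i \<in> {1..n}" for i
      using that by (rule measurable_component_singleton)
    show ?thesis
      by (rule iffD2[OF indep_vars_iff_distr_eq_PiM'[OF ne rv] eq])
  qed
  with comp show ?thesis
    by unfold_locales auto
qed

section \<open>Simple graphs\<close>

record 'v sgraph =
  verts :: "'v set"
  edges :: "'v set set"

definition simple_graph :: "'v sgraph \<Rightarrow> bool" where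
  "simple_graph G \<longleftrightarrow> finite (verts G) \<and> (\<forall>e\<in>edges G. e \<subseteq> verts G \<and> card e = 2)"

definition adjacent :: "'v sgraph \<Rightarrow> 'v \<Rightarrow> 'v \<Rightarrow> bool" where
  "adjacent G x y \<longleftrightarrow> {x, y} \<in> edges G"

definition neighbors :: "'v sgraph \<Rightarrow> 'v \<Rightarrow> 'v set" where
  "neighbors G x = {z \<in> verts G. adjacent G x z}"

definition adjacent_twins :: "'v sgraph \<Rightarrow> 'v \<Rightarrow> 'v \<Rightarrow> bool" where
  "adjacent_twins G x y \<longleftrightarrow>
     adjacent G x y \<and> neighbors G x - {x, y} = neighbors G y - {x, y}"

definition num_adjacent_twins :: "'v sgraph \<Rightarrow> nat" where
  "num_adjacent_twins G =
     card {{x, y} | x y. x \<in> verts G \<and> y \<in> verts G \<and> adjacent_twins G x y}"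

definition torus_graph :: "nat \<Rightarrow> nat \<Rightarrow> real \<Rightarrow> (nat \<Rightarrow> nat \<Rightarrow> circle) \<Rightarrow> nat sgraph" where
  "torus_graph D n r x =
     \<lparr>verts = {1..n},
      edges = {{i, j} | i j. i \<in> {1..n} \<and> j \<in> {1..n} \<and> i \<noteq> j \<and> torus_dist D (x i) (x j) \<le> r}\<rparr>"

lemma simple_graph_torus_graph: "simple_graph (torus_graph D n r x)"
  by (auto simp: simple_graph_def torus_graph_def)

section \<open>First-order logic of graphs\<close>

datatype fo =
    Eq nat nat
  | Edge nat nat
  | Neg fo
  | Conj fo fo
  | Forall nat fo

primrec free_vars :: "fo \<Rightarrow> nat set" where
  "free_vars (Eq i j) = {i, j}"
| "free_vars (Edge i j) = {i, j}"
| "free_vars (Neg \<phi>) = free_vars \<phi>"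
| "free_vars (Conj \<phi> \<psi>) = free_vars \<phi> \<union> free_vars \<psi>"
| "free_vars (Forall i \<phi>) = free_vars \<phi> - {i}"

definition sentence :: "fo \<Rightarrow> bool" where
  "sentence \<phi> \<longleftrightarrow> free_vars \<phi> = {}"

primrec sat :: "'v sgraph \<Rightarrow> (nat \<Rightarrow> 'v) \<Rightarrow> fo \<Rightarrow> bool" where
  "sat G s (Eq i j) \<longleftrightarrow> s i = s j"
| "sat G s (Edge i j) \<longleftrightarrow> adjacent G (s i) (s j)"
| "sat G s (Neg \<phi>) \<longleftrightarrow> \<not> sat G s \<phi>"
| "sat G s (Conj \<phi> \<psi>) \<longleftrightarrow> sat G s \<phi> \<and> sat G s \<psi>"
| "sat G s (Forall i \<phi>) \<longleftrightarrow> (\<forall>v\<in>verts G. sat G (s(i := v)) \<phi>)"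

lemma sat_cong: "(\<And>i. i \<in> free_vars \<phi> \<Longrightarrow> s i = t i) \<Longrightarrow> sat G s \<phi> \<longleftrightarrow> sat G t \<phi>"
proof (induction \<phi> arbitrary: s t)
  case (Neg \<phi>)
  then show ?case by (metis free_vars.simps(3) sat.simps(3))
next
  case (Conj \<phi> \<psi>)
  then show ?case by (metis UnCI free_vars.simps(4) sat.simps(4))
next
  case (Forall i \<phi>)
  have "sat G (s(i := v)) \<phi> \<longleftrightarrow> sat G (t(i := v)) \<phi>" for v
    by (rule Forall.IH) (use Forall.prems in auto)
  then show ?case by simp
qed auto

text \<open>The truth of a sentence does not depend on the assignment (see \<open>sat_cong\<close>).\<close>

definition models :: "'v sgraph \<Rightarrow> fo \<Rightarrow> bool" where
  "models G \<phi> \<longleftrightarrow> (\<forall>s. sat G s \<phi>)"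

text \<open>The \<open>n\<close>-th random graph of the sequence is \<open>\<Gamma> n\<close>, defined on the probability space \<open>M n\<close>.\<close>

definition fo_zero_one_law :: "(nat \<Rightarrow> 'a measure) \<Rightarrow> (nat \<Rightarrow> 'a \<Rightarrow> 'v sgraph) \<Rightarrow> bool" where
  "fo_zero_one_law M \<Gamma> \<longleftrightarrow>
     (\<forall>\<phi>. sentence \<phi> \<longrightarrow>
        (\<lambda>n. measure (M n) {\<omega> \<in> space (M n). models (\<Gamma> n \<omega>) \<phi>}) \<longlonglongrightarrow> 0 \<or>
        (\<lambda>n. measure (M n) {\<omega> \<in> space (M n). models (\<Gamma> n \<omega>) \<phi>}) \<longlonglongrightarrow> 1)"

section \<open>Convergence in probability to a constant\<close>

definition tendsto_in_prob :: "(nat \<Rightarrow> 'a measure) \<Rightarrow> (nat \<Rightarrow> 'a \<Rightarrow> real) \<Rightarrow> real \<Rightarrow> bool" where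
  "tendsto_in_prob M Y c \<longleftrightarrow>
     (\<forall>\<epsilon>>0. (\<lambda>n. measure (M n) {\<omega> \<in> space (M n). \<bar>Y n \<omega> - c\<bar> > \<epsilon>}) \<longlonglongrightarrow> 0)"

end

theory Submission
  imports Defs
begin

text \<open>
  For two points of the torus with difference \<open>u\<close>, \<open>\<bar>u\<^sub>c\<bar> \<le> r\<close>, the symmetric difference of their \<open>r\<close>-balls
  has volume \<open>p(u) = 2 ((2 r)\<^sup>D - (\<Prod>\<^sub>c (2 r - min \<bar>u\<^sub>c\<bar> (1 - 2 r))))\<close>, and they are adjacent twins iff no other point
  falls into it. Substituting \<open>u = v / n\<close>, dominated convergence yields
  \<open>n\<^sup>D E[(1 - p(u))\<^sup>n] \<longlonglongrightarrow> \<integral> exp (- 2 (2 r)\<^bsup>D-1\<^esup> (\<Sum>\<^sub>c \<bar>v\<^sub>c\<bar>)) = (2 r)\<^bsup>-D(D-1)\<^esup>\<close>, hence the first moment.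

  For \<open>k\<close> disjoint prescribed pairs, the separating sets of different pairs are independent translates, so the
  volume of the intersection of two of them is \<open>p(u) p(u')\<close> on average over the base points. Hence the
  probability that all \<open>k\<close> pairs are twins factorizes up to a relative error \<open>O(1/n)\<close>, which gives the expected
  number of ordered \<open>k\<close>-matchings of twin pairs. In dimension 2 the probability of three mutual twins tends
  to 0, and without such triples the \<open>k\<close>-matchings count the \<open>k\<close>-th factorial moment of the number \<open>T\<close> of twin pairs. Because
  being twins is an equivalence relation, matchings also bound all moments of \<open>T\<close>, so triples do not
  contribute and the factorial moments of \<open>T\<close> converge to those of a Poisson distribution.
  Bonferroni's inequalities conclude. ``There are adjacent twins'' is a first-order sentence.
\<close>

section \<open>The circle as a measurable group\<close>

text \<open>The probability that k prescribed pairs are twins has order \<open>n^(-D k)\<close>, so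
  an absolute error of order 1/n says nothing. Every error estimate therefore keeps an exponential
  factor in \<open>n p(u)\<close>, whose integral over u, the function \<open>psi\<close>, is again
  of order \<open>n^(-D)\<close> per pair. This rests on a lower bound for p(u) by a multiple of the
  sum of the |u_c| (\<open>sepvol_ge\<close>), which also supplies the dominating function for the
  limit integral. Disjoint pairs fail to be independent in two ways: a vertex of one pair may
  separate another pair, and separating sets may overlap. Neither effect is small pointwise; only
  the averages over independent base points are. Hence the sharp estimate is made for matchings,
  while three mutual twins, which share a base point, get an upper bound. The cap 1 - 2 r in p(u)
  comes from arcs that meet a second time on the far side of the circle, which for adjacent points
  takes r > 1/3. It is inactive near u = 0, but the lower bound has to cope with it.\<close>

lemma borel_measurable_abs_circle [measurable]: "abs_circle \<in> borel \<rightarrow>\<^sub>M borel"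
  by (intro borel_measurable_continuous_onI continuous_on_abs_circle)

lemma abs_circle_eq_iff: "abs_circle s = abs_circle t \<longleftrightarrow> s - t \<in> \<int>"
  by (simp add: circle.abs_eq_iff)

lemma abs_circle_add_of_int [simp]: "abs_circle (t + of_int m) = abs_circle t"
  by (simp add: abs_circle_eq_iff)

lemma abs_circle_surj: "\<exists>t. x = abs_circle t"
  by (metis Quotient_circle Quotient_abs_rep)

text \<open>A Borel section of \<open>abs_circle\<close>: sums, differences and the norm are built
  from it, real arithmetic and \<open>abs_circle\<close>, which reduces their measurability to the
  reals.\<close>

lift_definition circle_frac :: "circle \<Rightarrow> real" is frac
proof -
  fix s t :: real assume "s - t \<in> \<int>"
  then obtain k where "s = t + of_int k"
    by (metis Ints_cases add.commute diff_add_cancel)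
  then show "frac s = frac t" by (simp add: frac_def)
qed

lemma abs_circle_circle_frac [simp]: "abs_circle (circle_frac x) = x"
  by transfer (simp add: frac_def)

lemma circle_frac_bounds: "0 \<le> circle_frac x" "circle_frac x < 1"
  by (transfer, simp add: frac_lt_1)+

lemma vimage_circle_frac_Ioo:
  assumes "0 \<le> a" "a \<le> 1"
  shows "abs_circle -` {x. 0 < circle_frac x \<and> circle_frac x < a} = (\<Union>m::int. {of_int m <..< of_int m + a})"
proof (intro set_eqI iffI)
  fix t assume "t \<in> abs_circle -` {x. 0 < circle_frac x \<and> circle_frac x < a}"
  then have "0 < frac t" "frac t < a" by (auto simp: circle_frac.abs_eq)
  then show "t \<in> (\<Union>m::int. {of_int m <..< of_int m + a})"
    by (intro UN_I[of "\<lfloor>t\<rfloor>"]) (auto simp: frac_def)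
next
  fix t assume "t \<in> (\<Union>m::int. {of_int m <..< of_int m + a})"
  then obtain m :: int where m: "of_int m < t" "t < of_int m + a" by auto
  then have "\<lfloor>t\<rfloor> = m" using assms by (intro floor_unique) auto
  with m show "t \<in> abs_circle -` {x. 0 < circle_frac x \<and> circle_frac x < a}"
    by (auto simp: circle_frac.abs_eq frac_def)
qed

text \<open>For 0 < y < 1 the sublevel set is a half-open arc. It is split into the point 0, closed
  because its preimage is the set of integers, and an open arc whose preimage is a union of open
  intervals.\<close>

lemma borel_measurable_circle_frac [measurable]: "circle_frac \<in> borel_measurable borel"
proof (rule borel_measurableI_less)
  fix y :: real
  have 0: "{abs_circle 0} \<in> sets borel"
  proof -
    have "abs_circle -` (- {abs_circle 0}) = - \<int>"
      by (auto simp: abs_circle_eq_iff)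
    then have "open (- {abs_circle 0})"
      by (simp add: open_circle_def closed_Ints open_Compl)
    then show ?thesis
      by (intro borel_closed) (simp add: closed_def)
  qed
  define a where "a = min y 1"
  show "{x \<in> space borel. circle_frac x < y} \<in> sets borel"
  proof (cases "y > 0")
    case True
    then have a: "0 < a" "a \<le> 1" by (auto simp: a_def)
    have "open {x. 0 < circle_frac x \<and> circle_frac x < a}"
      unfolding open_circle_def by (subst vimage_circle_frac_Ioo) (use a in auto)
    then have "{abs_circle 0} \<union> {x. 0 < circle_frac x \<and> circle_frac x < a} \<in> sets borel"
      using 0 by (intro sets.Un) auto
    also have "{abs_circle 0} \<union> {x. 0 < circle_frac x \<and> circle_frac x < a} = {x. circle_frac x < a}"
    proof -
      have *: "circle_frac x = 0 \<longleftrightarrow> x = abs_circle 0" for x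
        by (metis abs_circle_circle_frac circle_frac.abs_eq frac_of_int of_int_0)
      show ?thesis
      proof (intro set_eqI)
        fix x
        have "0 \<le> circle_frac x" by (rule circle_frac_bounds)
        then show "x \<in> {abs_circle 0} \<union> {x. 0 < circle_frac x \<and> circle_frac x < a} \<longleftrightarrow> x \<in> {x. circle_frac x < a}"
          using *[of x] a by auto
      qed
    qed
    also have "\<dots> = {x \<in> space borel. circle_frac x < y}"
      using circle_frac_bounds(2) by (auto simp: a_def)
    finally show ?thesis .
  next
    case False
    then have "{x \<in> space borel. circle_frac x < y} = {}"
      using circle_frac_bounds(1) by (auto simp: not_less intro: order_trans)
    then show ?thesis by simp
  qed
qed

lemma circle_add_eq: "x + y = abs_circle (circle_frac x + circle_frac y)"
  by (simp flip: plus_circle.abs_eq)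

lemma circle_diff_eq: "x - y = abs_circle (circle_frac x - circle_frac y)"
  by (simp flip: minus_circle.abs_eq)

lemma measurable_circle_add [measurable]:
  assumes [measurable]: "f \<in> M \<rightarrow>\<^sub>M borel" "g \<in> M \<rightarrow>\<^sub>M borel"
  shows "(\<lambda>w. f w + g w :: circle) \<in> M \<rightarrow>\<^sub>M borel"
  unfolding circle_add_eq by measurable

lemma measurable_circle_diff [measurable]:
  assumes [measurable]: "f \<in> M \<rightarrow>\<^sub>M borel" "g \<in> M \<rightarrow>\<^sub>M borel"
  shows "(\<lambda>w. f w - g w :: circle) \<in> M \<rightarrow>\<^sub>M borel"
  unfolding circle_diff_eq by measurable

lemma circle_norm_abs_circle: "circle_norm (abs_circle t) = \<bar>t - of_int (round t)\<bar>"
  unfolding circle_norm.abs_eq by (rule cInf_eq_minimum) (auto intro: round_diff_minimal)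

lemma circle_norm_le_iff: "circle_norm (abs_circle t) \<le> r \<longleftrightarrow> (\<exists>m::int. \<bar>t - of_int m\<bar> \<le> r)"
  using circle_norm_attained[of t] by (metis order_trans order_refl)

lemma circle_norm_eq_abs:
  assumes "\<bar>t\<bar> \<le> 1/2"
  shows "circle_norm (abs_circle t) = \<bar>t\<bar>"
proof -
  obtain m :: int where m: "circle_norm (abs_circle t) = \<bar>t - of_int m\<bar>" "\<bar>t - of_int m\<bar> \<le> \<bar>t - of_int 0\<bar>"
    using circle_norm_attained by blast
  have "\<bar>t\<bar> \<le> \<bar>t - of_int m\<bar>"
  proof (cases "m = 0")
    case False
    then have "\<bar>of_int m :: real\<bar> \<ge> 1" by (metis of_int_abs of_int_1_le_iff zero_less_abs_iff int_one_le_iff_zero_less)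
    then show ?thesis using assms by linarith
  qed simp
  with m show ?thesis by simp
qed

lemma circle_norm_nonneg: "0 \<le> circle_norm x"
  by (metis abs_circle_surj circle_norm_abs_circle abs_ge_zero)

lemma circle_norm_zero [simp]: "circle_norm 0 = 0"
  unfolding zero_circle_def using circle_norm_eq_abs[of 0] by simp

lemma circle_norm_uminus [simp]: "circle_norm (- x) = circle_norm x"
proof -
  have le: "circle_norm (- x) \<le> circle_norm x" for x
  proof -
    obtain t where x: "x = abs_circle t" using abs_circle_surj by blast
    obtain m :: int where "circle_norm (abs_circle t) = \<bar>t - of_int m\<bar>" using circle_norm_attained by blast
    then show ?thesis unfolding x
      by (simp add: uminus_circle.abs_eq circle_norm_le_iff) (intro exI[of _ "-m"], simp)
  qed
  from le[of x] le[of "-x"] show ?thesis by simp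
qed

lemma circle_norm_minus_commute: "circle_norm (x - y) = circle_norm (y - x)"
  by (metis circle_norm_uminus minus_diff_eq)

lemma circle_rep_centered: "\<exists>s. x = abs_circle s \<and> \<bar>s\<bar> = circle_norm x \<and> \<bar>s\<bar> \<le> 1/2"
proof -
  obtain t where x: "x = abs_circle t" using abs_circle_surj by blast
  have "\<bar>t - of_int (round t)\<bar> \<le> 1/2"
    using of_int_round_abs_le[of t] by (simp add: abs_minus_commute)
  moreover have "abs_circle (t - of_int (round t)) = x"
    unfolding x by (simp add: abs_circle_eq_iff)
  ultimately show ?thesis using circle_norm_abs_circle[of t] x by metis
qed

lemma borel_measurable_circle_norm [measurable]: "circle_norm \<in> borel_measurable borel"
proof -
  have "circle_norm = (\<lambda>x. min (circle_frac x) (1 - circle_frac x))"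
  proof
    fix x
    have f: "circle_norm x = circle_norm (abs_circle (circle_frac x))" by simp
    have g: "abs_circle (circle_frac x - 1) = x"
      using abs_circle_add_of_int[of "circle_frac x" "-1"] by simp
    show "circle_norm x = min (circle_frac x) (1 - circle_frac x)"
    proof (cases "circle_frac x \<le> 1/2")
      case True
      then show ?thesis using circle_norm_eq_abs[of "circle_frac x"] circle_frac_bounds[of x] by simp
    next
      case False
      then show ?thesis using circle_norm_eq_abs[of "circle_frac x - 1"] circle_frac_bounds[of x] g by simp
    qed
  qed
  show ?thesis unfolding \<open>circle_norm = _\<close> by measurable
qed

section \<open>Translation invariance on the circle and the length of arcs\<close>

lemma emeasure_lborel_shift:
  fixes S :: "real set"
  assumes "S \<in> sets borel"
  shows "emeasure lborel {t. c + t \<in> S} = emeasure lborel S"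
proof -
  have "emeasure (distr lborel borel ((+) c)) S = emeasure lborel ((+) c -` S \<inter> space lborel)"
    using assms by (intro emeasure_distr) auto
  then show ?thesis by (simp add: lborel_distr_plus vimage_def)
qed

lemma prob_space_circle_uniform: "prob_space circle_uniform"
proof -
  have 1: "prob_space (uniform_measure lborel {0..<1::real})"
    by (rule prob_space_uniform_measure) auto
  show ?thesis
    unfolding circle_uniform_def by (rule prob_space.prob_space_distr[OF 1]) simp
qed

interpretation circle_uniform: prob_space circle_uniform
  by (rule prob_space_circle_uniform)

lemma sets_circle_uniform [measurable_cong, simp]: "sets circle_uniform = sets borel"
  by (simp add: circle_uniform_def)

lemma space_circle_uniform [simp]: "space circle_uniform = UNIV"
  by (simp add: circle_uniform_def)

text \<open>Every half-open unit interval is a fundamental domain: the part beyond an integer is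
  moved back by an integer translation, which changes neither Lebesgue measure nor the image on the
  circle. The free choice of \<open>a\<close> serves translation invariance (windows starting at s)
  and centered arcs (\<open>a = -1/2\<close>).\<close>

lemma emeasure_circle_uniform:
  assumes [measurable]: "A \<in> sets borel"
  shows "emeasure circle_uniform A = emeasure lborel {t \<in> {a..<a+1}. abs_circle t \<in> A}"
proof -
  let ?S = "\<lambda>u v. {t \<in> {u..<v}. abs_circle t \<in> A}"
  have 0: "emeasure circle_uniform A = emeasure lborel (?S 0 1)"
    unfolding circle_uniform_def
    by (subst emeasure_distr; (subst emeasure_uniform_measure)?)
       (auto simp: measurable_sets_borel[OF borel_measurable_abs_circle] vimage_def Int_def divide_ennreal_def)
  define m where "m = \<lfloor>a\<rfloor>"
  define \<theta> where "\<theta> = frac a"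
  have am: "a = of_int m + \<theta>" "0 \<le> \<theta>" "\<theta> < 1" by (auto simp: m_def \<theta>_def frac_def frac_lt_1) linarith
  have shift: "emeasure lborel (?S u v)
      = emeasure lborel (?S (u + of_int k) (v + of_int k))" for u v and k :: int
  proof -
    have "emeasure lborel {t. of_int k + t \<in> (?S (u + of_int k) (v + of_int k))}
       = emeasure lborel (?S (u + of_int k) (v + of_int k))"
      by (intro emeasure_lborel_shift) measurable
    also have "{t. of_int k + t \<in> (?S (u + of_int k) (v + of_int k))} = (?S u v)"
      by (auto simp: add.commute[of "of_int k"])
    finally show ?thesis .
  qed
  have "emeasure lborel (?S a (a+1)) = emeasure lborel (?S \<theta> (\<theta>+1))"
    using shift[of \<theta> "\<theta>+1" m] am by (simp add: add_ac)
  also have "(?S \<theta> (\<theta>+1)) = (?S \<theta> 1) \<union> (?S 1 (\<theta>+1))"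
    using am by auto
  also have "emeasure lborel \<dots> = emeasure lborel (?S \<theta> 1) + emeasure lborel (?S 1 (\<theta>+1))"
    by (intro plus_emeasure[symmetric]) (measurable, auto)
  also have "emeasure lborel (?S 1 (\<theta>+1)) = emeasure lborel (?S 0 \<theta>)"
    using shift[of 0 \<theta> 1] by (simp add: add_ac)
  also have "emeasure lborel (?S \<theta> 1) + emeasure lborel (?S 0 \<theta>)
      = emeasure lborel ((?S \<theta> 1) \<union> (?S 0 \<theta>))"
    by (intro plus_emeasure) (measurable, auto)
  also have "(?S \<theta> 1) \<union> (?S 0 \<theta>) = (?S 0 1)"
    using am by auto
  finally show ?thesis using 0 by simp
qed

lemma distr_circle_uniform_add: "distr circle_uniform circle_uniform ((+) x) = circle_uniform"
proof (rule measure_eqI)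
  fix A assume "A \<in> sets (distr circle_uniform circle_uniform ((+) x))"
  then have A[measurable]: "A \<in> sets borel" by simp
  obtain s where x: "x = abs_circle s" using abs_circle_surj by blast
  have "emeasure (distr circle_uniform circle_uniform ((+) x)) A = emeasure circle_uniform {y. x + y \<in> A}"
    by (subst emeasure_distr) (simp_all add: vimage_def)
  also have "\<dots> = emeasure lborel {t \<in> {0..<0+1}. abs_circle t \<in> {y. x + y \<in> A}}"
    by (rule emeasure_circle_uniform) measurable
  also have "\<dots> = emeasure lborel {t. s + t \<in> {t \<in> {s..<s+1}. abs_circle t \<in> A}}"
    by (intro arg_cong[where f="emeasure lborel"]) (auto simp: x plus_circle.abs_eq)
  also have "\<dots> = emeasure lborel {t \<in> {s..<s+1}. abs_circle t \<in> A}"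
    by (intro emeasure_lborel_shift) measurable
  also have "\<dots> = emeasure circle_uniform A" by (rule emeasure_circle_uniform[symmetric]) measurable
  finally show "emeasure (distr circle_uniform circle_uniform ((+) x)) A = emeasure circle_uniform A" .
qed simp

text \<open>Two arcs of length \<open>2 r\<close> with centers at distance |t| overlap in length
  \<open>2 r - |t|\<close> and, once \<open>|t| > 1 - 2 r\<close>, a second time on the far side of
  the circle in length \<open>|t| - (1 - 2 r)\<close>. The sum of both is the capped
  expression.\<close>

lemma measure_two_arcs:
  assumes r: "0 < r" "r < 1/2" and t: "circle_norm t \<le> r"
  shows "measure circle_uniform {w. circle_norm w \<le> r \<and> circle_norm (w - t) \<le> r}
     = 2 * r - min (circle_norm t) (1 - 2 * r)"
proof -
  obtain s where s: "t = abs_circle s" "\<bar>s\<bar> = circle_norm t" using circle_rep_centered by blast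
  let ?A = "{w. circle_norm w \<le> r \<and> circle_norm (w - t) \<le> r}"
  \<comment> \<open>\<open>?I\<close> is the overlap between the two centers, \<open>?J\<close> the
    one on the far side of the circle; for \<open>|s| < 1 - 2 r\<close> the bounds of
    \<open>?J\<close> are reversed and it is empty.\<close>
  let ?I = "if 0 \<le> s then {s-r..r} else {-r..s+r}" and ?J = "if 0 \<le> s then {-r..s-1+r} else {s+1-r..r}"
  have "{u \<in> {-1/2..<-1/2+1}. abs_circle u \<in> ?A} = ?I \<union> ?J"
  proof (intro set_eqI)
    fix u
    have 1: "u \<in> {-1/2..<-1/2+1} \<and> circle_norm (abs_circle u) \<le> r \<longleftrightarrow> \<bar>u\<bar> \<le> r"
      using r circle_norm_eq_abs[of u] by auto
    have 2: "circle_norm (abs_circle (u - s)) \<le> r \<longleftrightarrow> \<bar>u - s\<bar> \<le> r \<or> \<bar>u - s - 1\<bar> \<le> r \<or> \<bar>u - s + 1\<bar> \<le> r" if u: "\<bar>u\<bar> \<le> r"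
    proof -
      have "m = 0 \<or> m = 1 \<or> m = -1" if "\<bar>u - s - of_int m\<bar> \<le> r" for m :: int
      proof -
        have "\<bar>of_int m :: real\<bar> < 2" using that u s t r by linarith
        then have "\<bar>m\<bar> < 2" by linarith
        then show ?thesis by linarith
      qed
      moreover have "\<bar>u - s - of_int 0\<bar> \<le> r \<longleftrightarrow> \<bar>u - s\<bar> \<le> r" "\<bar>u - s - of_int 1\<bar> \<le> r \<longleftrightarrow> \<bar>u - s - 1\<bar> \<le> r"
         "\<bar>u - s - of_int (-1)\<bar> \<le> r \<longleftrightarrow> \<bar>u - s + 1\<bar> \<le> r" by auto
      ultimately show ?thesis unfolding circle_norm_le_iff by metis
    qed
    have "u \<in> {u \<in> {-1/2..<-1/2+1}. abs_circle u \<in> ?A} \<longleftrightarrow>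
       \<bar>u\<bar> \<le> r \<and> (\<bar>u - s\<bar> \<le> r \<or> \<bar>u - s - 1\<bar> \<le> r \<or> \<bar>u - s + 1\<bar> \<le> r)"
      using 1 2 by (auto simp: s(1) minus_circle.abs_eq)
    also have "\<dots> \<longleftrightarrow> u \<in> ?I \<union> ?J"
      using r s(2) t by (auto simp: abs_le_iff)
    finally show "u \<in> {u \<in> {-1/2..<-1/2+1}. abs_circle u \<in> ?A} \<longleftrightarrow> u \<in> ?I \<union> ?J" .
  qed
  then have "emeasure circle_uniform ?A = emeasure lborel (?I \<union> ?J)"
    by (subst emeasure_circle_uniform[where a="-1/2"]) auto
  also have "\<dots> = emeasure lborel ?I + emeasure lborel ?J"
    using r by (intro plus_emeasure[symmetric]) auto
  also have "\<dots> = ennreal (2 * r - \<bar>s\<bar>) + ennreal (max 0 (\<bar>s\<bar> - 1 + 2 * r))"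
  proof (rule arg_cong2[where f="(+)"])
    show "emeasure lborel ?I = ennreal (2 * r - \<bar>s\<bar>)"
      using r s(2) t by (cases "0 \<le> s") (auto simp: emeasure_lborel_Icc_eq)
    show "emeasure lborel ?J = ennreal (max 0 (\<bar>s\<bar> - 1 + 2 * r))"
      using r s(2) t by (cases "0 \<le> \<bar>s\<bar> - 1 + 2 * r"; cases "0 \<le> s") (auto simp: emeasure_lborel_Icc_eq abs_if max_def)
  qed
  also have "\<dots> = ennreal (2 * r - min \<bar>s\<bar> (1 - 2 * r))"
  proof -
    have "0 \<le> 2 * r - \<bar>s\<bar>" "0 \<le> max 0 (\<bar>s\<bar> - 1 + 2 * r)"
      "2 * r - \<bar>s\<bar> + max 0 (\<bar>s\<bar> - 1 + 2 * r) = 2 * r - min \<bar>s\<bar> (1 - 2 * r)"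
      using r s(2) t by linarith+
    then show ?thesis by (metis ennreal_plus)
  qed
  finally show ?thesis
    using r s(2) t unfolding measure_def by (simp add: enn2real_ennreal)
qed

lemma measure_arc:
  assumes "0 < r" "r < 1/2"
  shows "measure circle_uniform {w. circle_norm w \<le> r} = 2 * r"
  using measure_two_arcs[of r 0] assms by simp

section \<open>Separating sets of two points of the torus\<close>

lemma measure_section_measurable:
  assumes "finite_measure M" and Q: "Measurable.pred (N \<Otimes>\<^sub>M M) (\<lambda>p. Q (fst p) (snd p))"
  shows "(\<lambda>q. measure M {w \<in> space M. Q q w}) \<in> borel_measurable N"
proof -
  interpret finite_measure M by fact
  have "{p \<in> space (N \<Otimes>\<^sub>M M). Q (fst p) (snd p)} \<in> sets (N \<Otimes>\<^sub>M M)"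
    using Q by measurable
  then have "(\<lambda>q. emeasure M (Pair q -` {p \<in> space (N \<Otimes>\<^sub>M M). Q (fst p) (snd p)})) \<in> borel_measurable N"
    by (rule measurable_emeasure_Pair)
  then have "(\<lambda>q. measure M (Pair q -` {p \<in> space (N \<Otimes>\<^sub>M M). Q (fst p) (snd p)})) \<in> borel_measurable N"
    unfolding measure_def by measurable
  also have "?this \<longleftrightarrow> ?thesis"
    by (intro measurable_cong arg_cong[where f="measure M"]) (auto simp: space_pair_measure)
  finally show ?thesis .
qed

type_synonym point = "nat \<Rightarrow> circle"
type_synonym points = "nat \<Rightarrow> point"

locale torus_box =
  fixes D :: nat and r :: real
  assumes D: "D \<ge> 1" and r: "0 < r" "r < 1/2"
begin

abbreviation \<mu> :: "point measure" where "\<mu> \<equiv> torus_uniform D"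

sublocale mu: prob_space \<mu> by (rule prob_space_torus_uniform)

lemma sets_mu: "sets \<mu> = sets (PiM {1..D} (\<lambda>_. borel :: circle measure))"
  unfolding torus_uniform_def by (intro sets_PiM_cong) auto

lemma space_mu: "space \<mu> = extensional {1..D}"
  by (auto simp: torus_uniform_def space_PiM PiE_def)

lemma measurable_mu_component [measurable]:
  assumes "f \<in> N \<rightarrow>\<^sub>M \<mu>" "c \<in> {1..D}"
  shows "(\<lambda>x. f x c) \<in> N \<rightarrow>\<^sub>M borel"
proof -
  have "(\<lambda>y. y c) \<in> \<mu> \<rightarrow>\<^sub>M borel"
    using assms(2) by (subst measurable_cong_sets[OF sets_mu refl]) (rule measurable_component_singleton)
  then show ?thesis using assms(1) by (rule measurable_compose[rotated])
qed

definition near :: "point \<Rightarrow> point \<Rightarrow> bool" where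
  "near x y \<longleftrightarrow> (\<forall>c\<in>{1..D}. circle_norm (x c - y c) \<le> r)"

text \<open>The restriction puts the sum into the space of \<open>\<mu>\<close> for arbitrary
  arguments. So the constant function \<open>\<lambda>_. 0\<close> can serve as origin although it
  need not be a point of that space.\<close>

definition tadd :: "point \<Rightarrow> point \<Rightarrow> point" where
  "tadd x y = (\<lambda>c\<in>{1..D}. x c + y c)"

definition sep :: "point \<Rightarrow> point \<Rightarrow> point set" where
  "sep x y = {w \<in> space \<mu>. near x w \<noteq> near y w}"

definition sepvol :: "point \<Rightarrow> real" where
  "sepvol u = measure \<mu> (sep (\<lambda>_. 0) u)"

abbreviation near0 :: "point \<Rightarrow> bool" where "near0 u \<equiv> near (\<lambda>_. 0) u"

lemma torus_dist_le_iff: "torus_dist D x y \<le> r \<longleftrightarrow> near x y"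
  unfolding torus_dist_def near_def using D by (subst Max_le_iff) auto

lemma near_refl: "near x x" using r by (simp add: near_def)

lemma near_commute: "near x y \<longleftrightarrow> near y x"
  by (simp add: near_def circle_norm_minus_commute)

lemma near_tadd: "near (tadd z x) (tadd z y) \<longleftrightarrow> near x y"
  by (simp add: near_def tadd_def)

lemma near_tadd_right: "near z (tadd z y) \<longleftrightarrow> near0 y"
  by (simp add: near_def tadd_def)

lemma tadd_commute: "tadd x y = tadd y x" by (simp add: tadd_def add.commute)

lemma tadd_assoc: "tadd (tadd x y) z = tadd x (tadd y z)" by (simp add: tadd_def add.assoc restrict_def fun_eq_iff)

lemma near_measurable [measurable]:
  assumes [measurable]: "f \<in> N \<rightarrow>\<^sub>M \<mu>" "g \<in> N \<rightarrow>\<^sub>M \<mu>"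
  shows "Measurable.pred N (\<lambda>x. near (f x) (g x))"
  unfolding near_def by measurable

lemma near0_measurable [measurable]:
  assumes [measurable]: "f \<in> N \<rightarrow>\<^sub>M \<mu>"
  shows "Measurable.pred N (\<lambda>x. near0 (f x))"
  unfolding near_def by measurable

lemma near_measurable1 [measurable]:
  assumes [measurable]: "f \<in> N \<rightarrow>\<^sub>M \<mu>"
  shows "Measurable.pred N (\<lambda>x. near z (f x))" "Measurable.pred N (\<lambda>x. near (f x) z)"
  unfolding near_def by measurable

lemma tadd_measurable [measurable]:
  assumes [measurable]: "f \<in> N \<rightarrow>\<^sub>M \<mu>" "g \<in> N \<rightarrow>\<^sub>M \<mu>"
  shows "(\<lambda>x. tadd (f x) (g x)) \<in> N \<rightarrow>\<^sub>M \<mu>"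
  unfolding tadd_def by (subst measurable_cong_sets[OF refl sets_mu]) measurable

lemma tadd_measurable1 [measurable]:
  assumes [measurable]: "g \<in> N \<rightarrow>\<^sub>M \<mu>"
  shows "(\<lambda>x. tadd z (g x)) \<in> N \<rightarrow>\<^sub>M \<mu>" "(\<lambda>x. tadd (g x) z) \<in> N \<rightarrow>\<^sub>M \<mu>"
  unfolding tadd_def by (subst measurable_cong_sets[OF refl sets_mu], measurable)+

lemma sep_sets [measurable]: "sep x y \<in> sets \<mu>"
  unfolding sep_def by measurable

end

text \<open>Used on two levels: to translate a single point coordinate by coordinate, and to
  translate all partners in a cluster by their base points.\<close>

lemma distr_PiM_coordinatewise:
  assumes I: "finite I"
    and M: "\<And>i. prob_space (M i)"
    and f: "\<And>i. i \<in> I \<Longrightarrow> distr (M i) (M i) (f i) = M i" "\<And>i. i \<in> I \<Longrightarrow> f i \<in> M i \<rightarrow>\<^sub>M M i"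
  shows "distr (PiM I M) (PiM I M) (\<lambda>x. \<lambda>i\<in>I. f i (x i)) = PiM I M"
proof -
  let ?P = "PiM I M" and ?F = "\<lambda>x. \<lambda>i\<in>I. f i (x i)"
  interpret product_prob_space M by (rule product_prob_spaceI) (rule M)
  note f(2)[measurable]
  show ?thesis
  proof (rule PiM_eqI)
    fix A assume A: "\<And>i. i \<in> I \<Longrightarrow> A i \<in> sets (M i)"
    have "emeasure (distr ?P ?P ?F) (Pi\<^sub>E I A)
        = emeasure ?P (?F -` Pi\<^sub>E I A \<inter> space ?P)"
      using A I by (intro emeasure_distr sets_PiM_I_finite) auto
    also have "?F -` Pi\<^sub>E I A \<inter> space ?P = Pi\<^sub>E I (\<lambda>i. f i -` A i \<inter> space (M i))"
      by (auto simp: space_PiM PiE_iff)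
    also have "emeasure ?P \<dots> = (\<Prod>i\<in>I. emeasure (M i) (f i -` A i \<inter> space (M i)))"
      using A I f(2) by (intro emeasure_PiM) auto
    also have "\<dots> = (\<Prod>i\<in>I. emeasure (M i) (A i))"
      using A f by (intro prod.cong refl) (metis emeasure_distr)
    finally show "emeasure (distr ?P ?P ?F) (Pi\<^sub>E I A) = (\<Prod>i\<in>I. emeasure (M i) (A i))" .
  qed (use I in auto)
qed

context torus_box begin

lemma distr_mu_tadd: "distr \<mu> \<mu> (tadd x) = \<mu>"
  unfolding torus_uniform_def tadd_def
  using distr_PiM_coordinatewise[where I="{1..D}" and M="\<lambda>_. circle_uniform" and f="\<lambda>c. (+) (x c)"]
  by (simp add: distr_circle_uniform_add prob_space_circle_uniform)

lemma measure_mu_tadd: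
  assumes "A \<in> sets \<mu>"
  shows "measure \<mu> {w \<in> space \<mu>. tadd z w \<in> A} = measure \<mu> A"
proof -
  have "measure (distr \<mu> \<mu> (tadd z)) A = measure \<mu> (tadd z -` A \<inter> space \<mu>)"
    using assms by (intro measure_distr) auto
  then show ?thesis by (simp add: distr_mu_tadd vimage_def Int_def conj_commute)
qed

lemma tadd_in_space [simp]: "tadd x y \<in> space \<mu>" by (simp add: tadd_def space_mu)

lemma measure_sep: "measure \<mu> (sep z (tadd z u)) = sepvol u"
proof -
  have "sepvol u = measure \<mu> {w \<in> space \<mu>. tadd z w \<in> sep z (tadd z u)}"
    unfolding sepvol_def by (intro arg_cong[where f="measure \<mu>"]) (auto simp: sep_def near_tadd near_tadd_right)
  then show ?thesis by (simp add: measure_mu_tadd)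
qed

text \<open>Here the base point is random and w is fixed. Since \<open>near\<close> is symmetric and
  translation invariant, replacing z by w + z removes w from the condition, and a translation by u
  turns it into membership in the separating set of 0 and u. This allows base points to be
  integrated out first.\<close>

lemma measure_sep_base:
  assumes "w \<in> space \<mu>"
  shows "measure \<mu> {z \<in> space \<mu>. w \<in> sep z (tadd z u)} = sepvol u"
proof -
  have "near (tadd w z) w = near0 z" for z
    by (metis near_commute near_tadd_right)
  then have "measure \<mu> {z \<in> space \<mu>. w \<in> sep z (tadd z u)} = measure \<mu> {z \<in> space \<mu>. near0 z \<noteq> near0 (tadd u z)}"
    using assms by (subst measure_mu_tadd[symmetric, where z=w])
       (auto simp: sep_def tadd_assoc near_commute[of _ w] near_tadd_right tadd_commute[of u]  intro!: arg_cong[where f="measure \<mu>"])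
  also have "\<dots> = measure \<mu> {w \<in> space \<mu>. tadd u w \<in> sep (\<lambda>_. 0) u}"
    by (intro arg_cong[where f="measure \<mu>"]) (auto simp: sep_def near_tadd_right)
  also have "\<dots> = sepvol u" by (simp add: measure_mu_tadd sepvol_def)
  finally show ?thesis .
qed

lemma sepvol_bounds: "0 \<le> sepvol u" "sepvol u \<le> 1"
  by (auto simp: sepvol_def)

lemma sepvol_measurable [measurable]:
  assumes [measurable]: "f \<in> N \<rightarrow>\<^sub>M \<mu>"
  shows "(\<lambda>x. sepvol (f x)) \<in> borel_measurable N"
proof -
  have "(\<lambda>u. measure \<mu> {w \<in> space \<mu>. near0 w \<noteq> near u w}) \<in> borel_measurable \<mu>"
    by (rule measure_section_measurable[OF mu.finite_measure_axioms]) measurable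
  then have "sepvol \<in> borel_measurable \<mu>" unfolding sepvol_def sep_def .
  then show ?thesis by measurable
qed

lemma measure_mu_box:
  assumes "\<And>c. c \<in> {1..D} \<Longrightarrow> A c \<in> sets borel"
  shows "measure \<mu> {w \<in> space \<mu>. \<forall>c\<in>{1..D}. w c \<in> A c} = (\<Prod>c\<in>{1..D}. measure circle_uniform (A c))"
proof -
  interpret product_prob_space "\<lambda>_::nat. circle_uniform"
    by (rule product_prob_spaceI) (rule prob_space_circle_uniform)
  have eq: "{w \<in> space \<mu>. \<forall>c\<in>{1..D}. w c \<in> A c} = Pi\<^sub>E {1..D} A"
    by (auto simp: space_mu PiE_def)
  have "emeasure \<mu> (Pi\<^sub>E {1..D} A) = (\<Prod>c\<in>{1..D}. emeasure circle_uniform (A c))"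
    unfolding torus_uniform_def using assms by (intro emeasure_PiM) auto
  also have "\<dots> = ennreal (\<Prod>c\<in>{1..D}. measure circle_uniform (A c))"
    unfolding circle_uniform.emeasure_eq_measure by (rule prod_ennreal) simp
  finally show ?thesis
    unfolding eq by (intro measure_eq_emeasure_eq_ennreal prod_nonneg) auto
qed

text \<open>A symmetric difference of two boxes of volume \<open>(2 r)^D\<close> each. Their
  intersection is a product of overlaps of arcs, and \<open>near0 u\<close> provides the bound on
  the centers that \<open>measure_two_arcs\<close> asks for.\<close>

lemma sepvol_eq:
  assumes u: "near0 u"
  shows "sepvol u = 2 * ((2 * r) ^ D - (\<Prod>c\<in>{1..D}. 2 * r - min (circle_norm (u c)) (1 - 2 * r)))"
proof -
  let ?A = "{w \<in> space \<mu>. near0 w}" and ?B = "{w \<in> space \<mu>. near u w}"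
  have A: "measure \<mu> ?A = (2 * r) ^ D"
  proof -
    have "?A = {w \<in> space \<mu>. \<forall>c\<in>{1..D}. w c \<in> {w. circle_norm w \<le> r}}"
      by (auto simp: near_def)
    then show ?thesis by (simp only:, subst measure_mu_box) (use r in \<open>auto simp: measure_arc\<close>)
  qed
  have B: "measure \<mu> ?B = (2 * r) ^ D"
    by (subst measure_mu_tadd[symmetric, where z=u]) (simp_all add: near_tadd_right A)
  have AB: "measure \<mu> (?A \<inter> ?B) = (\<Prod>c\<in>{1..D}. 2 * r - min (circle_norm (u c)) (1 - 2 * r))"
  proof -
    have eq: "?A \<inter> ?B = {w \<in> space \<mu>. \<forall>c\<in>{1..D}. w c \<in> {w. circle_norm w \<le> r \<and> circle_norm (w - u c) \<le> r}}"
      using near_commute[of u] by (simp add: near_def) blast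
    show ?thesis unfolding eq
      by (subst measure_mu_box) (use r u in \<open>auto simp: near_def measure_two_arcs intro!: prod.cong\<close>)
  qed
  have "sep (\<lambda>_. 0) u = (?A - ?B) \<union> (?B - ?A)" by (auto simp: sep_def)
  then have "sepvol u = measure \<mu> (?A - ?B) + measure \<mu> (?B - ?A)"
    unfolding sepvol_def by (simp only:, intro mu.finite_measure_Union) auto
  also have "\<dots> = (measure \<mu> ?A - measure \<mu> (?A \<inter> ?B)) + (measure \<mu> ?B - measure \<mu> (?B \<inter> ?A))"
    by (intro arg_cong2[where f="(+)"] mu.finite_measure_Diff') measurable
  finally show ?thesis by (simp add: A B AB Int_commute[of ?B])
qed

text \<open>\<open>min 1 ((1 - 2 * r) / r)\<close> is the largest c with
  \<open>min t (1 - 2 r) \<ge> c t\<close> on \<open>[0, r]\<close>. The division by D comes from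
  averaging D lower bounds, each of which uses a single coordinate.\<close>

definition kappa :: real where
  "kappa = 2 * (2 * r) ^ (D - 1) * min 1 ((1 - 2 * r) / r) / D"

lemma kappa_pos: "kappa > 0" using r D by (simp add: kappa_def)

lemma sepvol_ge:
  assumes u: "near0 u"
  shows "sepvol u \<ge> kappa * (\<Sum>c\<in>{1..D}. circle_norm (u c))"
proof -
  define m where "m c = min (circle_norm (u c)) (1 - 2 * r)" for c
  have m: "0 \<le> m c" "m c \<le> r" if "c \<in> {1..D}" for c
  proof -
    have "circle_norm (u c) \<le> r" using u that by (auto simp: near_def)
    then show "0 \<le> m c" "m c \<le> r"
      using r circle_norm_nonneg[of "u c"] unfolding m_def by linarith+
  qed
  have mge: "min 1 ((1 - 2 * r) / r) * circle_norm (u c) \<le> m c" if "c \<in> {1..D}" for c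
  proof -
    have t: "0 \<le> circle_norm (u c)" "circle_norm (u c) \<le> r"
      using u that circle_norm_nonneg[of "u c"] by (auto simp: near_def)
    have "min 1 ((1 - 2 * r) / r) * circle_norm (u c) \<le> 1 * circle_norm (u c)"
      using t by (intro mult_right_mono) auto
    moreover have "min 1 ((1 - 2 * r) / r) * circle_norm (u c) \<le> ((1 - 2 * r) / r) * r"
      using t r by (intro mult_mono) auto
    ultimately show ?thesis using r by (simp add: m_def)
  qed
  \<comment> \<open>Only the factor of coordinate c is kept; all others are bounded by
    \<open>2 r\<close>.\<close>
  have single: "(2 * r) ^ (D - 1) * m c \<le> (2 * r) ^ D - (\<Prod>c\<in>{1..D}. 2 * r - m c)" if c: "c \<in> {1..D}" for c
  proof -
    have "(\<Prod>c\<in>{1..D}. 2 * r - m c) = (2 * r - m c) * (\<Prod>c\<in>{1..D} - {c}. 2 * r - m c)"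
      using c by (intro prod.remove) auto
    also have "\<dots> \<le> (2 * r - m c) * (\<Prod>c\<in>{1..D} - {c}. 2 * r)"
    proof (intro mult_left_mono prod_mono conjI)
      show "0 \<le> 2 * r - m c" using m[OF c] r by linarith
      fix d assume "d \<in> {1..D} - {c}"
      with m[of d] r show "0 \<le> 2 * r - m d" "2 * r - m d \<le> 2 * r" by auto
    qed
    also have "\<dots> = (2 * r) ^ D - (2 * r) ^ (D - 1) * m c"
      using c D by (simp add: algebra_simps flip: power_Suc)
    finally show ?thesis by simp
  qed
  have "kappa * (\<Sum>c\<in>{1..D}. circle_norm (u c)) = 2 * (2 * r) ^ (D - 1) / D * (\<Sum>c\<in>{1..D}. min 1 ((1 - 2 * r) / r) * circle_norm (u c))"
    by (simp add: kappa_def flip: sum_distrib_left)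
  also have "\<dots> \<le> 2 * (2 * r) ^ (D - 1) / D * (\<Sum>c\<in>{1..D}. m c)"
    using mge r by (intro mult_left_mono sum_mono) auto
  also have "\<dots> = 2 / D * (\<Sum>c\<in>{1..D}. (2 * r) ^ (D - 1) * m c)"
    by (simp flip: sum_distrib_left)
  also have "\<dots> \<le> 2 / D * (\<Sum>c\<in>{1..D}. (2 * r) ^ D - (\<Prod>c\<in>{1..D}. 2 * r - m c))"
    using single by (intro mult_left_mono sum_mono) auto
  also have "\<dots> = sepvol u"
    using D by (simp add: sepvol_eq[OF u] m_def)
  finally show ?thesis .
qed

end

section \<open>Rescaled integrals over the torus\<close>

lemma shifted_ratio_limit: "(\<lambda>m. real (m + c) / real m) \<longlonglongrightarrow> 1"
proof (rule Lim_transform_eventually)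
  have "(\<lambda>m. 1 + real c / real m) \<longlonglongrightarrow> 1 + 0" by (intro tendsto_add tendsto_const lim_const_over_n)
  then show "(\<lambda>m. 1 + real c / real m) \<longlonglongrightarrow> 1" by simp
  show "\<forall>\<^sub>F m in sequentially. 1 + real c / real m = real (m + c) / real m"
    using eventually_gt_at_top[of 0] by eventually_elim (simp add: field_simps)
qed

section \<open>Product densities, the Laplace integral and first-order limits\<close>

lemma density_PiM:
  assumes I: "finite I" and M: "sigma_finite_measure M" and g[measurable]: "g \<in> borel_measurable M"
    and Mg: "sigma_finite_measure (density M g)"
  shows "density (PiM I (\<lambda>_. M)) (\<lambda>x. \<Prod>i\<in>I. g (x i)) = PiM I (\<lambda>_. density M g)"
proof -
  interpret M: product_sigma_finite "\<lambda>_. M" by (rule product_sigma_finite.intro) (rule M)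
  interpret N: product_sigma_finite "\<lambda>_. density M g" by (rule product_sigma_finite.intro) (rule Mg)
  show ?thesis
  proof (rule N.PiM_eqI)
    show "sets (density (PiM I (\<lambda>_. M)) (\<lambda>x. \<Prod>i\<in>I. g (x i))) = sets (PiM I (\<lambda>_. density M g))"
      by (simp cong: sets_PiM_cong)
    fix A assume A: "\<And>i. i \<in> I \<Longrightarrow> A i \<in> sets (density M g)"
    then have [measurable]: "\<And>i. i \<in> I \<Longrightarrow> A i \<in> sets M" by simp
    have "emeasure (density (PiM I (\<lambda>_. M)) (\<lambda>x. \<Prod>i\<in>I. g (x i))) (Pi\<^sub>E I A)
       = (\<integral>\<^sup>+ x. (\<Prod>i\<in>I. g (x i)) * indicator (Pi\<^sub>E I A) x \<partial>PiM I (\<lambda>_. M))"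
      using I by (intro emeasure_density sets_PiM_I_finite) measurable
    also have "\<dots> = (\<integral>\<^sup>+ x. (\<Prod>i\<in>I. g (x i) * indicator (A i) (x i)) \<partial>PiM I (\<lambda>_. M))"
    proof (intro nn_integral_cong)
      fix x assume x: "x \<in> space (PiM I (\<lambda>_. M))"
      have "indicator (Pi\<^sub>E I A) x = (\<Prod>i\<in>I. indicator (A i) (x i) :: ennreal)"
      proof (cases "x \<in> Pi\<^sub>E I A")
        case True
        then have "(\<Prod>i\<in>I. indicator (A i) (x i) :: ennreal) = (\<Prod>i\<in>I. 1)"
          by (intro prod.cong) (auto simp: PiE_mem)
        with True show ?thesis by simp
      next
        case False
        then obtain i where "i \<in> I" "x i \<notin> A i" using x by (auto simp: space_PiM PiE_iff)
        with False I show ?thesis by (auto simp: indicator_def intro!: prod_zero[symmetric])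
      qed
      then show "(\<Prod>i\<in>I. g (x i)) * indicator (Pi\<^sub>E I A) x = (\<Prod>i\<in>I. g (x i) * indicator (A i) (x i))"
        by (simp add: prod.distrib)
    qed
    also have "\<dots> = (\<Prod>i\<in>I. \<integral>\<^sup>+ x. g x * indicator (A i) x \<partial>M)"
      using I by (intro M.product_nn_integral_prod) auto
    also have "\<dots> = (\<Prod>i\<in>I. emeasure (density M g) (A i))"
      by (intro prod.cong refl emeasure_density[symmetric]) auto
    finally show "emeasure (density (PiM I (\<lambda>_. M)) (\<lambda>x. \<Prod>i\<in>I. g (x i))) (Pi\<^sub>E I A)
       = (\<Prod>i\<in>I. emeasure (density M g) (A i))" .
  qed (rule I)
qed

text \<open>The half line contributes the total mass of the exponential distribution divided by its
  rate; evenness doubles it.\<close>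

lemma has_bochner_integral_exp_abs:
  fixes \<beta> :: real
  assumes "\<beta> > 0"
  shows "has_bochner_integral lborel (\<lambda>t. exp (- \<beta> * \<bar>t\<bar>)) (2 / \<beta>)"
proof -
  have "emeasure (density lborel (exponential_density \<beta>)) UNIV = 1"
    using prob_space.emeasure_space_1[OF prob_space_exponential_density[OF assms]] by simp
  then have "(\<integral>\<^sup>+ x. ennreal (exponential_density \<beta> x) \<partial>lborel) = ennreal 1"
    by (simp add: emeasure_density)
  then have "has_bochner_integral lborel (exponential_density \<beta>) 1"
    using assms by (intro has_bochner_integral_nn_integral) (auto simp: exponential_density_nonneg)
  then have "has_bochner_integral lborel (\<lambda>x. (1 / \<beta>) * exponential_density \<beta> x) ((1 / \<beta>) * 1)"
    by (rule has_bochner_integral_mult_right)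
  also have "(\<lambda>x. (1 / \<beta>) * exponential_density \<beta> x) = (\<lambda>x. indicator {0..} x *\<^sub>R exp (- \<beta> * \<bar>x\<bar>))"
    using assms by (auto simp: exponential_density_def fun_eq_iff)
  finally show ?thesis
    using has_bochner_integral_even_function[of "\<lambda>t. exp (- \<beta> * \<bar>t\<bar>)" "(1 / \<beta>) * 1"] by simp
qed

lemma has_bochner_integral_prod_exp_abs:
  fixes \<beta> :: real
  assumes "\<beta> > 0" "finite I"
  shows "has_bochner_integral (PiM I (\<lambda>_. lborel)) (\<lambda>v. \<Prod>i\<in>I. exp (- \<beta> * \<bar>v i\<bar>)) ((2 / \<beta>) ^ card I)"
proof -
  interpret product_sigma_finite "\<lambda>_. lborel :: real measure"
    by (rule product_sigma_finite.intro) (rule lborel.sigma_finite_measure_axioms)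
  note h = has_bochner_integral_exp_abs[OF assms(1), unfolded has_bochner_integral_iff]
  show ?thesis
    unfolding has_bochner_integral_iff
  proof
    show "integrable (PiM I (\<lambda>_. lborel)) (\<lambda>v. \<Prod>i\<in>I. exp (- \<beta> * \<bar>v i\<bar>))"
      by (rule product_integrable_prod) (use h assms(2) in auto)
    have "(\<integral>v. (\<Prod>i\<in>I. exp (- \<beta> * \<bar>v i\<bar>)) \<partial>PiM I (\<lambda>_. lborel)) = (\<Prod>i\<in>I. \<integral>t. exp (- \<beta> * \<bar>t\<bar>) \<partial>lborel)"
      by (rule product_integral_prod) (use h assms(2) in auto)
    then show "(\<integral>v. (\<Prod>i\<in>I. exp (- \<beta> * \<bar>v i\<bar>)) \<partial>PiM I (\<lambda>_. lborel)) = (2 / \<beta>) ^ card I"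
      using h by simp
  qed
qed

text \<open>Centered at 0, so that on the support \<open>|v| / N\<close> is the circle norm of the
  projected point.\<close>

abbreviation centered_uniform :: "real \<Rightarrow> real measure" where
  "centered_uniform N \<equiv> density lborel (\<lambda>v. ennreal (indicator {-N/2..<N/2} v / N))"

lemma circle_uniform_eq_distr:
  fixes N :: real
  assumes N: "N > 0"
  shows "circle_uniform = distr (centered_uniform N) borel (\<lambda>v. abs_circle (v / N))"
proof (rule measure_eqI)
  fix A assume "A \<in> sets circle_uniform"
  then have A[measurable]: "A \<in> sets borel" by simp
  let ?k = "\<lambda>v. ennreal (indicator {-N/2..<N/2} v / N) * indicator {v. abs_circle (v / N) \<in> A} v"
  have "emeasure (distr (centered_uniform N) borel (\<lambda>v. abs_circle (v / N))) A
     = emeasure (centered_uniform N) {v. abs_circle (v / N) \<in> A}"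
    by (subst emeasure_distr) (auto simp: vimage_def)
  also have "\<dots> = (\<integral>\<^sup>+ v. ?k v \<partial>lborel)"
    by (rule emeasure_density) measurable
  also have "\<dots> = ennreal \<bar>N\<bar> * (\<integral>\<^sup>+ v. ?k (0 + N * v) \<partial>lborel)"
    using N by (intro nn_integral_real_affine) measurable
  also have "\<dots> = (\<integral>\<^sup>+ v. ennreal N * ?k (0 + N * v) \<partial>lborel)"
    using N by (subst nn_integral_cmult) auto
  also have "\<dots> = (\<integral>\<^sup>+ v. indicator {v \<in> {-1/2..<-1/2+1}. abs_circle v \<in> A} v \<partial>lborel)"
  proof (intro nn_integral_cong)
    fix v :: real
    have "N * v \<in> {-N/2..<N/2} \<longleftrightarrow> v \<in> {-1/2..<-1/2+1}"
      using mult_le_cancel_left_pos[OF N, of "-1/2" v] mult_less_cancel_left_pos[OF N, of v "1/2"] by simp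
    moreover have "ennreal N * ennreal (1 / N) = 1" using N by (simp flip: ennreal_mult)
    ultimately show "ennreal N * ?k (0 + N * v)
       = indicator {v \<in> {-1/2..<-1/2+1}. abs_circle v \<in> A} v"
      using N by (auto simp: indicator_def)
  qed
  also have "\<dots> = emeasure lborel {v \<in> {-1/2..<-1/2+1}. abs_circle v \<in> A}"
    by (rule nn_integral_indicator) measurable
  also have "\<dots> = emeasure circle_uniform A" by (rule emeasure_circle_uniform[symmetric]) measurable
  finally show "emeasure circle_uniform A = emeasure (distr (centered_uniform N) borel (\<lambda>v. abs_circle (v / N))) A"
    by simp
qed simp

lemma prob_space_density_interval:
  fixes N :: real
  assumes N: "N > 0"
  shows "prob_space (centered_uniform N)"
proof (rule prob_spaceI)
  have "emeasure (distr (centered_uniform N) borel (\<lambda>v. abs_circle (v / N))) UNIV = 1"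
    using circle_uniform.emeasure_space_1 circle_uniform_eq_distr[OF N] by simp
  then show "emeasure (centered_uniform N)
     (space (centered_uniform N)) = 1"
    by (subst (asm) emeasure_distr) auto
qed

text \<open>For numbers of modulus at most 1, the m-th powers differ by at most m times the
  difference of the bases. Comparing with \<open>(1 - a / m) ^ m\<close> therefore costs only
  \<open>|m * b m - a|\<close>.\<close>

lemma power_exp_limit:
  fixes b :: "nat \<Rightarrow> real"
  assumes b: "\<And>m. 0 \<le> b m" "\<And>m. b m \<le> 1" and a: "0 \<le> a" and lim: "(\<lambda>m. real m * b m) \<longlonglongrightarrow> a"
  shows "(\<lambda>m. (1 - b m) ^ m) \<longlonglongrightarrow> exp (- a)"
proof (rule Lim_transform)
  show "(\<lambda>m. (1 + (- a) / real m) ^ m) \<longlonglongrightarrow> exp (- a)" by (rule tendsto_exp_limit_sequentially)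
  show "(\<lambda>m. (1 - b m) ^ m - (1 + (- a) / real m) ^ m) \<longlonglongrightarrow> 0"
  proof (rule Lim_null_comparison)
    have "(\<lambda>m. real m * b m - a) \<longlonglongrightarrow> 0" using tendsto_diff[OF lim tendsto_const[of a]] by simp
    then show "(\<lambda>m. \<bar>real m * b m - a\<bar>) \<longlonglongrightarrow> 0" by (rule tendsto_rabs_zero)
    show "\<forall>\<^sub>F m in sequentially. norm ((1 - b m) ^ m - (1 + (- a) / real m) ^ m) \<le> \<bar>real m * b m - a\<bar>"
      using eventually_ge_at_top[of "Suc (nat \<lceil>a\<rceil>)"]
    proof eventually_elim
      case (elim m)
      \<comment> \<open>\<open>m \<ge> a\<close> puts \<open>1 - a / m\<close> into [0, 1], as the
        estimate for powers demands.\<close>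
      then have m: "m > 0" "a \<le> real m" by linarith+
      have "norm ((1 - b m) ^ m - (1 + (- a) / real m) ^ m) \<le> real m * norm ((1 - b m) - (1 + (- a) / real m))"
      proof (rule norm_power_diff)
        show "norm (1 - b m) \<le> 1" using b[of m] by auto
        show "norm (1 + (- a) / real m) \<le> 1" using a m by (auto simp: field_simps abs_le_iff)
      qed
      also have "\<dots> = \<bar>real m * ((1 - b m) - (1 + (- a) / real m))\<bar>" by (simp add: abs_mult)
      also have "real m * ((1 - b m) - (1 + (- a) / real m)) = - (real m * b m - a)"
        using m by (simp add: field_simps)
      finally show ?case by simp
    qed
  qed
qed

text \<open>First-order expansion of a product, proved one factor at a time. With P the product over
  I and k its cardinality, \<open>N (a^(k+1) - (a - f j / N) P) = (a - f j / N) N (a^k - P) + a^k f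
  j\<close>.\<close>

lemma prod_diff_limit:
  fixes f :: "'i \<Rightarrow> real"
  assumes "finite I" and N: "filterlim N at_top sequentially"
  shows "(\<lambda>m. N m * (a ^ card I - (\<Prod>i\<in>I. a - f i / N m))) \<longlonglongrightarrow> a ^ (card I - 1) * (\<Sum>i\<in>I. f i)"
  using assms(1)
proof induction
  case empty
  then show ?case by simp
next
  case (insert j I)
  have Nn0: "\<forall>\<^sub>F m in sequentially. N m \<noteq> 0"
    using filterlim_at_top_dense[of N sequentially] N by (auto elim!: allE[of _ 0] eventually_mono)
  have "(\<lambda>m. f j / N m) \<longlonglongrightarrow> 0"
    by (rule tendsto_divide_0[OF tendsto_const]) (rule filterlim_at_top_imp_at_infinity[OF N])
  then have lim: "(\<lambda>m. (a - f j / N m) * (N m * (a ^ card I - (\<Prod>i\<in>I. a - f i / N m))) + a ^ card I * f j)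
      \<longlonglongrightarrow> (a - 0) * (a ^ (card I - 1) * (\<Sum>i\<in>I. f i)) + a ^ card I * f j"
    by (intro tendsto_intros insert.IH)
  have "(\<lambda>m. N m * (a ^ card (insert j I) - (\<Prod>i\<in>insert j I. a - f i / N m)))
      \<longlonglongrightarrow> (a - 0) * (a ^ (card I - 1) * (\<Sum>i\<in>I. f i)) + a ^ card I * f j"
    using lim
  proof (rule Lim_transform_eventually)
    show "\<forall>\<^sub>F m in sequentially. (a - f j / N m) * (N m * (a ^ card I - (\<Prod>i\<in>I. a - f i / N m))) + a ^ card I * f j
       = N m * (a ^ card (insert j I) - (\<Prod>i\<in>insert j I. a - f i / N m))"
      using Nn0 by eventually_elim (use insert.hyps in \<open>simp add: field_simps\<close>)
  qed
  also have "(a - 0) * (a ^ (card I - 1) * (\<Sum>i\<in>I. f i)) + a ^ card I * f j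
     = a ^ (card (insert j I) - 1) * (\<Sum>i\<in>insert j I. f i)"
  \<comment> \<open>For empty I the truncated \<open>card I - 1\<close> is 0 and
    \<open>a * a ^ (card I - 1) = a ^ card I\<close> fails, but the sum it multiplies
    vanishes.\<close>
  proof (cases "I = {}")
    case False
    then have "card I > 0" using insert.hyps by (simp add: card_gt_0_iff)
    then have "a * a ^ (card I - 1) = a ^ card I" by (simp flip: power_Suc)
    then show ?thesis using insert.hyps by (simp add: algebra_simps flip: mult.assoc)
  qed (use insert.hyps in simp)
  finally show ?case .
qed

context torus_box begin

abbreviation LD :: "(nat \<Rightarrow> real) measure" where "LD \<equiv> PiM {1..D} (\<lambda>_. lborel)"

definition blowup :: "real \<Rightarrow> (nat \<Rightarrow> real) \<Rightarrow> point" where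
  "blowup N v = (\<lambda>c\<in>{1..D}. abs_circle (v c / N))"

definition window :: "real \<Rightarrow> (nat \<Rightarrow> real) \<Rightarrow> real" where
  "window N v = (\<Prod>c\<in>{1..D}. indicator {-N/2..<N/2} (v c))"

text \<open>The substitution u = v / N: the D window densities multiply to
  \<open>window N v / N ^ D\<close>, and the factor on the left cancels the denominator.\<close>

lemma integral_mu_rescale:
  fixes F :: "point \<Rightarrow> real"
  assumes [measurable]: "F \<in> borel_measurable \<mu>" and N: "(N::real) > 0"
  shows "N ^ D * (\<integral>u. F u \<partial>\<mu>) = (\<integral>v. window N v * F (blowup N v) \<partial>LD)"
proof -
  let ?g = "\<lambda>v. ennreal (indicator {-N/2..<N/2} v / N)"
  let ?\<nu> = "density lborel ?g"
  let ?h = "\<lambda>v. abs_circle (v / N)"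
  let ?w = "\<lambda>v. \<Prod>c\<in>{1..D}. indicator {-N/2..<N/2} (v c) / N"
  let ?Q = "density LD (\<lambda>v. ennreal (?w v))"
  have b: "compose {1..D} ?h = blowup N" by (simp add: compose_def blowup_def fun_eq_iff)
  have h[measurable]: "?h \<in> ?\<nu> \<rightarrow>\<^sub>M borel" by measurable
  have h': "?h \<in> ?\<nu> \<rightarrow>\<^sub>M circle_uniform"
    using h by (simp cong: measurable_cong_sets)
  have "\<mu> = PiM {1..D} (\<lambda>_. distr ?\<nu> circle_uniform ?h)"
    unfolding torus_uniform_def
    by (intro PiM_cong refl) (subst circle_uniform_eq_distr[OF N], intro distr_cong, auto)
  also have "\<dots> = distr (PiM {1..D} (\<lambda>_. ?\<nu>)) (PiM {1..D} (\<lambda>_. circle_uniform)) (compose {1..D} ?h)"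
    by (rule distr_PiM_finite_prob_space'[symmetric])
       (rule finite_atLeastAtMost prob_space_density_interval[OF N] prob_space_circle_uniform h')+
  also have "PiM {1..D} (\<lambda>_. ?\<nu>) = density LD (\<lambda>v. \<Prod>c\<in>{1..D}. ?g (v c))"
    by (intro density_PiM[symmetric] lborel.sigma_finite_measure_axioms prob_space_imp_sigma_finite prob_space_density_interval N) auto
  also have "(\<lambda>v::nat\<Rightarrow>real. \<Prod>c\<in>{1..D}. ?g (v c)) = (\<lambda>v. ennreal (?w v))"
    using N by (simp add: prod_ennreal)
  finally have mu: "\<mu> = distr ?Q \<mu> (blowup N)" by (simp only: torus_uniform_def b)
  have m[measurable]: "blowup N \<in> LD \<rightarrow>\<^sub>M \<mu>"
    unfolding blowup_def by (subst measurable_cong_sets[OF refl sets_mu]) measurable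
  have "(\<integral>u. F u \<partial>\<mu>) = (\<integral>v. F (blowup N v) \<partial>?Q)"
    by (subst mu, rule integral_distr) (use m in auto)
  also have "\<dots> = (\<integral>v. ?w v *\<^sub>R F (blowup N v) \<partial>LD)"
  proof (rule integral_density)
    show "(\<lambda>v. F (blowup N v)) \<in> borel_measurable LD"
      by (rule measurable_compose[OF m assms(1)])
    show "AE v in LD. 0 \<le> ?w v"
      using N by (intro AE_I2 prod_nonneg) auto
  qed measurable
  finally have "N ^ D * (\<integral>u. F u \<partial>\<mu>) = (\<integral>v. N ^ D * (?w v *\<^sub>R F (blowup N v)) \<partial>LD)"
    by simp
  also have "\<dots> = (\<integral>v. window N v * F (blowup N v) \<partial>LD)"
    using N by (intro Bochner_Integration.integral_cong refl) (simp add: window_def prod_dividef)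
  finally show ?thesis .
qed

end

section \<open>Asymptotics for one prescribed pair\<close>

context torus_box begin

text \<open>The probability that two independent uniform points are adjacent and that none of m
  further independent points separates them.\<close>

definition phi :: "nat \<Rightarrow> real" where
  "phi m = (\<integral>u. (if near0 u then (1 - sepvol u) ^ m else 0) \<partial>\<mu>)"

text \<open>Exponential majorant of \<open>phi\<close>; its parameter is real because the error
  terms carry exponents such as \<open>m / (4 k)\<close>.\<close>

definition psi :: "real \<Rightarrow> real" where
  "psi x = (\<integral>u. (if near0 u then exp (- x * sepvol u) else 0) \<partial>\<mu>)"

abbreviation laplace :: "real \<Rightarrow> (nat \<Rightarrow> real) \<Rightarrow> real" where
  "laplace b v \<equiv> \<Prod>c\<in>{1..D}. exp (- b * \<bar>v c\<bar>)"

lemma laplace_integral: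
  assumes "b > 0"
  shows "integrable LD (laplace b)" "(\<integral>v. laplace b v \<partial>LD) = (2 / b) ^ D"
  using has_bochner_integral_prod_exp_abs[OF assms, of "{1..D}"] unfolding has_bochner_integral_iff by auto

lemma window_cases:
  assumes "N > 0"
  shows "window N v = 0 \<or> (window N v = 1 \<and> (\<forall>c\<in>{1..D}. circle_norm (blowup N v c) = \<bar>v c\<bar> / N))"
proof (cases "\<forall>c\<in>{1..D}. v c \<in> {-N/2..<N/2}")
  case True
  then have "circle_norm (blowup N v c) = \<bar>v c\<bar> / N" if "c \<in> {1..D}" for c
  proof -
    have "\<bar>v c / N\<bar> \<le> 1/2" using True that assms by (force simp: abs_le_iff field_simps)
    then show ?thesis using that assms by (simp add: blowup_def circle_norm_eq_abs)
  qed
  moreover have "window N v = (\<Prod>c\<in>{1..D}. 1)"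
    unfolding window_def by (intro prod.cong refl) (use True in auto)
  ultimately show ?thesis by simp
next
  case False
  then show ?thesis by (auto simp: window_def indicator_def)
qed

lemma near0_iff: "near0 u \<longleftrightarrow> (\<forall>c\<in>{1..D}. circle_norm (u c) \<le> r)"
  by (simp add: near_def)

text \<open>Inside the window the circle norms are \<open>|v c| / N\<close>, so
  \<open>sepvol_ge\<close> turns the exponent into a sum over coordinates. For x proportional to N
  the right-hand side does not depend on N.\<close>

lemma window_bound:
  assumes "N > 0" "x \<ge> 0"
  shows "window N v * (if near0 (blowup N v) then exp (- x * sepvol (blowup N v)) else 0)
      \<le> laplace (x * kappa / N) v"
proof -
  consider "window N v = 0" | "window N v = 1" "\<forall>c\<in>{1..D}. circle_norm (blowup N v c) = \<bar>v c\<bar> / N"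
    using window_cases[OF assms(1)] by blast
  then show ?thesis
  proof cases
    case 1
    then show ?thesis by (simp add: prod_nonneg)
  next
    case 2
    show ?thesis
    proof (cases "near0 (blowup N v)")
      case True
      have "x * (kappa * (\<Sum>c\<in>{1..D}. \<bar>v c\<bar> / N)) \<le> x * sepvol (blowup N v)"
        using sepvol_ge[OF True] 2 assms by (intro mult_left_mono) auto
      then have "exp (- x * sepvol (blowup N v)) \<le> exp (- (x * (kappa * (\<Sum>c\<in>{1..D}. \<bar>v c\<bar> / N))))" by simp
      also have "- (x * (kappa * (\<Sum>c\<in>{1..D}. \<bar>v c\<bar> / N))) = (\<Sum>c\<in>{1..D}. - (x * kappa / N) * \<bar>v c\<bar>)"
        by (simp add: sum_distrib_left sum_negf mult_ac)
      finally show ?thesis using 2 True by (simp add: exp_sum)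
    qed (simp add: prod_nonneg)
  qed
qed

lemma psi_nonneg: "0 \<le> psi x"
  unfolding psi_def by (intro Bochner_Integration.integral_nonneg) auto

text \<open>For each fixed rate \<open>\<gamma>\<close>, an exponential weight at scale
  \<open>\<gamma> * N\<close> is worth a factor of order \<open>N^(-D)\<close> per pair. All error
  terms are measured against this.\<close>

lemma psi_bound:
  assumes "\<gamma> > 0" "N > 0"
  shows "N ^ D * psi (\<gamma> * N) \<le> (2 / (\<gamma> * kappa)) ^ D"
proof -
  have "N ^ D * psi (\<gamma> * N) = (\<integral>v. window N v * (if near0 (blowup N v) then exp (- (\<gamma> * N) * sepvol (blowup N v)) else 0) \<partial>LD)"
    unfolding psi_def by (rule integral_mu_rescale) (use assms in measurable)
  also have "\<dots> \<le> (\<integral>v. laplace (\<gamma> * kappa) v \<partial>LD)"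
  proof (rule integral_mono')
    show "integrable LD (\<lambda>v. laplace (\<gamma> * kappa) v)"
      using laplace_integral[of "\<gamma> * kappa"] assms kappa_pos by simp
    fix v
    show "window N v * (if near0 (blowup N v) then exp (- (\<gamma> * N) * sepvol (blowup N v)) else 0) \<le> laplace (\<gamma> * kappa) v"
      using window_bound[of N "\<gamma> * N" v] assms by (simp add: field_simps)
  qed (simp add: prod_nonneg)
  also have "\<dots> = (2 / (\<gamma> * kappa)) ^ D"
    using laplace_integral[of "\<gamma> * kappa"] assms kappa_pos by simp
  finally show ?thesis .
qed

definition slope :: real where "slope = 2 * (2 * r) ^ (D - 1)"

lemma slope_pos: "slope > 0" using r by (simp add: slope_def)

lemma one_minus_le_exp_power: "(1 - sepvol u) ^ m \<le> exp (- real m * sepvol u)"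
proof -
  have "(1 - sepvol u) ^ m \<le> exp (- sepvol u) ^ m"
    using sepvol_bounds[of u] exp_ge_add_one_self[of "- sepvol u"] by (intro power_mono) auto
  then show ?thesis by (simp flip: exp_of_nat_mult)
qed

text \<open>For fixed v, eventually v lies in the window and v / N is too small for the cap in
  \<open>sepvol_eq\<close>; then \<open>prod_diff_limit\<close> gives the limit of N times the
  volume. The scale \<open>m + q\<close> and the exponent m differ by q, which is harmless because
  the volume itself tends to 0.\<close>

lemma blowup_limit:
  shows "(\<lambda>m. window (real (m + q)) v * (if near0 (blowup (real (m + q)) v) then (1 - sepvol (blowup (real (m + q)) v)) ^ m else 0))
     \<longlonglongrightarrow> laplace slope v"
proof -
  let ?N = "\<lambda>m. real (m + q)"
  define S where "S = (\<Sum>c\<in>{1..D}. \<bar>v c\<bar>)"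
  define b where "b m = sepvol (blowup (?N m) v)" for m
  have Ntop: "filterlim ?N at_top sequentially"
    by (rule filterlim_compose[OF filterlim_real_sequentially filterlim_add_const_nat_at_top])
  \<comment> \<open>Coordinates below r make the point near 0, those below \<open>1 - 2 r\<close>
    leave the cap inactive, and \<open>e < 1/2\<close> puts v into the window.\<close>
  define e where "e = min r (1 - 2 * r)"
  have e: "e > 0" "e \<le> r" "e \<le> 1 - 2 * r" "e < 1/2" using r unfolding e_def by linarith+
  have "\<forall>\<^sub>F m in sequentially. ?N m \<ge> S / e + 1"
    using Ntop by (simp add: filterlim_at_top)
  then have ev: "\<forall>\<^sub>F m in sequentially. ?N m > 0 \<and> window (?N m) v = 1 \<and> near0 (blowup (?N m) v) \<and>
     b m = 2 * ((2 * r) ^ D - (\<Prod>c\<in>{1..D}. 2 * r - \<bar>v c\<bar> / ?N m))"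
  proof eventually_elim
    case (elim m)
    have S0: "S \<ge> 0" by (auto simp: S_def intro: sum_nonneg)
    then have N: "?N m > 0" using elim e by (smt (verit) divide_nonneg_pos)
    have "S / e < ?N m" using elim by simp
    then have "S < e * ?N m" using e by (simp add: field_simps)
    then have small: "\<bar>v c\<bar> < e * ?N m" if "c \<in> {1..D}" for c
      using member_le_sum[OF that, of "\<lambda>c. \<bar>v c\<bar>"] unfolding S_def by auto
    have small': "\<bar>v c\<bar> / ?N m < e" if "c \<in> {1..D}" for c
      using small[OF that] N by (simp add: field_simps)
    have w: "window (?N m) v = 1"
    proof -
      have "v c \<in> {- ?N m / 2..<?N m / 2}" if "c \<in> {1..D}" for c
      proof -
        have "e * ?N m \<le> 1/2 * ?N m" using e N by (intro mult_right_mono) auto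
        with small[OF that] show ?thesis by auto
      qed
      then have "window (?N m) v = (\<Prod>c\<in>{1..D}. 1)"
        unfolding window_def by (intro prod.cong refl) simp
      then show ?thesis by simp
    qed
    then have nrm: "circle_norm (blowup (?N m) v c) = \<bar>v c\<bar> / ?N m" if "c \<in> {1..D}" for c
      using window_cases[OF N, of v] that by auto
    have nr: "near0 (blowup (?N m) v)"
      unfolding near0_iff using nrm small' e by (smt (verit))
    have "b m = 2 * ((2 * r) ^ D - (\<Prod>c\<in>{1..D}. 2 * r - \<bar>v c\<bar> / ?N m))"
    proof -
      have "min (circle_norm (blowup (?N m) v c)) (1 - 2 * r) = \<bar>v c\<bar> / ?N m" if "c \<in> {1..D}" for c
        using nrm[OF that] small'[OF that] e by linarith
      then show ?thesis unfolding b_def sepvol_eq[OF nr] by simp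
    qed
    with N w nr show ?case by simp
  qed
  have "(\<lambda>m. ?N m * ((2 * r) ^ card {1..D} - (\<Prod>c\<in>{1..D}. 2 * r - \<bar>v c\<bar> / ?N m)))
      \<longlonglongrightarrow> (2 * r) ^ (card {1..D} - 1) * (\<Sum>c\<in>{1..D}. \<bar>v c\<bar>)"
    by (rule prod_diff_limit) (use Ntop in auto)
  then have "(\<lambda>m. 2 * (?N m * ((2 * r) ^ D - (\<Prod>c\<in>{1..D}. 2 * r - \<bar>v c\<bar> / ?N m)))) \<longlonglongrightarrow> 2 * ((2 * r) ^ (D - 1) * S)"
    unfolding S_def by (intro tendsto_mult_left) simp
  then have Nb: "(\<lambda>m. ?N m * b m) \<longlonglongrightarrow> slope * S"
    unfolding slope_def mult.assoc
    by (rule Lim_transform_eventually) (use ev in \<open>auto elim!: eventually_mono\<close>)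
  have "(\<lambda>m. ?N m * b m * inverse (?N m)) \<longlonglongrightarrow> slope * S * 0"
    by (intro tendsto_mult Nb tendsto_inverse_0_at_top Ntop)
  then have "(\<lambda>m. ?N m * b m * inverse (?N m)) \<longlonglongrightarrow> 0" by simp
  then have "b \<longlonglongrightarrow> 0"
    by (rule Lim_transform_eventually) (use ev in \<open>auto elim!: eventually_mono\<close>)
  then have "(\<lambda>m. ?N m * b m - real q * b m) \<longlonglongrightarrow> slope * S - real q * 0"
    by (intro tendsto_intros Nb)
  then have "(\<lambda>m. real m * b m) \<longlonglongrightarrow> slope * S" by (simp add: algebra_simps)
  then have "(\<lambda>m. (1 - b m) ^ m) \<longlonglongrightarrow> exp (- (slope * S))"
    by (intro power_exp_limit) (use sepvol_bounds slope_pos in \<open>auto simp: b_def S_def intro!: mult_nonneg_nonneg sum_nonneg\<close>)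
  also have "exp (- (slope * S)) = laplace slope v"
    by (simp add: S_def sum_distrib_left sum_negf flip: exp_sum)
  finally show ?thesis
    by (rule Lim_transform_eventually) (use ev in \<open>auto elim!: eventually_mono simp: b_def\<close>)
qed

lemma phi_limit: "(\<lambda>m. real (m + q) ^ D * phi m) \<longlonglongrightarrow> (1 / (2 * r) ^ (D - 1)) ^ D"
\<comment> \<open>The index 0 is skipped: for \<open>m \<ge> 1\<close> one has
  \<open>m / (m + q) \<ge> 1 / (q + 1)\<close>, so one function
  \<open>laplace (kappa / (q + 1))\<close> dominates all terms.\<close>
proof (rule LIMSEQ_imp_Suc)
  let ?N = "\<lambda>m. real (m + q)"
  let ?f = "\<lambda>m v. window (?N m) v * (if near0 (blowup (?N m) v) then (1 - sepvol (blowup (?N m) v)) ^ m else 0)"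
  have bm[measurable]: "blowup N \<in> LD \<rightarrow>\<^sub>M \<mu>" for N
    unfolding blowup_def by (subst measurable_cong_sets[OF refl sets_mu]) measurable
  have eq: "?N (Suc m) ^ D * phi (Suc m) = (\<integral>v. ?f (Suc m) v \<partial>LD)" for m
    unfolding phi_def by (rule integral_mu_rescale) auto
  have "(\<lambda>m. \<integral>v. ?f (Suc m) v \<partial>LD) \<longlonglongrightarrow> (\<integral>v. laplace slope v \<partial>LD)"
  proof (rule integral_dominated_convergence[where w="\<lambda>v. laplace (kappa / (q + 1)) v"])
    show "integrable LD (\<lambda>v. laplace (kappa / (q + 1)) v)"
      using laplace_integral[of "kappa / (q + 1)"] kappa_pos by simp
    show "AE v in LD. (\<lambda>m. ?f (Suc m) v) \<longlonglongrightarrow> laplace slope v"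
      by (intro AE_I2 LIMSEQ_Suc[OF blowup_limit])
    fix m
    show "?f (Suc m) \<in> borel_measurable LD"
      unfolding window_def by measurable
    show "AE v in LD. norm (?f (Suc m) v) \<le> laplace (kappa / (q + 1)) v"
    proof (intro AE_I2)
      fix v
      have w: "window N v \<ge> 0" for N by (simp add: window_def prod_nonneg)
      let ?x = "real (Suc m)"
      have "norm (?f (Suc m) v) = ?f (Suc m) v"
        using w sepvol_bounds by auto
      also have "\<dots> \<le> window (?N (Suc m)) v * (if near0 (blowup (?N (Suc m)) v) then exp (- ?x * sepvol (blowup (?N (Suc m)) v)) else 0)"
        by (intro mult_left_mono w) (simp only: one_minus_le_exp_power order_refl split: if_split, simp)
      also have "\<dots> \<le> laplace (?x * kappa / ?N (Suc m)) v"
        by (rule window_bound) auto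
      also have "\<dots> \<le> laplace (kappa / (q + 1)) v"
      proof (intro prod_mono conjI)
        fix c
        have "?N (Suc m) \<le> ?x * (q + 1)" by (simp add: algebra_simps)
        then have "1 / (q + 1) \<le> ?x / ?N (Suc m)" by (simp add: field_simps)
        then have "kappa * (1 / (q + 1)) \<le> kappa * (?x / ?N (Suc m))"
          using kappa_pos by (intro mult_left_mono) auto
        then have "kappa / (q + 1) * \<bar>v c\<bar> \<le> ?x * kappa / ?N (Suc m) * \<bar>v c\<bar>"
          by (intro mult_right_mono) (auto simp: mult_ac)
        then show "exp (- (?x * kappa / ?N (Suc m)) * \<bar>v c\<bar>) \<le> exp (- (kappa / (q + 1)) * \<bar>v c\<bar>)"
          by simp
      qed simp
      finally show "norm (?f (Suc m) v) \<le> laplace (kappa / (q + 1)) v" .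
    qed
  qed measurable
  also have "(\<integral>v. laplace slope v \<partial>LD) = (2 / slope) ^ D"
    using laplace_integral[of slope] slope_pos by simp
  also have "2 / slope = 1 / (2 * r) ^ (D - 1)"
    by (simp add: slope_def)
  finally show "(\<lambda>m. ?N (Suc m) ^ D * phi (Suc m)) \<longlonglongrightarrow> (1 / (2 * r) ^ (D - 1)) ^ D"
    by (simp only: eq)
qed

end

section \<open>Joint probability of prescribed twins\<close>

lemma prod_one_minus_le:
  fixes p :: "'i \<Rightarrow> real"
  assumes "finite B" "\<And>b. b \<in> B \<Longrightarrow> 0 \<le> p b" "\<And>b. b \<in> B \<Longrightarrow> p b \<le> 1"
  shows "(\<Prod>b\<in>B. 1 - p b) \<le> 1 - (\<Sum>b\<in>B. p b) + (\<Sum>b\<in>B. p b)\<^sup>2"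
  using assms
proof induction
  case empty
  then show ?case by simp
next
  case (insert a B)
  define s where "s = (\<Sum>b\<in>B. p b)"
  have s: "s \<ge> 0" unfolding s_def using insert.prems by (intro sum_nonneg) auto
  have pa: "0 \<le> p a" "p a \<le> 1" using insert.prems by auto
  have "(\<Prod>b\<in>insert a B. 1 - p b) = (1 - p a) * (\<Prod>b\<in>B. 1 - p b)"
    using insert.hyps by simp
  also have "\<dots> \<le> (1 - p a) * (1 - s + s\<^sup>2)"
    using insert pa by (intro mult_left_mono) (auto simp: s_def)
  also have "\<dots> = 1 - (p a + s) + (p a + s)\<^sup>2 - (p a * s + (p a)\<^sup>2 + p a * s\<^sup>2)"
    by (simp add: algebra_simps power2_eq_square)
  also have "\<dots> \<le> 1 - (p a + s) + (p a + s)\<^sup>2"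
  proof -
    have "0 \<le> p a * s + (p a)\<^sup>2 + p a * s\<^sup>2" using pa s by (intro add_nonneg_nonneg mult_nonneg_nonneg) auto
    then show ?thesis by simp
  qed
  finally show ?case using insert.hyps by (simp add: s_def)
qed

lemma prod_one_minus_ge:
  fixes p :: "'i \<Rightarrow> real"
  assumes "finite B" "\<And>b. b \<in> B \<Longrightarrow> 0 \<le> p b" "\<And>b. b \<in> B \<Longrightarrow> p b \<le> 1"
  shows "1 - (\<Sum>b\<in>B. p b) \<le> (\<Prod>b\<in>B. 1 - p b)"
  using assms
proof induction
  case empty
  then show ?case by simp
next
  case (insert a B)
  have pa: "0 \<le> p a" "p a \<le> 1" using insert.prems by auto
  have "0 \<le> p a * (\<Sum>b\<in>B. p b)" using insert.prems by (intro mult_nonneg_nonneg sum_nonneg) auto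
  then have "1 - (\<Sum>b\<in>insert a B. p b) \<le> (1 - p a) * (1 - (\<Sum>b\<in>B. p b))"
    using insert.hyps by (simp add: algebra_simps)
  also have "\<dots> \<le> (1 - p a) * (\<Prod>b\<in>B. 1 - p b)"
    using insert pa by (intro mult_left_mono) auto
  finally show ?case using insert.hyps by simp
qed

text \<open>The factor \<open>M ^ m\<close> is kept because M will decay exponentially in the
  volumes; this decay gives the error the same order as the main term.\<close>

lemma abs_power_diff_le:
  fixes x y M :: real
  assumes "0 \<le> x" "x \<le> M" "0 \<le> y" "y \<le> M"
  shows "\<bar>x ^ Suc m - y ^ Suc m\<bar> \<le> real (Suc m) * \<bar>x - y\<bar> * M ^ m"
proof (induction m)
  case 0
  then show ?case by simp
next
  case (Suc m)
  have "x ^ Suc (Suc m) - y ^ Suc (Suc m) = x * (x ^ Suc m - y ^ Suc m) + y ^ Suc m * (x - y)"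
    by (simp add: algebra_simps)
  also have "\<bar>\<dots>\<bar> \<le> x * \<bar>x ^ Suc m - y ^ Suc m\<bar> + y ^ Suc m * \<bar>x - y\<bar>"
    using assms by (intro abs_triangle_ineq[THEN order_trans]) (simp add: abs_mult power_abs)
  also have "\<dots> \<le> M * (real (Suc m) * \<bar>x - y\<bar> * M ^ m) + M ^ Suc m * \<bar>x - y\<bar>"
    using assms Suc.IH by (intro add_mono mult_mono power_mono mult_nonneg_nonneg zero_le_power) auto
  finally show ?case by (simp add: algebra_simps)
qed

text \<open>In the application U is the volume of a union of sets with volumes \<open>p b\<close>,
  and I bounds their overlaps. Both \<open>1 - U\<close> and the product of the
  \<open>1 - p b\<close> lie between \<open>1 - s\<close> and \<open>1 - s + I + s^2\<close>. Both
  are at most \<open>exp (- s / k)\<close>, the former because U is at least every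
  \<open>p b\<close> and hence at least their mean \<open>s / k\<close>.\<close>

lemma abs_power_diff_prod_le:
  fixes p :: "'i \<Rightarrow> real"
  assumes B: "finite B" "card B = k" "k \<ge> 1" and p: "\<And>b. b \<in> B \<Longrightarrow> 0 \<le> p b" "\<And>b. b \<in> B \<Longrightarrow> p b \<le> 1"
    and U: "\<And>b. b \<in> B \<Longrightarrow> p b \<le> U" "U \<le> 1" and s: "s = (\<Sum>b\<in>B. p b)"
    and UI: "U \<le> s" "s - I \<le> U" "I \<ge> 0" and m: "m \<ge> 1"
  shows "\<bar>(1 - U) ^ m - (\<Prod>b\<in>B. (1 - p b) ^ m)\<bar> \<le> real m * (I + s\<^sup>2) * exp (- (real (m - 1) * s / k))"
proof -
  define x where "x = 1 - U"
  define y where "y = (\<Prod>b\<in>B. 1 - p b)"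
  define M where "M = exp (- s / k)"
  have "s \<le> (\<Sum>b\<in>B. U)" unfolding s by (intro sum_mono U)
  then have "s / k \<le> U" using B by (simp add: field_simps)
  then have x: "0 \<le> x" "x \<le> M"
    using exp_ge_add_one_self[of "- s / k"] U(2) unfolding x_def M_def by auto
  have s0: "0 \<le> s" unfolding s by (intro sum_nonneg p)
  have "y \<le> (\<Prod>b\<in>B. exp (- p b))"
  proof -
    have "1 - p b \<le> exp (- p b)" for b using exp_ge_add_one_self[of "- p b"] by simp
    then show ?thesis unfolding y_def using p by (intro prod_mono) auto
  qed
  also have "\<dots> = exp (- s)" using B by (simp add: s sum_negf flip: exp_sum)
  also have "\<dots> \<le> M"
  proof -
    have "s / k \<le> s / 1" using B s0 by (intro divide_left_mono) auto
    then show ?thesis by (simp add: M_def)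
  qed
  finally have y: "0 \<le> y" "y \<le> M" unfolding y_def using p by (auto intro!: prod_nonneg)
  have "1 - s \<le> y" unfolding y_def s using B p by (intro prod_one_minus_ge) auto
  moreover have "y \<le> 1 - s + s\<^sup>2" unfolding y_def s using B p by (intro prod_one_minus_le) auto
  ultimately have "\<bar>x - y\<bar> \<le> I + s\<^sup>2"
    using UI zero_le_power2[of s] unfolding x_def by linarith
  then have "\<bar>x ^ Suc (m - 1) - y ^ Suc (m - 1)\<bar> \<le> real (Suc (m - 1)) * (I + s\<^sup>2) * M ^ (m - 1)"
    by (intro order_trans[OF abs_power_diff_le[OF x y]] mult_right_mono mult_left_mono) (auto simp: M_def)
  also have "M ^ (m - 1) = exp (- (real (m - 1) * s / k))"
    by (simp add: M_def flip: exp_of_nat_mult)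
  finally show ?thesis using m by (simp add: x_def y_def prod_power_distrib)
qed

text \<open>Bonferroni's lower bound over ordered pairs, so each overlap is subtracted twice; in an
  error term this factor is immaterial.\<close>

lemma (in finite_measure) measure_UN_ge:
  assumes "finite B" "\<And>b. b \<in> B \<Longrightarrow> S b \<in> sets M"
  shows "measure M (\<Union>b\<in>B. S b) \<ge> (\<Sum>b\<in>B. measure M (S b)) - (\<Sum>b\<in>B. \<Sum>b'\<in>B - {b}. measure M (S b \<inter> S b'))"
  using assms
proof induction
  case empty
  then show ?case by simp
next
  case (insert a B)
  let ?O = "\<lambda>B. \<Sum>b\<in>B. \<Sum>b'\<in>B - {b}. measure M (S b \<inter> S b')"
  note [measurable] = insert.prems
  have U: "(\<Union>b\<in>B. S b) \<in> sets M" using insert by (intro sets.finite_UN) auto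
  have "measure M (\<Union>b\<in>insert a B. S b) = measure M (S a \<union> (\<Union>b\<in>B. S b))" by simp
  also have "\<dots> = measure M (S a) + measure M (\<Union>b\<in>B. S b) - measure M (S a \<inter> (\<Union>b\<in>B. S b))"
    using insert U by (intro measure_Un3) (auto simp: fmeasurable_eq_sets)
  also have "measure M (S a \<inter> (\<Union>b\<in>B. S b)) = measure M (\<Union>b\<in>B. S a \<inter> S b)"
    by (intro arg_cong[where f="measure M"]) auto
  finally have "measure M (\<Union>b\<in>insert a B. S b) = measure M (S a) + measure M (\<Union>b\<in>B. S b) - measure M (\<Union>b\<in>B. S a \<inter> S b)" .
  moreover have "measure M (\<Union>b\<in>B. S a \<inter> S b) \<le> (\<Sum>b\<in>B. measure M (S a \<inter> S b))"
    using insert by (intro finite_measure_subadditive_finite) auto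
  moreover have "measure M (\<Union>b\<in>B. S b) \<ge> (\<Sum>b\<in>B. measure M (S b)) - ?O B"
    using insert by auto
  moreover have "?O (insert a B)
     \<ge> (\<Sum>b\<in>B. measure M (S a \<inter> S b)) + ?O B"
  proof -
    have Ba: "insert a B - {a} = B" using insert.hyps by auto
    have "?O (insert a B)
       = (\<Sum>b'\<in>B. measure M (S a \<inter> S b')) + (\<Sum>b\<in>B. \<Sum>b'\<in>insert a B - {b}. measure M (S b \<inter> S b'))"
      unfolding sum.insert[OF insert.hyps] Ba ..
    moreover have "(\<Sum>b\<in>B. \<Sum>b'\<in>insert a B - {b}. measure M (S b \<inter> S b')) \<ge> ?O B"
      using insert.hyps by (intro sum_mono sum_mono2) auto
    ultimately show ?thesis by linarith
  qed
  ultimately show ?case using insert.hyps by simp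
qed

section \<open>Averages over two independent base points\<close>

lemma distr_PiM_pair:
  assumes M: "prob_space M" and A: "finite A" "a \<in> A" "a' \<in> A" "a \<noteq> a'"
  shows "distr (PiM A (\<lambda>_. M)) (M \<Otimes>\<^sub>M M) (\<lambda>z. (z a, z a')) = M \<Otimes>\<^sub>M M"
proof (rule pair_measure_eqI[symmetric])
  let ?f = "\<lambda>z. (z a, z a')" and ?P = "PiM A (\<lambda>_. M)"
  interpret M: prob_space M by fact
  interpret P: product_prob_space "\<lambda>_. M" by (rule product_prob_spaceI) (rule M)
  show "sigma_finite_measure M" "sigma_finite_measure M" by unfold_locales
  show "sets (M \<Otimes>\<^sub>M M) = sets (distr ?P (M \<Otimes>\<^sub>M M) ?f)" by simp
  fix X Y assume XY[measurable]: "X \<in> sets M" "Y \<in> sets M"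
  let ?E = "\<lambda>i. if i = a then X else if i = a' then Y else space M"
  have meas: "?f \<in> ?P \<rightarrow>\<^sub>M M \<Otimes>\<^sub>M M"
    using A by (intro measurable_Pair measurable_component_singleton)
  have "emeasure (distr ?P (M \<Otimes>\<^sub>M M) ?f) (X \<times> Y)
     = emeasure ?P (?f -` (X \<times> Y) \<inter> space ?P)"
    by (intro emeasure_distr meas) measurable
  also have "?f -` (X \<times> Y) \<inter> space ?P = Pi\<^sub>E A ?E"
  proof (intro set_eqI iffI)
    fix z assume "z \<in> ?f -` (X \<times> Y) \<inter> space ?P"
    then show "z \<in> Pi\<^sub>E A ?E" by (auto simp: space_PiM PiE_iff)
  next
    fix z assume z: "z \<in> Pi\<^sub>E A ?E"
    then have "z i \<in> ?E i" if "i \<in> A" for i using that by (auto simp: PiE_iff)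
    from this[of a] this[of a'] have "z a \<in> X" "z a' \<in> Y" using A by auto
    moreover have "z i \<in> space M" if "i \<in> A" for i
      using \<open>i \<in> A \<Longrightarrow> z i \<in> ?E i\<close>[OF that] sets.sets_into_space[OF XY(1)] sets.sets_into_space[OF XY(2)]
      by (auto split: if_splits)
    ultimately show "z \<in> ?f -` (X \<times> Y) \<inter> space ?P"
      using z by (auto simp: space_PiM PiE_iff)
  qed
  also have "emeasure ?P (Pi\<^sub>E A ?E) = (\<Prod>i\<in>A. emeasure M (?E i))"
    using A by (intro P.emeasure_PiM) auto
  also have "\<dots> = (\<Prod>i\<in>{a, a'}. emeasure M (?E i))"
    using A M.emeasure_space_1 by (intro prod.mono_neutral_right) auto
  also have "\<dots> = emeasure M X * emeasure M Y" using A by simp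
  finally show "emeasure M X * emeasure M Y = emeasure (distr ?P (M \<Otimes>\<^sub>M M) ?f) (X \<times> Y)" by simp
qed

context torus_box begin

lemma two_point_integral:
  fixes F :: "point \<Rightarrow> point \<Rightarrow> real"
  assumes A: "finite A" "a \<in> A" "a' \<in> A" "a \<noteq> a'"
    and F[measurable]: "(\<lambda>p. F (fst p) (snd p)) \<in> borel_measurable (\<mu> \<Otimes>\<^sub>M \<mu>)" and bd: "\<And>x y. \<bar>F x y\<bar> \<le> c"
  shows "(\<integral>z. F (z a) (z a') \<partial>PiM A (\<lambda>_. \<mu>)) = (\<integral>x. (\<integral>y. F x y \<partial>\<mu>) \<partial>\<mu>)"
proof -
  interpret MM: pair_prob_space \<mu> \<mu> by unfold_locales
  have [measurable]: "(\<lambda>z. (z a, z a')) \<in> PiM A (\<lambda>_. \<mu>) \<rightarrow>\<^sub>M \<mu> \<Otimes>\<^sub>M \<mu>"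
    using A by (intro measurable_Pair measurable_component_singleton)
  have "(\<integral>z. F (z a) (z a') \<partial>PiM A (\<lambda>_. \<mu>)) = (\<integral>p. F (fst p) (snd p) \<partial>distr (PiM A (\<lambda>_. \<mu>)) (\<mu> \<Otimes>\<^sub>M \<mu>) (\<lambda>z. (z a, z a')))"
    by (subst integral_distr) auto
  also have "\<dots> = (\<integral>p. F (fst p) (snd p) \<partial>(\<mu> \<Otimes>\<^sub>M \<mu>))"
    by (simp only: distr_PiM_pair[OF mu.prob_space_axioms A])
  also have "\<dots> = (\<integral>x. (\<integral>y. F x y \<partial>\<mu>) \<partial>\<mu>)"
    using bd by (subst MM.integral_fst'[symmetric]) (auto intro!: MM.integrable_const_bound[where B=c])
  finally show ?thesis .
qed

text \<open>The two ways in which a vertex of another pair can separate x and x + u: as a base point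
  y, or as the partner y + v of a base point.\<close>

lemma prob_hit:
  "measure \<mu> {y \<in> space \<mu>. y \<in> sep x (tadd x u)} = sepvol u"
  "measure \<mu> {y \<in> space \<mu>. tadd y v \<in> sep x (tadd x u)} = sepvol u"
proof -
  show "measure \<mu> {y \<in> space \<mu>. y \<in> sep x (tadd x u)} = sepvol u"
  proof -
    have "{y \<in> space \<mu>. y \<in> sep x (tadd x u)} = sep x (tadd x u)" by (auto simp: sep_def)
    then show ?thesis by (simp add: measure_sep)
  qed
  show "measure \<mu> {y \<in> space \<mu>. tadd y v \<in> sep x (tadd x u)} = sepvol u"
    by (simp add: tadd_commute[of _ v] measure_mu_tadd measure_sep)
qed

text \<open>The product formula already holds for every fixed x: with w in the first separating set
  held fixed, y is integrated first, and by \<open>measure_sep_base\<close> the result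
  \<open>sepvol u'\<close> does not depend on w.\<close>

lemma integral_sep_Int:
  "(\<integral>x. (\<integral>y. measure \<mu> (sep x (tadd x u) \<inter> sep y (tadd y u')) \<partial>\<mu>) \<partial>\<mu>) = sepvol u * sepvol u'"
proof -
  interpret MM: pair_prob_space \<mu> \<mu> by unfold_locales
  have "(\<integral>y. measure \<mu> (sep x (tadd x u) \<inter> sep y (tadd y u')) \<partial>\<mu>) = sepvol u * sepvol u'" for x
  proof -
    let ?f = "\<lambda>y w. indicator (sep x (tadd x u)) w * (if near y w \<noteq> near (tadd y u') w then 1 else 0) :: real"
    have "(\<integral>y. measure \<mu> (sep x (tadd x u) \<inter> sep y (tadd y u')) \<partial>\<mu>) = (\<integral>y. (\<integral>w. ?f y w \<partial>\<mu>) \<partial>\<mu>)"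
    proof (intro Bochner_Integration.integral_cong refl)
      fix y
      have "measure \<mu> (sep x (tadd x u) \<inter> sep y (tadd y u')) = (\<integral>w. indicator (sep x (tadd x u) \<inter> sep y (tadd y u')) w \<partial>\<mu>)"
        by simp
      also have "\<dots> = (\<integral>w. ?f y w \<partial>\<mu>)"
        by (intro Bochner_Integration.integral_cong refl) (auto simp: sep_def indicator_def)
      finally show "measure \<mu> (sep x (tadd x u) \<inter> sep y (tadd y u')) = (\<integral>w. ?f y w \<partial>\<mu>)" .
    qed
    also have "\<dots> = (\<integral>w. (\<integral>y. ?f y w \<partial>\<mu>) \<partial>\<mu>)"
      by (rule MM.Fubini_integral[symmetric])
         (auto intro!: MM.integrable_const_bound[where B=1] simp: split_beta' indicator_def)
    also have "\<dots> = (\<integral>w. indicator (sep x (tadd x u)) w * sepvol u' \<partial>\<mu>)"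
    proof (intro Bochner_Integration.integral_cong refl)
      fix w assume w: "w \<in> space \<mu>"
      have "(\<integral>y. ?f y w \<partial>\<mu>) = indicator (sep x (tadd x u)) w * (\<integral>y. (if near y w \<noteq> near (tadd y u') w then 1 else 0) \<partial>\<mu>)"
        by simp
      also have "(\<integral>y. (if near y w \<noteq> near (tadd y u') w then 1 else 0) \<partial>\<mu>) = (\<integral>y. indicator {z \<in> space \<mu>. w \<in> sep z (tadd z u')} y \<partial>\<mu>)"
        by (intro Bochner_Integration.integral_cong refl) (use w in \<open>auto simp: sep_def\<close>)
      also have "\<dots> = sepvol u'"
        using measure_sep_base[OF w, of u'] by (simp add: Int_absorb2)
      finally show "(\<integral>y. ?f y w \<partial>\<mu>) = indicator (sep x (tadd x u)) w * sepvol u'" .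
    qed
    also have "\<dots> = sepvol u * sepvol u'" by (simp add: measure_sep)
    finally show ?thesis .
  qed
  then show ?thesis by (simp add: mu.prob_space)
qed

end

text \<open>A holds the base points, each b in B is to be a twin of \<open>\<pi> b\<close>, and J
  holds the remaining vertices. An injective \<open>\<pi>\<close> describes a matching; two partners
  with a common base point describe three mutual twins.\<close>

locale cluster = torus_box +
  fixes A B J :: "nat set" and \<pi> :: "nat \<Rightarrow> nat"
  assumes fin: "finite A" "finite B" "finite J"
    and disj: "A \<inter> B = {}" "(A \<union> B) \<inter> J = {}"
    and pi: "\<And>b. b \<in> B \<Longrightarrow> \<pi> b \<in> A"
    and B_ne: "B \<noteq> {}"
begin

abbreviation \<M> :: "nat set \<Rightarrow> points measure" where "\<M> I \<equiv> PiM I (\<lambda>_. \<mu>)"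

sublocale PM: product_prob_space "\<lambda>_::nat. \<mu>"
  by (rule product_prob_spaceI) (rule mu.prob_space_axioms)

lemma prob_space_PM: "prob_space (\<M> I)"
  by (intro prob_space_PiM mu.prob_space_axioms)

text \<open>Here z also ranges over the pair itself: z = b gives
  \<open>near (x (\<pi> b)) (x b)\<close> by reflexivity, so adjacency is part of the
  condition.\<close>

definition twins :: "points \<Rightarrow> bool" where
  "twins x \<longleftrightarrow> (\<forall>b\<in>B. \<forall>z\<in>A \<union> B \<union> J. near (x (\<pi> b)) (x z) \<longleftrightarrow> near (x b) (x z))"

definition twins_in :: "points \<Rightarrow> bool" where
  "twins_in x \<longleftrightarrow> (\<forall>b\<in>B. \<forall>z\<in>A \<union> B. near (x (\<pi> b)) (x z) \<longleftrightarrow> near (x b) (x z))"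

definition unionvol :: "points \<Rightarrow> real" where
  "unionvol x = measure \<mu> {w \<in> space \<mu>. \<exists>b\<in>B. near (x (\<pi> b)) w \<noteq> near (x b) w}"

text \<open>The conditional probability of \<open>twins\<close> given the positions of the vertices
  in \<open>A \<union> B\<close>: each vertex of J independently has to miss the union of the
  separating sets.\<close>

definition avoid :: "points \<Rightarrow> real" where
  "avoid x = (if twins_in x then (1 - unionvol x) ^ card J else 0)"

abbreviation prob_twins :: real where
  "prob_twins \<equiv> measure (\<M> (A \<union> B \<union> J)) {x \<in> space (\<M> (A \<union> B \<union> J)). twins x}"

lemma twins_measurable [measurable]: "Measurable.pred (\<M> (A \<union> B \<union> J)) twins"
proof -
  have [measurable]: "(\<lambda>x. x i) \<in> \<M> (A \<union> B \<union> J) \<rightarrow>\<^sub>M \<mu>" if "i \<in> A \<union> B \<union> J" for i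
    using that by (rule measurable_component_singleton)
  show ?thesis unfolding twins_def
    using fin by (intro pred_intros_finite) (auto intro!: measurable_If pred_intros_logic near_measurable measurable_component_singleton pi)
qed

lemma comp_measurable:
  assumes "f \<in> N \<rightarrow>\<^sub>M \<M> (A \<union> B)" "i \<in> A \<union> B"
  shows "(\<lambda>q. f q i) \<in> N \<rightarrow>\<^sub>M \<mu>"
  using measurable_compose[OF assms(1) measurable_component_singleton[OF assms(2)]] .

lemma twins_in_measurable [measurable]:
  assumes "f \<in> N \<rightarrow>\<^sub>M \<M> (A \<union> B)"
  shows "Measurable.pred N (\<lambda>q. twins_in (f q))"
  unfolding twins_in_def
  using fin by (intro pred_intros_finite) (auto intro!: pred_intros_logic near_measurable comp_measurable[OF assms] pi)

lemma unionvol_measurable [measurable]: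
  assumes "f \<in> N \<rightarrow>\<^sub>M \<M> (A \<union> B)"
  shows "(\<lambda>q. unionvol (f q)) \<in> borel_measurable N"
proof -
  have f: "(\<lambda>p. f (fst p)) \<in> N \<Otimes>\<^sub>M \<mu> \<rightarrow>\<^sub>M \<M> (A \<union> B)"
    using assms by measurable
  have "Measurable.pred (N \<Otimes>\<^sub>M \<mu>) (\<lambda>p. \<exists>b\<in>B. near (f (fst p) (\<pi> b)) (snd p) \<noteq> near (f (fst p) b) (snd p))"
    using fin by (intro pred_intros_finite) (auto intro!: pred_intros_logic near_measurable comp_measurable[OF f] pi)
  from measure_section_measurable[OF mu.finite_measure_axioms this]
  show ?thesis unfolding unionvol_def .
qed

lemma avoid_measurable [measurable]:
  assumes [measurable]: "f \<in> N \<rightarrow>\<^sub>M \<M> (A \<union> B)"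
  shows "(\<lambda>q. avoid (f q)) \<in> borel_measurable N"
  unfolding avoid_def by measurable

lemma unionvol_bounds: "0 \<le> unionvol x" "unionvol x \<le> 1"
  by (auto simp: unionvol_def)

lemma avoid_bounds: "0 \<le> avoid x" "avoid x \<le> 1"
  using unionvol_bounds[of x] by (auto simp: avoid_def intro!: power_le_one)

abbreviation MV where "MV \<equiv> \<M> (A \<union> B \<union> J)"

lemma prob_twins_eq_avoid: "prob_twins = (\<integral>x. avoid x \<partial>\<M> (A \<union> B))"
proof -
  interpret T: prob_space "MV" by (rule prob_space_PM)
  let ?E = "{x \<in> space MV. twins x}"
  have E[measurable]: "?E \<in> sets MV" by measurable
  have "measure MV ?E = (\<integral>x. indicator ?E x \<partial>MV)"
    by simp
  also have "\<dots> = (\<integral>x. (\<integral>y. indicator ?E (merge (A \<union> B) J (x, y)) \<partial>\<M> J) \<partial>\<M> (A \<union> B))"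
    using fin disj by (intro PM.product_integral_fold T.integrable_const_bound[where B=1]) auto
  also have "\<dots> = (\<integral>x. avoid x \<partial>\<M> (A \<union> B))"
  proof (intro Bochner_Integration.integral_cong refl)
    fix x assume x: "x \<in> space (\<M> (A \<union> B))"
    let ?U = "{w \<in> space \<mu>. \<exists>b\<in>B. near (x (\<pi> b)) w \<noteq> near (x b) w}"
    have U[measurable]: "?U \<in> sets \<mu>"
    proof -
      have "?U = (\<Union>b\<in>B. sep (x (\<pi> b)) (x b))" by (auto simp: sep_def)
      also have "\<dots> \<in> sets \<mu>" using fin by (intro sets.finite_UN) auto
      finally show ?thesis .
    qed
    have "(\<integral>y. indicator ?E (merge (A \<union> B) J (x, y)) \<partial>\<M> J :: real) = (\<integral>y. (if twins_in x then 1 else 0) * (\<Prod>z\<in>J. indicator (space \<mu> - ?U) (y z)) \<partial>\<M> J)"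
    proof (intro Bochner_Integration.integral_cong refl)
      fix y assume y: "y \<in> space (\<M> J)"
      have yz: "y z \<in> space \<mu>" if "z \<in> J" for z using y that by (auto simp: space_PiM)
      let ?m = "merge (A \<union> B) J (x, y)"
      have m1: "?m z = x z" if "z \<in> A \<union> B" for z using that by (auto simp: merge_def)
      have m2: "?m z = y z" if "z \<in> J" for z using that disj by (auto simp: merge_def)
      have sp: "?m \<in> space MV"
        using x y by (auto simp: space_PiM PiE_iff merge_def extensional_def)
      have tw: "twins ?m \<longleftrightarrow> twins_in x \<and> (\<forall>z\<in>J. y z \<notin> ?U)"
      proof -
        have "near (?m (\<pi> b)) (?m z) = near (x (\<pi> b)) (x z)" "near (?m b) (?m z) = near (x b) (x z)" if "b \<in> B" "z \<in> A \<union> B" for b z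
          using that pi[of b] m1 by auto
        moreover have "near (?m (\<pi> b)) (?m z) = near (x (\<pi> b)) (y z)" "near (?m b) (?m z) = near (x b) (y z)" if "b \<in> B" "z \<in> J" for b z
          using that pi[of b] m1 m2 by auto
        ultimately show ?thesis unfolding twins_def twins_in_def using yz by auto
      qed
      show "(indicator ?E ?m :: real) = (if twins_in x then 1 else 0) * (\<Prod>z\<in>J. indicator (space \<mu> - ?U) (y z))"
      proof (cases "\<forall>z\<in>J. y z \<notin> ?U")
        case True
        then have "(\<Prod>z\<in>J. indicator (space \<mu> - ?U) (y z)) = (\<Prod>z\<in>J. 1 :: real)"
          using yz by (intro prod.cong) auto
        with True sp tw show ?thesis by simp
      next
        case False
        then obtain z where z: "z \<in> J" "y z \<in> ?U" by blast
        from z(2) have "indicator (space \<mu> - ?U) (y z) = (0 :: real)" by simp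
        then have "(\<Prod>z\<in>J. indicator (space \<mu> - ?U) (y z)) = (0 :: real)"
          by (intro prod_zero[OF fin(3)] bexI[OF _ z(1)])
        with False tw show ?thesis by (auto simp: indicator_def)
      qed
    qed
    also have "\<dots> = (if twins_in x then 1 else 0) * (\<integral>y. (\<Prod>z\<in>J. indicator (space \<mu> - ?U) (y z)) \<partial>\<M> J)"
      by simp
    also have "(\<integral>y. (\<Prod>z\<in>J. indicator (space \<mu> - ?U) (y z)) \<partial>\<M> J :: real) = (\<Prod>z\<in>J. (\<integral>w. indicator (space \<mu> - ?U) w \<partial>\<mu>) :: real)"
      using fin by (intro PM.product_integral_prod mu.integrable_const_bound[where B=1]) auto
    also have "\<dots> = (1 - unionvol x) ^ card J"
      by (simp add: mu.prob_compl Int_absorb2 unionvol_def)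
    finally show "(\<integral>y. indicator ?E (merge (A \<union> B) J (x, y)) \<partial>\<M> J) = avoid x"
      by (simp add: avoid_def)
  qed
  finally show ?thesis .
qed

definition config :: "points \<Rightarrow> points \<Rightarrow> points" where
  "config z u = merge A B (z, \<lambda>b\<in>B. tadd (z (\<pi> b)) (u b))"

lemma config_simps:
  "a \<in> A \<Longrightarrow> config z u a = z a"
  "b \<in> B \<Longrightarrow> config z u b = tadd (z (\<pi> b)) (u b)"
  using disj by (auto simp: config_def merge_def)

lemma config_measurable [measurable]:
  assumes [measurable]: "f \<in> N \<rightarrow>\<^sub>M \<M> A" "g \<in> N \<rightarrow>\<^sub>M \<M> B"
  shows "(\<lambda>q. config (f q) (g q)) \<in> N \<rightarrow>\<^sub>M \<M> (A \<union> B)"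
proof -
  have "(\<lambda>q. tadd (f q (\<pi> b)) (g q b)) \<in> N \<rightarrow>\<^sub>M \<mu>" if "b \<in> B" for b
    by (rule tadd_measurable)
       (rule measurable_compose[OF assms(1) measurable_component_singleton[OF pi[OF that]]],
        rule measurable_compose[OF assms(2) measurable_component_singleton[OF that]])
  then have "(\<lambda>q. \<lambda>b\<in>B. tadd (f q (\<pi> b)) (g q b)) \<in> N \<rightarrow>\<^sub>M \<M> B"
    by (rule measurable_restrict)
  then have "(\<lambda>q. (f q, \<lambda>b\<in>B. tadd (f q (\<pi> b)) (g q b))) \<in> N \<rightarrow>\<^sub>M \<M> A \<Otimes>\<^sub>M \<M> B"
    using assms by (intro measurable_Pair)
  from measurable_compose[OF this measurable_merge] show ?thesis by (simp add: config_def)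
qed

text \<open>The differences \<open>u b = x b - x (\<pi> b)\<close> are again uniform and independent of the base points.\<close>

lemma integral_avoid_config: "(\<integral>x. avoid x \<partial>\<M> (A \<union> B)) = (\<integral>u. (\<integral>z. avoid (config z u) \<partial>\<M> A) \<partial>\<M> B)"
proof -
  interpret AB: pair_prob_space "\<M> A" "\<M> B"
    by (intro pair_prob_space.intro pair_sigma_finite.intro prob_space_imp_sigma_finite prob_space_PM)
  interpret T: prob_space "\<M> (A \<union> B)" by (rule prob_space_PM)
  have "(\<integral>x. avoid x \<partial>\<M> (A \<union> B)) = (\<integral>z. (\<integral>u. avoid (merge A B (z, u)) \<partial>\<M> B) \<partial>\<M> A)"
    using fin disj avoid_bounds
    by (intro PM.product_integral_fold T.integrable_const_bound[where B=1]) auto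
  also have "\<dots> = (\<integral>z. (\<integral>u. avoid (config z u) \<partial>\<M> B) \<partial>\<M> A)"
  proof (rule Bochner_Integration.integral_cong[OF refl])
    fix z assume z: "z \<in> space (\<M> A)"
    have d: "distr (\<M> B) (\<M> B) (\<lambda>u. \<lambda>b\<in>B. tadd (z (\<pi> b)) (u b)) = \<M> B"
      using fin by (intro distr_PiM_coordinatewise mu.prob_space_axioms distr_mu_tadd) measurable
    have m: "(\<lambda>u. avoid (merge A B (z, u))) \<in> borel_measurable (\<M> B)"
      using z by (intro avoid_measurable measurable_compose[OF _ measurable_merge]) measurable
    have m': "(\<lambda>u. \<lambda>b\<in>B. tadd (z (\<pi> b)) (u b)) \<in> \<M> B \<rightarrow>\<^sub>M \<M> B"
      by (intro measurable_restrict tadd_measurable1 measurable_component_singleton)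
    have "(\<integral>u. avoid (merge A B (z, u)) \<partial>\<M> B) = (\<integral>u. avoid (merge A B (z, u)) \<partial>distr (\<M> B) (\<M> B) (\<lambda>u. \<lambda>b\<in>B. tadd (z (\<pi> b)) (u b)))"
      by (simp only: d)
    also have "\<dots> = (\<integral>u. avoid (config z u) \<partial>\<M> B)"
      unfolding config_def by (rule integral_distr[OF m' m])
    finally show "(\<integral>u. avoid (merge A B (z, u)) \<partial>\<M> B) = (\<integral>u. avoid (config z u) \<partial>\<M> B)" .
  qed
  also have "\<dots> = (\<integral>u. (\<integral>z. avoid (config z u) \<partial>\<M> A) \<partial>\<M> B)"
    using avoid_bounds
    by (intro AB.Fubini_integral[symmetric] AB.integrable_const_bound[where B=1]) (auto simp: split_beta')
  finally show ?thesis .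
qed

end

text \<open>Put \<open>w = m s / (4 k)\<close>. Both exponents are at least \<open>2 w\<close> in
  modulus, the second because \<open>m - 1 \<ge> m / 2\<close>. One factor \<open>exp (- w)\<close>
  absorbs the polynomials w and \<open>w^2\<close> at the cost of 1 and 2, the other survives on the
  right; hence \<open>72 = 8 + 32 * 2\<close>.\<close>

lemma exp_tail_bound:
  fixes s :: real
  assumes "s \<ge> 0" "k \<ge> 1" "m \<ge> 2"
  shows "2 * real k * s * exp (- (real m * s / k)) + 2 * real m * s\<^sup>2 * exp (- (real (m - 1) * s / k))
    \<le> 72 * (real k)\<^sup>2 / real m * exp (- (real m / (4 * real k) * s))"
proof -
  define w where "w = real m * s / (4 * real k)"
  have w: "w \<ge> 0" using assms by (simp add: w_def)
  have s: "s = 4 * real k * w / real m" using assms by (simp add: w_def)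
  have e1: "w * exp (- w) \<le> 1" "w\<^sup>2 * exp (- w) \<le> 2"
  proof -
    have "1 + w + w\<^sup>2 / 2 \<le> exp w" by (rule exp_lower_Taylor_quadratic[OF w])
    moreover have "0 \<le> w\<^sup>2" by simp
    ultimately have "w \<le> exp w" "w\<^sup>2 \<le> 2 * exp w" using w by linarith+
    then show "w * exp (- w) \<le> 1" "w\<^sup>2 * exp (- w) \<le> 2" by (simp_all add: exp_minus field_simps)
  qed
  have a: "exp (- (real m * s / k)) \<le> exp (- w) * exp (- w)"
  proof -
    have "real m * s / k = 4 * w" using assms by (simp add: w_def)
    then show ?thesis using w by (simp flip: exp_add)
  qed
  have b: "exp (- (real (m - 1) * s / k)) \<le> exp (- w) * exp (- w)"
  proof -
    have "real m / 2 \<le> real (m - 1)" using assms by simp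
    then have "real m / 2 * (s / k) \<le> real (m - 1) * (s / k)" using assms by (intro mult_right_mono) auto
    then have "2 * w \<le> real (m - 1) * s / k" using assms by (simp add: w_def mult.commute)
    then show ?thesis by (simp flip: exp_add)
  qed
  have "2 * real k * s * exp (- (real m * s / k)) + 2 * real m * s\<^sup>2 * exp (- (real (m - 1) * s / k))
     \<le> 2 * real k * s * (exp (- w) * exp (- w)) + 2 * real m * s\<^sup>2 * (exp (- w) * exp (- w))"
    using assms a b by (intro add_mono mult_left_mono) auto
  also have "\<dots> = (8 * (real k)\<^sup>2 * (w * exp (- w)) + 32 * (real k)\<^sup>2 * (w\<^sup>2 * exp (- w))) / m * exp (- w)"
    using assms by (simp add: s field_simps power2_eq_square)
  also have "\<dots> \<le> (8 * (real k)\<^sup>2 * 1 + 32 * (real k)\<^sup>2 * 2) / m * exp (- w)"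
    using assms e1 by (intro mult_right_mono divide_right_mono add_mono mult_left_mono) auto
  finally show ?thesis by (simp add: w_def)
qed

context cluster begin

lemma unionvol_config_ge:
  assumes "b \<in> B"
  shows "sepvol (u b) \<le> unionvol (config z u)"
proof -
  let ?W = "{w \<in> space \<mu>. \<exists>b\<in>B. near (config z u (\<pi> b)) w \<noteq> near (config z u b) w}"
  have "measure \<mu> (sep (z (\<pi> b)) (tadd (z (\<pi> b)) (u b))) \<le> unionvol (config z u)"
    unfolding unionvol_def
  proof (rule mu.finite_measure_mono)
    show "sep (z (\<pi> b)) (tadd (z (\<pi> b)) (u b)) \<subseteq> ?W"
    proof
      fix w assume "w \<in> sep (z (\<pi> b)) (tadd (z (\<pi> b)) (u b))"
      then show "w \<in> ?W"
        using assms pi[OF assms] by (intro CollectI conjI bexI[OF _ assms]) (simp_all add: sep_def config_simps)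
    qed
    have "?W = (\<Union>b\<in>B. sep (config z u (\<pi> b)) (config z u b))"
      unfolding sep_def by blast
    then show "?W \<in> sets \<mu>"
      using fin by (simp add: sets.finite_UN)
  qed
  then show ?thesis by (simp add: measure_sep)
qed

lemma twins_in_config_near0:
  assumes "twins_in (config z u)" "b \<in> B"
  shows "near0 (u b)"
proof -
  have "near (config z u (\<pi> b)) (config z u b) = near (config z u b) (config z u b)"
    using assms unfolding twins_in_def by blast
  then show ?thesis using assms(2) pi[OF assms(2)] by (simp add: near_refl config_simps near_tadd_right)
qed

abbreviation mean_avoid :: "points \<Rightarrow> real" where
  "mean_avoid u \<equiv> \<integral>z. avoid (config z u) \<partial>\<M> A"

text \<open>The union of the separating sets is at least as large as their mean volume, so the
  probability of avoiding it is at most a product over B, however the sets overlap. The base points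
  may therefore be shared, as for three mutual twins.\<close>

lemma prob_twins_le:
  "prob_twins \<le> psi (real (card J) / card B) ^ card B"
proof -
  let ?k = "real (card B)" and ?m = "real (card J)"
  let ?f = "\<lambda>w. if near0 w then exp (- (?m / ?k) * sepvol w) else 0"
  have k: "?k > 0" using fin B_ne by (simp add: card_gt_0_iff)
  interpret PA: prob_space "\<M> A" by (rule prob_space_PM)
  interpret PB: prob_space "\<M> B" by (rule prob_space_PM)
  have f01: "0 \<le> ?f w" "?f w \<le> 1" for w using sepvol_bounds[of w] by auto
  have fi: "integrable \<mu> ?f" using f01 by (intro mu.integrable_const_bound[where B=1]) auto
  have le: "avoid (config z u) \<le> (\<Prod>b\<in>B. ?f (u b))" for z u
  proof (cases "twins_in (config z u)")
    case True
    have "(\<Sum>b\<in>B. sepvol (u b)) \<le> (\<Sum>b\<in>B. unionvol (config z u))"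
      by (intro sum_mono unionvol_config_ge)
    then have "(\<Sum>b\<in>B. sepvol (u b)) / ?k \<le> unionvol (config z u)" using k by (simp add: field_simps)
    then have "?m * ((\<Sum>b\<in>B. sepvol (u b)) / ?k) \<le> ?m * unionvol (config z u)" by (intro mult_left_mono) auto
    have "(1 - unionvol (config z u)) ^ card J \<le> exp (- unionvol (config z u)) ^ card J"
      using unionvol_bounds[of "config z u"] exp_ge_add_one_self[of "- unionvol (config z u)"] by (intro power_mono) auto
    also have "\<dots> = exp (- (?m * unionvol (config z u)))" by (simp flip: exp_of_nat_mult)
    also have "\<dots> \<le> exp (- (?m * ((\<Sum>b\<in>B. sepvol (u b)) / ?k)))" using \<open>?m * _ \<le> _\<close> by simp
    also have "- (?m * ((\<Sum>b\<in>B. sepvol (u b)) / ?k)) = (\<Sum>b\<in>B. - (?m / ?k) * sepvol (u b))"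
      by (simp add: sum_negf sum_distrib_left sum_divide_distrib)
    also have "exp \<dots> = (\<Prod>b\<in>B. ?f (u b))"
      using fin twins_in_config_near0[OF True] by (simp add: exp_sum)
    finally show ?thesis using True by (simp add: avoid_def)
  next
    case False
    then show ?thesis by (simp add: avoid_def prod_nonneg)
  qed
  have "prob_twins = (\<integral>u. mean_avoid u \<partial>\<M> B)"
    by (simp only: prob_twins_eq_avoid integral_avoid_config)
  also have "\<dots> \<le> (\<integral>u. (\<Prod>b\<in>B. ?f (u b)) \<partial>\<M> B)"
  proof (rule integral_mono')
    show "integrable (\<M> B) (\<lambda>u. \<Prod>b\<in>B. ?f (u b))"
      using fin fi by (intro PM.product_integrable_prod) auto
    fix u
    have "mean_avoid u \<le> (\<integral>z. (\<Prod>b\<in>B. ?f (u b)) \<partial>\<M> A)"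
      using le f01 by (intro integral_mono') (auto intro!: prod_nonneg)
    then show "mean_avoid u \<le> (\<Prod>b\<in>B. ?f (u b))" by (simp add: PA.prob_space)
  qed (use f01 in \<open>auto intro!: prod_nonneg\<close>)
  also have "\<dots> = (\<Prod>b\<in>B. \<integral>w. ?f w \<partial>\<mu>)"
    using fin fi by (intro PM.product_integral_prod) auto
  also have "\<dots> = psi (?m / ?k) ^ card B" by (simp add: psi_def)
  finally show ?thesis .
qed

end

text \<open>Injectivity makes the base points of different pairs independent, the equation for A
  limits the cluster to \<open>2 * card B\<close> vertices, and \<open>card J \<ge> 2\<close> is
  what \<open>exp_tail_bound\<close> asks for.\<close>

locale matching_cluster = cluster +
  assumes inj: "inj_on \<pi> B" and A_eq: "A = \<pi> ` B" and J2: "card J \<ge> 2"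
begin

abbreviation Sb :: "points \<Rightarrow> points \<Rightarrow> nat \<Rightarrow> point set" where
  "Sb z u b \<equiv> sep (z (\<pi> b)) (tadd (z (\<pi> b)) (u b))"

definition hit :: "points \<Rightarrow> points \<Rightarrow> nat \<Rightarrow> nat \<Rightarrow> real" where
  "hit z u b v = (if config z u v \<in> Sb z u b then 1 else 0)"

text \<open>The vertex v belongs to another pair, whose base point differs from
  \<open>\<pi> b\<close> by injectivity. So its position is uniform and independent of the base
  point of b.\<close>

lemma integral_hit:
  assumes b: "b \<in> B" and v: "v \<in> A \<union> B - {b, \<pi> b}"
  shows "(\<integral>z. hit z u b v \<partial>\<M> A) = sepvol (u b)" "integrable (\<M> A) (\<lambda>z. hit z u b v)"
proof -
  interpret PA: prob_space "\<M> A" by (rule prob_space_PM)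
  \<comment> \<open>\<open>a'\<close> is the base point of the pair containing v, and t leads from
    its position to the position of v.\<close>
  define t where "t = (if v \<in> A then (\<lambda>y. y) else (\<lambda>y. tadd y (u v)))"
  define a' where "a' = (if v \<in> A then v else \<pi> v)"
  have a': "a' \<in> A" "a' \<noteq> \<pi> b"
    using v b pi inj by (auto simp: a'_def inj_on_def)
  have t[measurable]: "t \<in> \<mu> \<rightarrow>\<^sub>M \<mu>" by (auto simp: t_def)
  define F where "F x y = (if t y \<in> sep x (tadd x (u b)) then 1 else 0 :: real)" for x y
  have hit: "hit z u b v = F (z (\<pi> b)) (z a')" for z
    using v by (auto simp: hit_def F_def t_def a'_def config_simps)
  have F[measurable]: "(\<lambda>p. F (fst p) (snd p)) \<in> borel_measurable (\<mu> \<Otimes>\<^sub>M \<mu>)"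
  proof -
    have [measurable]: "Measurable.pred (\<mu> \<Otimes>\<^sub>M \<mu>) (\<lambda>p. t (snd p) \<in> space \<mu>)"
      by (subst measurable_cong[where g="\<lambda>_. True"]) (use measurable_space[OF t] in \<open>auto simp: space_pair_measure\<close>)
    show ?thesis unfolding F_def sep_def mem_Collect_eq by measurable
  qed
  have inner: "(\<integral>y. F x y \<partial>\<mu>) = sepvol (u b)" for x
  proof -
    have "(\<integral>y. F x y \<partial>\<mu>) = (\<integral>y. indicator {y \<in> space \<mu>. t y \<in> sep x (tadd x (u b))} y \<partial>\<mu>)"
      by (intro Bochner_Integration.integral_cong refl) (auto simp: F_def)
    also have "\<dots> = measure \<mu> {y \<in> space \<mu>. t y \<in> sep x (tadd x (u b))}"
      by (simp add: Int_absorb2)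
    also have "\<dots> = sepvol (u b)" by (cases "v \<in> A") (simp_all add: t_def prob_hit)
    finally show ?thesis .
  qed
  have "(\<integral>z. F (z (\<pi> b)) (z a') \<partial>\<M> A) = (\<integral>x. (\<integral>y. F x y \<partial>\<mu>) \<partial>\<mu>)"
    by (rule two_point_integral[where c=1]) (use fin pi[OF b] a' F in \<open>auto simp: F_def\<close>)
  then show "(\<integral>z. hit z u b v \<partial>\<M> A) = sepvol (u b)"
    by (simp add: hit inner mu.prob_space)
  have "(\<lambda>z. F (z (\<pi> b)) (z a')) \<in> borel_measurable (\<M> A)"
    using measurable_compose[OF measurable_Pair[OF measurable_component_singleton[OF pi[OF b]] measurable_component_singleton[OF a'(1)]] F]
    by simp
  then show "integrable (\<M> A) (\<lambda>z. hit z u b v)"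
    unfolding hit by (intro PA.integrable_const_bound[where B=1]) (auto simp: F_def)
qed

definition ov :: "points \<Rightarrow> points \<Rightarrow> nat \<Rightarrow> nat \<Rightarrow> real" where
  "ov z u b b' = measure \<mu> (Sb z u b \<inter> Sb z u b')"

lemma integral_ov:
  assumes b: "b \<in> B" and b': "b' \<in> B - {b}"
  shows "(\<integral>z. ov z u b b' \<partial>\<M> A) = sepvol (u b) * sepvol (u b')" "integrable (\<M> A) (\<lambda>z. ov z u b b')"
proof -
  interpret PA: prob_space "\<M> A" by (rule prob_space_PM)
  have ne: "\<pi> b \<noteq> \<pi> b'" using b b' inj by (auto simp: inj_on_def)
  have pb': "\<pi> b' \<in> A" using b' pi by auto
  define F where "F x y = measure \<mu> (sep x (tadd x (u b)) \<inter> sep y (tadd y (u b')))" for x y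
  have F[measurable]: "(\<lambda>p. F (fst p) (snd p)) \<in> borel_measurable (\<mu> \<Otimes>\<^sub>M \<mu>)"
  proof -
    have "(\<lambda>p. measure \<mu> {w \<in> space \<mu>. near (fst p) w \<noteq> near (tadd (fst p) (u b)) w \<and> near (snd p) w \<noteq> near (tadd (snd p) (u b')) w})
       \<in> borel_measurable (\<mu> \<Otimes>\<^sub>M \<mu>)"
      by (rule measure_section_measurable[OF mu.finite_measure_axioms]) measurable
    also have "(\<lambda>p. measure \<mu> {w \<in> space \<mu>. near (fst p) w \<noteq> near (tadd (fst p) (u b)) w \<and> near (snd p) w \<noteq> near (tadd (snd p) (u b')) w})
      = (\<lambda>p. F (fst p) (snd p))"
      unfolding F_def by (intro ext arg_cong[where f="measure \<mu>"]) (auto simp: sep_def)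
    finally show ?thesis .
  qed
  have "(\<integral>z. F (z (\<pi> b)) (z (\<pi> b')) \<partial>\<M> A) = (\<integral>x. (\<integral>y. F x y \<partial>\<mu>) \<partial>\<mu>)"
    by (rule two_point_integral[where c=1]) (use fin pi[OF b] pb' ne F in \<open>auto simp: F_def\<close>)
  then show "(\<integral>z. ov z u b b' \<partial>\<M> A) = sepvol (u b) * sepvol (u b')"
    by (simp add: ov_def F_def integral_sep_Int)
  have "(\<lambda>z. F (z (\<pi> b)) (z (\<pi> b'))) \<in> borel_measurable (\<M> A)"
    using measurable_compose[OF measurable_Pair[OF measurable_component_singleton[OF pi[OF b]] measurable_component_singleton[OF pb']] F]
    by simp
  then show "integrable (\<M> A) (\<lambda>z. ov z u b b')"
    unfolding ov_def by (intro PA.integrable_const_bound[where B=1]) (auto simp: F_def)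
qed

text \<open>If no cluster vertex separates a pair, \<open>avoid\<close> is a power of one minus the
  volume of the union and is compared with the product by \<open>abs_power_diff_prod_le\<close>.
  Otherwise \<open>avoid\<close> is 0 and some \<open>hit\<close> equals 1, to which the product is
  charged, being at most the first exponential. The prefactor records that everything vanishes
  unless all pairs are adjacent.\<close>

lemma pointwise_bound:
  assumes z: "z \<in> space (\<M> A)"
  defines "s \<equiv> \<lambda>u. \<Sum>b\<in>B. sepvol (u b)" and "k \<equiv> card B" and "m \<equiv> card J"
  shows "\<bar>avoid (config z u) - (\<Prod>b\<in>B. if near0 (u b) then (1 - sepvol (u b)) ^ m else 0)\<bar>
    \<le> (\<Prod>b\<in>B. if near0 (u b) then 1 else 0) *
       ((\<Sum>b\<in>B. \<Sum>v\<in>A \<union> B - {b, \<pi> b}. hit z u b v) * exp (- (real m * s u / k))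
        + real m * ((\<Sum>b\<in>B. \<Sum>b'\<in>B - {b}. ov z u b b') + (s u)\<^sup>2) * exp (- (real (m - 1) * s u / k)))"
   (is "_ \<le> _ * (?X * ?e1 + ?Y * ?e2)")
proof (cases "\<forall>b\<in>B. near0 (u b)")
  case False
  then obtain b where b: "b \<in> B" "\<not> near0 (u b)" by blast
  have "avoid (config z u) = 0" using twins_in_config_near0[OF _ b(1)] b(2) by (auto simp: avoid_def)
  moreover have "(\<Prod>b\<in>B. if near0 (u b) then (1 - sepvol (u b)) ^ m else 0) = 0" "(\<Prod>b\<in>B. if near0 (u b) then 1 else 0) = (0::real)"
    using b fin by (auto intro!: prod_zero bexI[of _ b])
  ultimately show ?thesis by simp
next
  case True
  have k: "k \<ge> 1" using fin B_ne by (simp add: k_def Suc_le_eq card_gt_0_iff)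
  have s0: "s u \<ge> 0" unfolding s_def using sepvol_bounds by (intro sum_nonneg) auto
  have m: "m \<ge> 1" using J2 by (simp add: m_def)
  have ov0: "0 \<le> (\<Sum>b\<in>B. \<Sum>b'\<in>B - {b}. ov z u b b')" by (intro sum_nonneg) (simp add: ov_def)
  have Y: "0 \<le> ?Y * ?e2" using ov0 by simp
  have hit0: "0 \<le> hit z u b v" for b v by (simp add: hit_def)
  have X: "0 \<le> ?X * ?e1" by (intro mult_nonneg_nonneg sum_nonneg hit0) auto
  have csp: "config z u v \<in> space \<mu>" if "v \<in> A \<union> B" for v
    using that z by (auto simp: config_simps space_PiM)
  have "\<bar>avoid (config z u) - (\<Prod>b\<in>B. (1 - sepvol (u b)) ^ m)\<bar> \<le> ?X * ?e1 + ?Y * ?e2"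
  proof (cases "twins_in (config z u)")
    case tw: True
    have un: "unionvol (config z u) = measure \<mu> (\<Union>b\<in>B. Sb z u b)"
      unfolding unionvol_def using pi
      by (intro arg_cong[where f="measure \<mu>"]) (auto simp: sep_def config_simps)
    have "\<bar>(1 - unionvol (config z u)) ^ m - (\<Prod>b\<in>B. (1 - sepvol (u b)) ^ m)\<bar> \<le> ?Y * ?e2"
    proof (rule abs_power_diff_prod_le[OF fin(2) meta_eq_to_obj_eq[OF k_def, symmetric] k _ _ _ _ _ _ _ ov0 m])
      show "s u = (\<Sum>b\<in>B. sepvol (u b))" by (simp add: s_def)
      show "unionvol (config z u) \<le> s u"
        unfolding un s_def using mu.finite_measure_subadditive_finite[of B "Sb z u"] fin by (simp add: measure_sep image_subset_iff)
      show "s u - (\<Sum>b\<in>B. \<Sum>b'\<in>B - {b}. ov z u b b') \<le> unionvol (config z u)"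
        unfolding un s_def ov_def using mu.measure_UN_ge[of B "Sb z u"] fin by (simp add: measure_sep)
    qed (use sepvol_bounds unionvol_config_ge unionvol_bounds in auto)
    then show ?thesis using tw X by (simp add: avoid_def m_def)
  next
    case ntw: False
    then obtain b v where bv: "b \<in> B" "v \<in> A \<union> B" "near (config z u (\<pi> b)) (config z u v) \<noteq> near (config z u b) (config z u v)"
      unfolding twins_in_def by blast
    have nb: "near (config z u (\<pi> b)) (config z u b)"
      using bv(1) pi[OF bv(1)] True by (simp add: config_simps near_tadd_right)
    \<comment> \<open>The pair is adjacent, so neither of its own vertices can separate it.\<close>
    have v: "v \<in> A \<union> B - {b, \<pi> b}"
      using bv nb near_commute near_refl by blast
    have h1: "hit z u b v = 1"
      using bv csp[OF bv(2)] pi[OF bv(1)] by (auto simp: hit_def sep_def config_simps)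
    have "hit z u b v \<le> (\<Sum>v\<in>A \<union> B - {b, \<pi> b}. hit z u b v)"
      using fin v by (intro member_le_sum hit0) auto
    also have "\<dots> \<le> ?X"
      using fin bv(1) by (intro member_le_sum[where f="\<lambda>b. \<Sum>v\<in>A \<union> B - {b, \<pi> b}. hit z u b v"] sum_nonneg hit0) auto
    finally have "1 \<le> ?X" by (simp add: h1)
    have "(\<Prod>b\<in>B. (1 - sepvol (u b)) ^ m) \<le> (\<Prod>b\<in>B. exp (- real m * sepvol (u b)))"
      using sepvol_bounds by (intro prod_mono conjI one_minus_le_exp_power) auto
    also have "\<dots> = exp (- (real m * s u))"
      using fin by (simp add: s_def sum_negf sum_distrib_left flip: exp_sum)
    also have "\<dots> \<le> ?e1"
    proof -
      have "real m * s u / k \<le> real m * s u / 1" using k s0 by (intro divide_left_mono) auto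
      then show ?thesis by simp
    qed
    also have "\<dots> \<le> ?X * ?e1" using \<open>1 \<le> ?X\<close> by simp
    finally have "(\<Prod>b\<in>B. (1 - sepvol (u b)) ^ m) \<le> ?X * ?e1" .
    moreover have "0 \<le> (\<Prod>b\<in>B. (1 - sepvol (u b)) ^ m)" using sepvol_bounds by (intro prod_nonneg) auto
    ultimately show ?thesis using ntw Y by (simp add: avoid_def)
  qed
  then show ?thesis using True by simp
qed

text \<open>Averaged over the base points, the hits amount to at most \<open>2 k s\<close> and the
  overlaps to at most \<open>s^2\<close>. These are the two terms that \<open>exp_tail_bound\<close>
  converts into a factor 1/m times a product of exponentials.\<close>

lemma conditional_bound:
  defines "s \<equiv> \<lambda>u. \<Sum>b\<in>B. sepvol (u b)" and "k \<equiv> card B" and "m \<equiv> card J"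
  shows "\<bar>mean_avoid u - (\<Prod>b\<in>B. if near0 (u b) then (1 - sepvol (u b)) ^ m else 0)\<bar>
    \<le> 72 * (real k)\<^sup>2 / real m * (\<Prod>b\<in>B. if near0 (u b) then exp (- (real m / (4 * real k)) * sepvol (u b)) else 0)"
proof -
  interpret PA: prob_space "\<M> A" by (rule prob_space_PM)
  let ?P = "\<Prod>b\<in>B. if near0 (u b) then (1 - sepvol (u b)) ^ m else 0"
  let ?a = "\<Prod>b\<in>B. if near0 (u b) then 1 else 0 :: real"
  let ?e1 = "exp (- (real m * s u / k))" and ?e2 = "exp (- (real (m - 1) * s u / k))"
  let ?X = "\<lambda>z. \<Sum>b\<in>B. \<Sum>v\<in>A \<union> B - {b, \<pi> b}. hit z u b v"
  let ?O = "\<lambda>z. \<Sum>b\<in>B. \<Sum>b'\<in>B - {b}. ov z u b b'"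
  have k: "k \<ge> 1" using fin B_ne by (simp add: k_def Suc_le_eq card_gt_0_iff)
  have m: "m \<ge> 2" using J2 by (simp add: m_def)
  have s0: "s u \<ge> 0" unfolding s_def using sepvol_bounds by (intro sum_nonneg) auto
  have a0: "?a \<ge> 0" by (intro prod_nonneg) auto
  have iX: "integrable (\<M> A) ?X" by (intro Bochner_Integration.integrable_sum integral_hit)
  have iO: "integrable (\<M> A) ?O" by (intro Bochner_Integration.integrable_sum integral_ov)
  have EX: "(\<integral>z. ?X z \<partial>\<M> A) \<le> 2 * real k * s u"
  proof -
    have "(\<integral>z. ?X z \<partial>\<M> A) = (\<Sum>b\<in>B. \<Sum>v\<in>A \<union> B - {b, \<pi> b}. sepvol (u b))"
    proof -
      have "(\<integral>z. ?X z \<partial>\<M> A) = (\<Sum>b\<in>B. \<integral>z. (\<Sum>v\<in>A \<union> B - {b, \<pi> b}. hit z u b v) \<partial>\<M> A)"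
        by (intro Bochner_Integration.integral_sum Bochner_Integration.integrable_sum integral_hit(2))
      also have "\<dots> = (\<Sum>b\<in>B. \<Sum>v\<in>A \<union> B - {b, \<pi> b}. \<integral>z. hit z u b v \<partial>\<M> A)"
        by (intro sum.cong refl Bochner_Integration.integral_sum integral_hit(2))
      also have "\<dots> = (\<Sum>b\<in>B. \<Sum>v\<in>A \<union> B - {b, \<pi> b}. sepvol (u b))"
        by (intro sum.cong refl integral_hit(1))
      finally show ?thesis .
    qed
    also have "\<dots> \<le> (\<Sum>b\<in>B. 2 * real k * sepvol (u b))"
    proof (intro sum_mono)
      fix b
      have "card (A \<union> B - {b, \<pi> b}) \<le> card (A \<union> B)" using fin by (intro card_mono) auto
      also have "\<dots> \<le> card A + card B" by (rule card_Un_le)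
      also have "card A \<le> card B" unfolding A_eq using fin by (intro card_image_le)
      finally have "real (card (A \<union> B - {b, \<pi> b})) \<le> 2 * real k" unfolding k_def by simp
      then show "(\<Sum>v\<in>A \<union> B - {b, \<pi> b}. sepvol (u b)) \<le> 2 * real k * sepvol (u b)"
        using sepvol_bounds[of "u b"] by (simp add: mult_right_mono)
    qed
    also have "\<dots> = 2 * real k * s u" by (simp add: s_def sum_distrib_left)
    finally show ?thesis .
  qed
  have EO: "(\<integral>z. ?O z \<partial>\<M> A) \<le> (s u)\<^sup>2"
  proof -
    have "(\<integral>z. ?O z \<partial>\<M> A) = (\<Sum>b\<in>B. \<Sum>b'\<in>B - {b}. sepvol (u b) * sepvol (u b'))"
    proof -
      have "(\<integral>z. ?O z \<partial>\<M> A) = (\<Sum>b\<in>B. \<integral>z. (\<Sum>b'\<in>B - {b}. ov z u b b') \<partial>\<M> A)"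
        by (intro Bochner_Integration.integral_sum Bochner_Integration.integrable_sum integral_ov(2))
      also have "\<dots> = (\<Sum>b\<in>B. \<Sum>b'\<in>B - {b}. \<integral>z. ov z u b b' \<partial>\<M> A)"
        by (intro sum.cong refl Bochner_Integration.integral_sum integral_ov(2))
      also have "\<dots> = (\<Sum>b\<in>B. \<Sum>b'\<in>B - {b}. sepvol (u b) * sepvol (u b'))"
        by (intro sum.cong refl integral_ov(1))
      finally show ?thesis .
    qed
    also have "\<dots> \<le> (\<Sum>b\<in>B. \<Sum>b'\<in>B. sepvol (u b) * sepvol (u b'))"
      using fin sepvol_bounds by (intro sum_mono sum_mono2) auto
    also have "\<dots> = (s u)\<^sup>2" by (simp add: s_def power2_eq_square sum_product)
    finally show ?thesis .
  qed
  have iH: "integrable (\<M> A) (\<lambda>z. avoid (config z u))"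
  proof -
    \<comment> \<open>u is arbitrary and may lie outside the space of \<open>\<M> B\<close>. Adding
      the origin normalises it to a point u' of that space with the same configurations, where
      measurability of the section is available.\<close>
    define u' where "u' = (\<lambda>b\<in>B. tadd (u b) (\<lambda>_. 0))"
    have "config z u = config z u'" for z
      unfolding config_def u'_def by (intro arg_cong[where f="merge A B"]) (auto simp: tadd_def restrict_def fun_eq_iff)
    moreover have [measurable]: "u' \<in> space (\<M> B)" by (auto simp: u'_def space_PiM)
    then have "(\<lambda>z. avoid (config z u')) \<in> borel_measurable (\<M> A)" by measurable
    ultimately have "(\<lambda>z. avoid (config z u)) \<in> borel_measurable (\<M> A)" by simp
    then show ?thesis using avoid_bounds by (intro PA.integrable_const_bound[where B=1]) auto
  qed
  have "\<bar>mean_avoid u - ?P\<bar> = \<bar>\<integral>z. avoid (config z u) - ?P \<partial>\<M> A\<bar>"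
    using iH by (simp add: PA.prob_space)
  also have "\<dots> \<le> (\<integral>z. \<bar>avoid (config z u) - ?P\<bar> \<partial>\<M> A)"
    by (rule integral_abs_bound)
  also have "\<dots> \<le> (\<integral>z. ?a * (?X z * ?e1 + real m * (?O z + (s u)\<^sup>2) * ?e2) \<partial>\<M> A)"
    using pointwise_bound iX iO iH unfolding s_def k_def m_def
    by (intro integral_mono) auto
  also have "\<dots> = ?a * ((\<integral>z. ?X z \<partial>\<M> A) * ?e1 + real m * ((\<integral>z. ?O z \<partial>\<M> A) + (s u)\<^sup>2) * ?e2)"
    using iX iO by (simp add: PA.prob_space)
  also have "\<dots> \<le> ?a * (2 * real k * s u * ?e1 + real m * ((s u)\<^sup>2 + (s u)\<^sup>2) * ?e2)"
    using EX EO a0 by (intro mult_left_mono add_mono mult_right_mono) auto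
  also have "\<dots> = ?a * (2 * real k * s u * ?e1 + 2 * real m * (s u)\<^sup>2 * ?e2)"
    by (simp add: algebra_simps)
  also have "\<dots> \<le> ?a * (72 * (real k)\<^sup>2 / real m * exp (- (real m / (4 * real k) * s u)))"
    by (intro mult_left_mono exp_tail_bound s0 k m a0)
  also have "\<dots> = 72 * (real k)\<^sup>2 / real m * (?a * (\<Prod>b\<in>B. exp (- (real m / (4 * real k)) * sepvol (u b))))"
    using fin by (simp add: s_def sum_distrib_left sum_negf flip: exp_sum)
  also have "?a * (\<Prod>b\<in>B. exp (- (real m / (4 * real k)) * sepvol (u b))) = (\<Prod>b\<in>B. if near0 (u b) then exp (- (real m / (4 * real k)) * sepvol (u b)) else 0)"
    unfolding prod.distrib[symmetric] by (intro prod.cong) auto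
  finally show ?thesis .
qed

text \<open>By \<open>psi_bound\<close> the power of \<open>psi\<close> has the same order
  \<open>m^(-D k)\<close> as the main term \<open>phi m ^ k\<close>, so the factor 1/m is a genuine
  relative error.\<close>

lemma prob_twins_approx:
  defines "k \<equiv> card B" and "m \<equiv> card J"
  shows "\<bar>prob_twins - phi m ^ k\<bar>
    \<le> 72 * (real k)\<^sup>2 / real m * psi (real m / (4 * real k)) ^ k"
proof -
  interpret PA: prob_space "\<M> A" by (rule prob_space_PM)
  interpret PB: prob_space "\<M> B" by (rule prob_space_PM)
  let ?F = "\<lambda>u. \<Prod>b\<in>B. if near0 (u b) then (1 - sepvol (u b)) ^ m else 0"
  let ?G = "\<lambda>u. \<Prod>b\<in>B. if near0 (u b) then exp (- (real m / (4 * real k)) * sepvol (u b)) else 0"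
  have i1: "integrable \<mu> (\<lambda>w. if near0 w then (1 - sepvol w) ^ m else 0)"
    using sepvol_bounds by (intro mu.integrable_const_bound[where B=1]) (auto intro!: power_le_one)
  have i2: "integrable \<mu> (\<lambda>w. if near0 w then exp (- (real m / (4 * real k)) * sepvol w) else 0)"
    using sepvol_bounds by (intro mu.integrable_const_bound[where B=1]) auto
  have F: "(\<integral>u. ?F u \<partial>\<M> B) = phi m ^ k" "integrable (\<M> B) ?F"
    using fin i1 PM.product_integral_prod[of B "\<lambda>_ w. if near0 w then (1 - sepvol w) ^ m else 0"]
      PM.product_integrable_prod[of B "\<lambda>_ w. if near0 w then (1 - sepvol w) ^ m else 0"]
    by (auto simp: phi_def k_def)
  have G: "(\<integral>u. ?G u \<partial>\<M> B) = psi (real m / (4 * real k)) ^ k" "integrable (\<M> B) ?G"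
    using fin i2 PM.product_integral_prod[of B "\<lambda>_ w. if near0 w then exp (- (real m / (4 * real k)) * sepvol w) else 0"]
      PM.product_integrable_prod[of B "\<lambda>_ w. if near0 w then exp (- (real m / (4 * real k)) * sepvol w) else 0"]
    by (simp_all add: psi_def k_def[symmetric])
  have iH: "integrable (\<M> B) mean_avoid"
  proof (rule PB.integrable_const_bound[where B=1])
    show "mean_avoid \<in> borel_measurable (\<M> B)"
      by (rule PA.borel_measurable_lebesgue_integral) (simp add: split_beta')
    show "AE u in \<M> B. norm (mean_avoid u) \<le> 1"
    proof (intro AE_I2)
      fix u
      have "mean_avoid u \<le> (\<integral>z. 1 \<partial>\<M> A)" using avoid_bounds by (intro integral_mono') auto
      moreover have "0 \<le> mean_avoid u" using avoid_bounds by (intro Bochner_Integration.integral_nonneg) auto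
      ultimately show "norm (mean_avoid u) \<le> 1" by (simp add: PA.prob_space)
    qed
  qed
  have "\<bar>prob_twins - phi m ^ k\<bar> = \<bar>\<integral>u. mean_avoid u - ?F u \<partial>\<M> B\<bar>"
    using iH F by (simp only: prob_twins_eq_avoid integral_avoid_config) simp
  also have "\<dots> \<le> (\<integral>u. \<bar>mean_avoid u - ?F u\<bar> \<partial>\<M> B)" by (rule integral_abs_bound)
  also have "\<dots> \<le> (\<integral>u. 72 * (real k)\<^sup>2 / real m * ?G u \<partial>\<M> B)"
    using conditional_bound iH F G unfolding k_def m_def by (intro integral_mono) auto
  also have "\<dots> = 72 * (real k)\<^sup>2 / real m * psi (real m / (4 * real k)) ^ k"
    using G by simp
  finally show ?thesis .
qed

end

section \<open>Matchings of a twin relation\<close>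

definition entries :: "('a \<times> 'a) list \<Rightarrow> 'a list" where
  "entries ps = concat (map (\<lambda>p. [fst p, snd p]) ps)"

lemma entries_simps [simp]: "entries [] = []" "entries (p # ps) = fst p # snd p # entries ps"
  by (simp_all add: entries_def)

lemma set_entries: "set (entries ps) = fst ` set ps \<union> snd ` set ps"
  by (induction ps) auto

lemma length_entries [simp]: "length (entries ps) = 2 * length ps"
  by (induction ps) auto

lemma distinct_flatD:
  assumes "distinct (entries ps)"
  shows "distinct ps" "inj_on fst (set ps)" "inj_on snd (set ps)" "fst ` set ps \<inter> snd ` set ps = {}"
proof -
  have "distinct ps \<and> inj_on fst (set ps) \<and> inj_on snd (set ps) \<and> fst ` set ps \<inter> snd ` set ps = {}"
    using assms
  proof (induction ps)
    case (Cons p ps)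
    then show ?case by (auto simp: set_entries inj_on_def image_iff)
  qed auto
  then show "distinct ps" "inj_on fst (set ps)" "inj_on snd (set ps)" "fst ` set ps \<inter> snd ` set ps = {}" by auto
qed

text \<open>Lists of ordered pairs, so that a matching grows by prepending one pair at a time. For
  symmetric R an unordered matching with k edges is counted \<open>2^k k!\<close> times.\<close>

definition matchings :: "('a \<Rightarrow> 'a \<Rightarrow> bool) \<Rightarrow> nat \<Rightarrow> ('a \<times> 'a) list set" where
  "matchings R k = {ps. length ps = k \<and> distinct (entries ps) \<and> (\<forall>p\<in>set ps. R (fst p) (snd p))}"

definition ext :: "('a \<Rightarrow> 'a \<Rightarrow> bool) \<Rightarrow> ('a \<times> 'a) list \<Rightarrow> ('a \<times> 'a) set" where
  "ext R ps = {p. R (fst p) (snd p) \<and> fst p \<noteq> snd p \<and> fst p \<notin> set (entries ps) \<and> snd p \<notin> set (entries ps)}"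

lemma matchings_0 [simp]: "matchings R 0 = {[]}"
  by (auto simp: matchings_def)

lemma matchings_Suc: "matchings R (Suc k) = (\<Union>ps\<in>matchings R k. (\<lambda>p. p # ps) ` ext R ps)"
proof (intro set_eqI iffI)
  fix qs assume qs: "qs \<in> matchings R (Suc k)"
  then obtain p ps where "qs = p # ps" by (cases qs) (auto simp: matchings_def)
  with qs show "qs \<in> (\<Union>ps\<in>matchings R k. (\<lambda>p. p # ps) ` ext R ps)"
    by (auto simp: matchings_def ext_def intro!: bexI[of _ ps])
qed (auto simp: matchings_def ext_def)

lemma finite_ext:
  assumes "finite {p. R (fst p) (snd p)}"
  shows "finite (ext R ps)"
  by (rule finite_subset[OF _ assms]) (auto simp: ext_def)

lemma finite_matchings:
  assumes "finite {p. R (fst p) (snd p)}"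
  shows "finite (matchings R k)"
  by (induction k) (auto simp: matchings_Suc finite_ext[OF assms])

lemma card_matchings_Suc:
  assumes "finite {p. R (fst p) (snd p)}"
  shows "card (matchings R (Suc k)) = (\<Sum>ps\<in>matchings R k. card (ext R ps))"
proof -
  have "card (matchings R (Suc k)) = (\<Sum>ps\<in>matchings R k. card ((\<lambda>p. p # ps) ` ext R ps))"
    unfolding matchings_Suc
    by (rule card_UN_disjoint) (use finite_matchings[OF assms] finite_ext[OF assms] in auto)
  also have "\<dots> = (\<Sum>ps\<in>matchings R k. card (ext R ps))"
    by (intro sum.cong refl card_image) (auto simp: inj_on_def)
  finally show ?thesis .
qed

lemma card_off_diagonal:
  assumes "finite W"
  shows "card {p. fst p \<in> W \<and> snd p \<in> W \<and> fst p \<noteq> snd p} = card W * (card W - 1)"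
proof -
  have "{p. fst p \<in> W \<and> snd p \<in> W \<and> fst p \<noteq> snd p} = (SIGMA a:W. W - {a})" by auto
  then show ?thesis using assms by (simp add: card_SigmaI)
qed

text \<open>The exact count is a falling factorial with \<open>2 j\<close> factors; the two bounds
  retain its leading order \<open>card V ^ (2 * j)\<close>, which is all that the limit
  uses.\<close>

lemma card_free_matchings:
  assumes V: "finite V" and j: "j \<le> k"
  shows "(card V - 2 * k) ^ (2 * j) \<le> card (matchings (\<lambda>a b. a \<in> V \<and> b \<in> V) j)"
    "card (matchings (\<lambda>a b. a \<in> V \<and> b \<in> V) j) \<le> card V ^ (2 * j)"
proof -
  let ?R = "\<lambda>a b. a \<in> V \<and> b \<in> V"
  have fin: "finite {p. ?R (fst p) (snd p)}"
    by (rule finite_subset[of _ "V \<times> V"]) (use V in auto)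
  have e: "card (ext ?R ps) = (card V - 2 * i) * (card V - 2 * i - 1)" if "ps \<in> matchings ?R i" for ps i
  proof -
    have "set (entries ps) \<subseteq> V" using that by (auto simp: matchings_def set_entries)
    moreover have "card (set (entries ps)) = 2 * i" using that by (simp add: matchings_def distinct_card)
    ultimately
    have W: "card (V - set (entries ps)) = card V - 2 * i" by (simp add: card_Diff_subset)
    have "ext ?R ps = {p. fst p \<in> V - set (entries ps) \<and> snd p \<in> V - set (entries ps) \<and> fst p \<noteq> snd p}"
      by (auto simp: ext_def)
    then show ?thesis using card_off_diagonal[of "V - set (entries ps)"] V W by simp
  qed
  have "(card V - 2 * k) ^ (2 * j) \<le> card (matchings ?R j) \<and> card (matchings ?R j) \<le> card V ^ (2 * j)"
    using j
  proof (induction j)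
    case (Suc j)
    have c: "card (matchings ?R (Suc j)) = card (matchings ?R j) * ((card V - 2 * j) * (card V - 2 * j - 1))"
      using e by (simp add: card_matchings_Suc[OF fin])
    have "(card V - 2 * k) ^ (2 * j) * ((card V - 2 * k) * (card V - 2 * k)) \<le> card (matchings ?R j) * ((card V - 2 * j) * (card V - 2 * j - 1))"
      using Suc by (intro mult_le_mono) auto
    moreover have "card (matchings ?R j) * ((card V - 2 * j) * (card V - 2 * j - 1)) \<le> card V ^ (2 * j) * (card V * card V)"
      using Suc by (intro mult_le_mono) auto
    ultimately show ?case unfolding c by (simp add: mult_ac)
  qed simp
  then show "(card V - 2 * k) ^ (2 * j) \<le> card (matchings ?R j)" "card (matchings ?R j) \<le> card V ^ (2 * j)" by auto
qed

section \<open>Counting matchings inside equivalence classes\<close>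

lemma binomial_times_diff: "(n choose k) * (n - k) = Suc k * (n choose Suc k)"
proof (cases n)
  case (Suc m)
  then show ?thesis
    using binomial_absorb_comp[of n k] Suc_times_binomial_eq[of m k] by (simp add: mult.commute)
qed simp

text \<open>An equivalence relation with its diagonal removed: the classes are sets of mutual
  twins.\<close>

locale twin_relation =
  fixes R :: "'a \<Rightarrow> 'a \<Rightarrow> bool"
  assumes fin: "finite {p. R (fst p) (snd p)}"
    and irrefl: "\<not> R a a"
    and sym: "R a b \<Longrightarrow> R b a"
    and trans: "R a b \<Longrightarrow> R b c \<Longrightarrow> a \<noteq> c \<Longrightarrow> R a c"
begin

definition num :: nat where "num = card {{a, b} | a b. R a b}"

lemma card_ordered: "card {p. R (fst p) (snd p)} = 2 * num"
proof -
  let ?O = "{p. R (fst p) (snd p)}" and ?P = "{{a, b} | a b. R a b}"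
  let ?f = "\<lambda>p. {fst p, snd p}"
  have P: "?P = ?f ` ?O"
  proof (intro set_eqI iffI)
    fix e assume "e \<in> ?P"
    then obtain a b where "R a b" "e = {a, b}" by blast
    then show "e \<in> ?f ` ?O" by (intro image_eqI[of _ _ "(a, b)"]) auto
  qed auto
  have "card ?O = (\<Sum>e\<in>?f ` ?O. \<Sum>p\<in>{p \<in> ?O. ?f p = e}. 1)"
    using sum.image_gen[OF fin, of "\<lambda>_. 1::nat" ?f] by simp
  also have "\<dots> = (\<Sum>e\<in>?f ` ?O. 2)"
  proof (intro sum.cong refl)
    fix e assume "e \<in> ?f ` ?O"
    then obtain a b where ab: "R a b" "e = {a, b}" by auto
    then have "a \<noteq> b" using irrefl by blast
    moreover have "{p \<in> ?O. ?f p = e} = {(a, b), (b, a)}"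
      using ab sym by (auto simp: doubleton_eq_iff)
    ultimately show "(\<Sum>p\<in>{p \<in> ?O. ?f p = e}. 1) = (2::nat)" by simp
  qed
  also have "\<dots> = 2 * num" by (simp add: num_def P)
  finally show ?thesis .
qed

text \<open>Every class has at most two members, so the related pairs themselves form a
  matching.\<close>

definition no_triple :: bool where
  "no_triple \<longleftrightarrow> (\<forall>a b c. R a b \<longrightarrow> R a c \<longrightarrow> b = c)"

text \<open>The k chosen pairs in both orientations are \<open>2 k\<close> of the
  \<open>2 * num\<close> ordered pairs, and none of them extends the matching. Without triples, a
  related pair meeting a chosen vertex is one of these, so nothing else is lost.\<close>

lemma card_ext_upper:
  assumes ps: "ps \<in> matchings R k"
  shows "card (ext R ps) \<le> 2 * (num - k)" "no_triple \<Longrightarrow> card (ext R ps) = 2 * (num - k)"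
proof -
  let ?O = "{p. R (fst p) (snd p)}"
  let ?S = "set ps \<union> prod.swap ` set ps"
  have d: "distinct ps" "fst ` set ps \<inter> snd ` set ps = {}" and len: "length ps = k"
    and R: "\<And>p. p \<in> set ps \<Longrightarrow> R (fst p) (snd p)"
    using ps distinct_flatD[of ps] by (auto simp: matchings_def)
  have disj: "set ps \<inter> prod.swap ` set ps = {}"
    using d(2) by force
  have cS: "card ?S = 2 * k"
    using d len disj by (simp add: card_Un_disjoint card_image distinct_card)
  have S: "?S \<subseteq> ?O" using R sym by auto
  have E: "ext R ps \<subseteq> ?O - ?S" by (force simp: ext_def set_entries)
  have cO: "card (?O - ?S) = 2 * (num - k)"
    using S fin by (simp add: card_Diff_subset finite_subset[OF S fin] cS card_ordered diff_mult_distrib2)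
  show "card (ext R ps) \<le> 2 * (num - k)"
    using card_mono[OF _ E] fin cO by simp
  assume nt: "no_triple"
  have "?O - ?S \<subseteq> ext R ps"
  proof
    fix p assume p: "p \<in> ?O - ?S"
    then have Rp: "R (fst p) (snd p)" by simp
    have bad: "p \<in> ?S" if ab: "R a b" "a \<in> set (entries ps)" "p = (a, b) \<or> p = (b, a)" for a b
    proof -
      obtain q where q: "q \<in> set ps" "a = fst q \<or> a = snd q"
        using ab(2) by (auto simp: set_entries)
      define c where "c = (if a = fst q then snd q else fst q)"
      have "R a c" using q R[OF q(1)] sym by (auto simp: c_def)
      then have "b = c" using nt ab(1) by (auto simp: no_triple_def)
      then have "q = (a, b) \<or> q = (b, a)" using q(2) by (auto simp: c_def prod_eq_iff)
      then show ?thesis using ab(3) q(1) by (force simp: prod.swap_def)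
    qed
    have "fst p \<notin> set (entries ps)" using bad[OF Rp] p by auto
    moreover have "snd p \<notin> set (entries ps)" using bad[OF sym[OF Rp]] p by auto
    ultimately show "p \<in> ext R ps" using Rp irrefl by (auto simp: ext_def)
  qed
  with E have "ext R ps = ?O - ?S" by blast
  then show "card (ext R ps) = 2 * (num - k)" using cO by simp
qed

lemma card_matchings_upper:
  "card (matchings R k) \<le> 2 ^ k * fact k * (num choose k) \<and>
   (no_triple \<longrightarrow> card (matchings R k) = 2 ^ k * fact k * (num choose k))"
proof (induction k)
  case (Suc k)
  have step: "2 ^ k * fact k * (num choose k) * (2 * (num - k)) = 2 ^ Suc k * fact (Suc k) * (num choose Suc k)"
  proof -
    have "2 ^ k * fact k * (num choose k) * (2 * (num - k)) = 2 ^ Suc k * fact k * ((num choose k) * (num - k))"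
      by (simp add: mult_ac)
    then show ?thesis unfolding binomial_times_diff by (simp add: algebra_simps)
  qed
  have "card (matchings R (Suc k)) \<le> (\<Sum>ps\<in>matchings R k. 2 * (num - k))"
    unfolding card_matchings_Suc[OF fin] by (intro sum_mono card_ext_upper)
  also have "\<dots> \<le> 2 ^ k * fact k * (num choose k) * (2 * (num - k))"
    using Suc by (simp add: mult_right_mono)
  finally have "card (matchings R (Suc k)) \<le> 2 ^ Suc k * fact (Suc k) * (num choose Suc k)" unfolding step .
  moreover have "card (matchings R (Suc k)) = 2 ^ Suc k * fact (Suc k) * (num choose Suc k)" if nt: "no_triple"
  proof -
    have "card (matchings R (Suc k)) = (\<Sum>ps\<in>matchings R k. 2 * (num - k))"
      unfolding card_matchings_Suc[OF fin] by (intro sum.cong refl card_ext_upper(2) nt)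
    then show ?thesis unfolding step[symmetric] using Suc nt by simp
  qed
  ultimately show ?case by blast
qed simp

definition touched :: "'a set" where "touched = {a. \<exists>b. R a b}"

lemma finite_touched: "finite touched"
proof -
  have "touched \<subseteq> fst ` {p. R (fst p) (snd p)}"
  proof
    fix a assume "a \<in> touched"
    then obtain b where "R a b" by (auto simp: touched_def)
    then show "a \<in> fst ` {p. R (fst p) (snd p)}" by (intro image_eqI[of _ _ "(a, b)"]) auto
  qed
  then show ?thesis using fin by (meson finite_imageI finite_subset)
qed

lemma num_le_touched: "num \<le> card touched ^ 2"
proof -
  have "card {p. R (fst p) (snd p)} \<le> card (touched \<times> touched)"
  proof (intro card_mono subsetI)
    fix p assume "p \<in> {p. R (fst p) (snd p)}"
    then show "p \<in> touched \<times> touched" using sym[of "fst p" "snd p"] unfolding touched_def mem_Times_iff by blast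
  qed (use finite_touched in simp)
  then show ?thesis by (simp add: card_ordered card_cartesian_product power2_eq_square)
qed

text \<open>A touched vertex outside a matching that cannot be matched any more is the only unused member
  of its class, and that class contains an edge of the matching; so there are at most \<open>k\<close> of them.\<close>

lemma card_ext_lower:
  assumes ps: "ps \<in> matchings R k"
  shows "card touched - 3 * k \<le> card (ext R ps)"
proof -
  let ?U = "set (entries ps)"
  let ?Z = "{a \<in> touched. a \<notin> ?U \<and> (\<forall>b. R a b \<longrightarrow> b \<in> ?U)}"
  have len: "length ps = k" and R: "\<And>p. p \<in> set ps \<Longrightarrow> R (fst p) (snd p)"
    using ps by (auto simp: matchings_def)
  have sub: "touched \<subseteq> fst ` ext R ps \<union> ?U \<union> ?Z"
    using irrefl by (force simp: ext_def touched_def image_iff)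
  have cU: "card ?U \<le> 2 * k" using card_length[of "entries ps"] len by simp
  have cE: "card (fst ` ext R ps) \<le> card (ext R ps)" by (intro card_image_le finite_ext fin)
  have "\<forall>a\<in>?Z. \<exists>p. p \<in> set ps \<and> (R a (fst p) \<or> R a (snd p))"
    unfolding touched_def set_entries by fastforce
  then obtain f where "\<forall>a\<in>?Z. f a \<in> set ps \<and> (R a (fst (f a)) \<or> R a (snd (f a)))"
    by (rule bchoice[THEN exE])
  then have f: "\<And>a. a \<in> ?Z \<Longrightarrow> f a \<in> set ps" "\<And>a. a \<in> ?Z \<Longrightarrow> R a (fst (f a)) \<or> R a (snd (f a))"
    by blast+
  have f1: "R a (fst (f a))" if a: "a \<in> ?Z" for a
  proof -
    have "a \<noteq> fst (f a)" using a f(1)[OF a] by (auto simp: set_entries)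
    then show ?thesis using f(2)[OF a] R[OF f(1)[OF a]] sym trans by blast
  qed
  have "inj_on f ?Z"
  proof (rule inj_onI, rule ccontr)
    fix a b assume ab: "a \<in> ?Z" "b \<in> ?Z" "f a = f b" "a \<noteq> b"
    then have "R a b" using f1[of a] f1[of b] sym trans by metis
    then show False using ab by auto
  qed
  then have "card ?Z \<le> card (set ps)" using f(1) by (intro card_inj_on_le[of f]) auto
  then have cZ: "card ?Z \<le> k" using card_length[of ps] len by simp
  have "card touched \<le> card (fst ` ext R ps \<union> ?U \<union> ?Z)"
    using finite_touched fin by (intro card_mono sub) (auto intro!: finite_ext)
  also have "\<dots> \<le> card (fst ` ext R ps) + card ?U + card ?Z"
    by (intro card_Un_le[THEN order_trans] add_mono card_Un_le order_refl)
  finally show ?thesis using cU cE cZ by linarith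
qed

lemma card_matchings_lower:
  assumes "j \<le> k"
  shows "(card touched - 3 * k) ^ j \<le> card (matchings R j)"
  using assms
proof (induction j)
  case (Suc j)
  have "(card touched - 3 * k) ^ j * (card touched - 3 * k) \<le> card (matchings R j) * (card touched - 3 * k)"
    using Suc by (intro mult_right_mono) auto
  also have "\<dots> = (\<Sum>ps\<in>matchings R j. card touched - 3 * k)" by simp
  also have "\<dots> \<le> (\<Sum>ps\<in>matchings R j. card (ext R ps))"
    using Suc.prems by (intro sum_mono order_trans[OF _ card_ext_lower]) auto
  also have "\<dots> = card (matchings R (Suc j))" by (rule card_matchings_Suc[OF fin, symmetric])
  finally show ?case by (simp add: mult.commute)
qed simp

text \<open>With w touched vertices, \<open>num \<le> w^2\<close>, and a greedy choice of
  \<open>2 q\<close> edges has at least \<open>w - 6 q\<close> options at every step. If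
  \<open>w \<le> 12 q\<close> the first summand suffices, otherwise
  \<open>w \<le> 2 (w - 6 q)\<close>. This bounds the moments of \<open>num\<close> by expected
  matching counts even in the presence of triples.\<close>

lemma num_power_le: "num ^ q \<le> (12 * q) ^ (2 * q) + 2 ^ (2 * q) * card (matchings R (2 * q))"
proof -
  let ?p = "2 * q" and ?w = "card touched"
  have "num ^ q \<le> (?w ^ 2) ^ q" by (intro power_mono num_le_touched) auto
  also have "\<dots> = ?w ^ ?p" by (simp add: power_mult)
  also have "\<dots> \<le> (12 * q) ^ ?p + 2 ^ ?p * card (matchings R ?p)"
  proof (cases "?w \<le> 6 * ?p")
    case True
    then have "?w ^ ?p \<le> (12 * q) ^ ?p" by (intro power_mono) auto
    then show ?thesis by simp
  next
    case False
    then have "?w ^ ?p \<le> (2 * (?w - 3 * ?p)) ^ ?p" by (intro power_mono) auto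
    also have "\<dots> \<le> 2 ^ ?p * card (matchings R ?p)"
      unfolding power_mult_distrib by (intro mult_left_mono card_matchings_lower) auto
    finally show ?thesis by simp
  qed
  finally show ?thesis .
qed

end

section \<open>Poisson limits from binomial moments\<close>

lemma alternating_binomial_sum:
  "(\<Sum>i\<le>m. (-1) ^ i * real (Suc s choose i)) = (-1) ^ m * real (s choose m)"
  by (induction m) (simp_all add: algebra_simps)

lemma choose_product: "(t choose j) * ((t - j) choose i) = ((i + j) choose j) * (t choose (i + j))"
proof (cases "i + j \<le> t")
  case True
  then show ?thesis using choose_mult[of j "i + j" t] by (simp add: mult.commute)
next
  case False
  then have "t < j \<or> t - j < i" by linarith
  then show ?thesis using False by (auto simp: binomial_eq_0)
qed

text \<open>Truncated inclusion-exclusion for the event t = j, with error at most the first omitted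
  term. Once \<open>t choose j\<close> is factored out, the alternating sum for t > j collapses to
  the single coefficient \<open>t - j - 1 choose m - 1\<close>, which is at most
  \<open>t - j choose m\<close>.\<close>

lemma bonferroni_binomial:
  assumes "m \<ge> 1"
  shows "\<bar>(if t = j then 1 else 0) - (\<Sum>i<m. (-1) ^ i * (real ((i + j) choose j) * real (t choose (i + j))))\<bar>
    \<le> real ((m + j) choose j) * real (t choose (m + j))"
proof -
  have prod: "real ((i + j) choose j) * real (t choose (i + j)) = real (t choose j) * real ((t - j) choose i)" for i
    by (metis choose_product of_nat_mult)
  have sum: "(\<Sum>i<m. (-1) ^ i * (real ((i + j) choose j) * real (t choose (i + j)))) = real (t choose j) * (\<Sum>i<m. (-1) ^ i * real ((t - j) choose i))"
    unfolding prod sum_distrib_left by (intro sum.cong) auto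
  consider "t < j" | "t = j" | "t > j" by linarith
  then show ?thesis
  proof cases
    case 1
    then show ?thesis unfolding sum by (simp add: binomial_eq_0)
  next
    case 2
    have "(\<Sum>i<m. (-1) ^ i * real (0 choose i)) = (\<Sum>i\<in>{0}. (-1) ^ i * real (0 choose i))"
      using assms by (intro sum.mono_neutral_right) (auto simp: binomial_eq_0)
    then show ?thesis unfolding sum using 2 by simp
  next
    case 3
    then obtain s where s: "t - j = Suc s" by (metis Suc_diff_Suc)
    have m: "{..<m} = {..m - 1}" using assms by auto
    have "(\<Sum>i<m. (-1) ^ i * real ((t - j) choose i)) = (-1) ^ (m - 1) * real (s choose (m - 1))"
      unfolding s m by (rule alternating_binomial_sum)
    then have "\<bar>(if t = j then 1 else 0) - (\<Sum>i<m. (-1) ^ i * (real ((i + j) choose j) * real (t choose (i + j))))\<bar>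
       = real (t choose j) * real (s choose (m - 1))"
      unfolding sum using 3 by (simp add: abs_mult power_abs)
    also have "\<dots> \<le> real (t choose j) * real (Suc s choose m)"
      using assms by (cases m) (auto intro!: mult_left_mono)
    also have "\<dots> = real ((m + j) choose j) * real (t choose (m + j))" unfolding prod s ..
    finally show ?thesis .
  qed
qed

text \<open>First m is fixed so that the limiting approximation and the limiting error are good,
  then n goes to infinity. The convergence in n may be non-uniform in m.\<close>

lemma tendsto_approx:
  fixes x :: "nat \<Rightarrow> real"
  assumes bound: "\<And>m n. m \<ge> 1 \<Longrightarrow> \<bar>x n - a m n\<bar> \<le> e m n"
    and a: "\<And>m. a m \<longlonglongrightarrow> A m" and e: "\<And>m. e m \<longlonglongrightarrow> E m"
    and A: "A \<longlonglongrightarrow> L" and E: "E \<longlonglongrightarrow> 0"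
  shows "x \<longlonglongrightarrow> L"
proof (rule LIMSEQ_I)
  fix \<epsilon> :: real assume \<epsilon>: "\<epsilon> > 0"
  have "\<forall>\<^sub>F m in sequentially. dist (A m) L < \<epsilon> / 4" "\<forall>\<^sub>F m in sequentially. dist (E m) 0 < \<epsilon> / 4"
    using A E \<epsilon> by (auto dest: tendstoD[where e="\<epsilon> / 4"])
  with eventually_ge_at_top[of 1]
  have "\<forall>\<^sub>F m in sequentially. m \<ge> 1 \<and> dist (A m) L < \<epsilon> / 4 \<and> dist (E m) 0 < \<epsilon> / 4"
    by eventually_elim auto
  then obtain m where m: "m \<ge> 1" "dist (A m) L < \<epsilon> / 4" "dist (E m) 0 < \<epsilon> / 4"
    by (auto simp: eventually_sequentially)
  have "\<forall>\<^sub>F n in sequentially. dist (a m n) (A m) < \<epsilon> / 4" "\<forall>\<^sub>F n in sequentially. dist (e m n) (E m) < \<epsilon> / 4"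
    using a[of m] e[of m] \<epsilon> by (auto dest: tendstoD[where e="\<epsilon> / 4"])
  then have "\<forall>\<^sub>F n in sequentially. norm (x n - L) < \<epsilon>"
  proof eventually_elim
    case (elim n)
    then show ?case using bound[OF m(1), of n] m unfolding dist_real_def real_norm_def by linarith
  qed
  then show "\<exists>no. \<forall>n\<ge>no. norm (x n - L) < \<epsilon>" by (simp add: eventually_sequentially)
qed

text \<open>In the limit the Bonferroni sums become partial sums of the exponential series of
  \<open>exp (- l)\<close> times \<open>l^j / j!\<close>, and the error becomes a multiple of
  \<open>l^m / m!\<close>.\<close>

lemma poisson_limit_from_binomial_moments:
  fixes Y :: "nat \<Rightarrow> 'a \<Rightarrow> nat"
  assumes M: "\<And>n. prob_space (M n)"
    and Y[measurable]: "\<And>n. Y n \<in> M n \<rightarrow>\<^sub>M count_space UNIV"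
    and int: "\<And>n k. integrable (M n) (\<lambda>\<omega>. real (Y n \<omega> choose k))"
    and lim: "\<And>k. (\<lambda>n. \<integral>\<omega>. real (Y n \<omega> choose k) \<partial>M n) \<longlonglongrightarrow> l ^ k / fact k"
  shows "(\<lambda>n. measure (M n) {\<omega> \<in> space (M n). Y n \<omega> = j}) \<longlonglongrightarrow> l ^ j / fact j * exp (- l)"
proof (rule tendsto_approx)
  let ?b = "\<lambda>n k. \<integral>\<omega>. real (Y n \<omega> choose k) \<partial>M n"
  show "\<bar>measure (M n) {\<omega> \<in> space (M n). Y n \<omega> = j} - (\<Sum>i<m. (-1) ^ i * (real ((i + j) choose j) * ?b n (i + j)))\<bar>
    \<le> real ((m + j) choose j) * ?b n (m + j)" if m: "m \<ge> 1" for m n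
  proof -
    interpret prob_space "M n" by (rule M)
    have i1: "integrable (M n) (\<lambda>\<omega>. if Y n \<omega> = j then 1 else 0 :: real)"
      by (intro integrable_const_bound[where B=1]) auto
    have "measure (M n) {\<omega> \<in> space (M n). Y n \<omega> = j} = (\<integral>\<omega>. indicator {\<omega> \<in> space (M n). Y n \<omega> = j} \<omega> \<partial>M n)"
      by (simp add: Int_absorb2)
    also have "\<dots> = (\<integral>\<omega>. (if Y n \<omega> = j then 1 else 0) \<partial>M n)"
      by (intro Bochner_Integration.integral_cong) auto
    finally have eq: "measure (M n) {\<omega> \<in> space (M n). Y n \<omega> = j} - (\<Sum>i<m. (-1) ^ i * (real ((i + j) choose j) * ?b n (i + j)))
      = (\<integral>\<omega>. (if Y n \<omega> = j then 1 else 0) - (\<Sum>i<m. (-1) ^ i * (real ((i + j) choose j) * real (Y n \<omega> choose (i + j)))) \<partial>M n)"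
      using int i1 by (simp add: Bochner_Integration.integral_sum)
    have "\<bar>(\<integral>\<omega>. (if Y n \<omega> = j then 1 else 0) - (\<Sum>i<m. (-1) ^ i * (real ((i + j) choose j) * real (Y n \<omega> choose (i + j)))) \<partial>M n)\<bar>
        \<le> (\<integral>\<omega>. \<bar>(if Y n \<omega> = j then 1 else 0) - (\<Sum>i<m. (-1) ^ i * (real ((i + j) choose j) * real (Y n \<omega> choose (i + j))))\<bar> \<partial>M n)"
      by (rule integral_abs_bound)
    also have "\<dots> \<le> (\<integral>\<omega>. real ((m + j) choose j) * real (Y n \<omega> choose (m + j)) \<partial>M n)"
    proof (rule integral_mono')
      show "integrable (M n) (\<lambda>\<omega>. real ((m + j) choose j) * real (Y n \<omega> choose (m + j)))"
        by (intro integrable_mult_right int)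
    qed (rule bonferroni_binomial[OF m], simp)
    also have "\<dots> = real ((m + j) choose j) * ?b n (m + j)" by simp
    finally show ?thesis unfolding eq .
  qed
  show "(\<lambda>n. \<Sum>i<m. (-1) ^ i * (real ((i + j) choose j) * ?b n (i + j))) \<longlonglongrightarrow>
     (\<Sum>i<m. (-1) ^ i * (real ((i + j) choose j) * (l ^ (i + j) / fact (i + j))))" for m
    by (intro tendsto_intros lim)
  show "(\<lambda>n. real ((m + j) choose j) * ?b n (m + j)) \<longlonglongrightarrow> real ((m + j) choose j) * (l ^ (m + j) / fact (m + j))" for m
    by (intro tendsto_intros lim)
  have c: "real ((i + j) choose j) * (l ^ (i + j) / fact (i + j)) = l ^ j / fact j * (l ^ i / fact i)" for i
    by (simp add: binomial_fact power_add)
  have "(\<lambda>i. (- l) ^ i /\<^sub>R fact i) sums exp (- l)" by (rule exp_converges)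
  then have "(\<lambda>m. l ^ j / fact j * (\<Sum>i<m. (- l) ^ i /\<^sub>R fact i)) \<longlonglongrightarrow> l ^ j / fact j * exp (- l)"
    unfolding sums_def by (rule tendsto_mult_left)
  also have "(\<lambda>m. l ^ j / fact j * (\<Sum>i<m. (- l) ^ i /\<^sub>R fact i))
     = (\<lambda>m. \<Sum>i<m. (-1) ^ i * (real ((i + j) choose j) * (l ^ (i + j) / fact (i + j))))"
    unfolding c sum_distrib_left by (intro ext sum.cong refl) (simp add: power_minus[of l] field_simps)
  finally show "(\<lambda>m. \<Sum>i<m. (-1) ^ i * (real ((i + j) choose j) * (l ^ (i + j) / fact (i + j)))) \<longlonglongrightarrow> l ^ j / fact j * exp (- l)" .
  have "(\<lambda>m. l ^ m / fact m) \<longlonglongrightarrow> 0"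
    using summable_LIMSEQ_zero[OF sums_summable[OF exp_converges[of l]]] by (simp add: field_simps)
  then have "(\<lambda>m. l ^ j / fact j * (l ^ m / fact m)) \<longlonglongrightarrow> l ^ j / fact j * 0"
    by (rule tendsto_mult_left)
  then show "(\<lambda>m. real ((m + j) choose j) * (l ^ (m + j) / fact (m + j))) \<longlonglongrightarrow> 0"
    unfolding c by simp
qed

lemma (in prob_space) cdf_nat_valued:
  assumes Y[measurable]: "Y \<in> M \<rightarrow>\<^sub>M count_space UNIV"
  shows "cdf (distr M borel (\<lambda>\<omega>. real (Y \<omega>))) x = (\<Sum>j | real j \<le> x. prob {\<omega> \<in> space M. Y \<omega> = j})"
proof -
  have fin: "finite {j. real j \<le> x}"
    by (rule finite_subset[of _ "{..nat \<lfloor>x\<rfloor>}"]) (auto simp: le_nat_floor)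
  have "cdf (distr M borel (\<lambda>\<omega>. real (Y \<omega>))) x = prob ((\<lambda>\<omega>. real (Y \<omega>)) -` {..x} \<inter> space M)"
    unfolding cdf_def by (rule measure_distr) auto
  also have "(\<lambda>\<omega>. real (Y \<omega>)) -` {..x} \<inter> space M = (\<Union>j\<in>{j. real j \<le> x}. {\<omega> \<in> space M. Y \<omega> = j})"
    by auto
  also have "prob \<dots> = (\<Sum>j | real j \<le> x. prob {\<omega> \<in> space M. Y \<omega> = j})"
    using fin by (intro finite_measure_finite_Union) (auto simp: disjoint_family_on_def)
  finally show ?thesis .
qed

text \<open>The distribution function at x is a finite sum of point masses, so convergence of each
  mass suffices.\<close>

lemma weak_conv_nat_valued:
  fixes Y :: "nat \<Rightarrow> 'a \<Rightarrow> nat"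
  assumes M: "\<And>n. prob_space (M n)" and Y: "\<And>n. Y n \<in> M n \<rightarrow>\<^sub>M count_space UNIV"
    and lim: "\<And>j. (\<lambda>n. measure (M n) {\<omega> \<in> space (M n). Y n \<omega> = j}) \<longlonglongrightarrow> pmf p j"
  shows "weak_conv_m (\<lambda>n. distr (M n) borel (\<lambda>\<omega>. real (Y n \<omega>))) (distr (measure_pmf p) borel real)"
  unfolding weak_conv_m_def weak_conv_def
proof (intro allI impI)
  fix x
  have "(\<lambda>n. \<Sum>j | real j \<le> x. measure (M n) {\<omega> \<in> space (M n). Y n \<omega> = j}) \<longlonglongrightarrow> (\<Sum>j | real j \<le> x. pmf p j)"
    by (intro tendsto_sum lim)
  also have "(\<Sum>j | real j \<le> x. pmf p j) = cdf (distr (measure_pmf p) borel real) x"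
    by (subst measure_pmf.cdf_nat_valued[of "\<lambda>j. j", simplified]) (auto simp: measure_pmf_single)
  finally show "(\<lambda>n. cdf (distr (M n) borel (\<lambda>\<omega>. real (Y n \<omega>))) x) \<longlonglongrightarrow> cdf (distr (measure_pmf p) borel real) x"
    by (simp add: prob_space.cdf_nat_valued[OF M Y])
qed

section \<open>Factorial moments of the number of twin pairs\<close>

declare One_nat_def [simp del]

context torus_box begin

abbreviation \<Omega> :: "nat \<Rightarrow> points measure" where "\<Omega> n \<equiv> PiM {1..n} (\<lambda>_. \<mu>)"

lemma prob_space_Omega: "prob_space (\<Omega> n)"
  by (intro prob_space_PiM mu.prob_space_axioms)

text \<open>Letting z range over a and b as well encodes adjacency, since \<open>near\<close> is
  reflexive. It also makes transitivity visible: twins see the same set of vertices, themselves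
  included.\<close>

definition tw :: "nat \<Rightarrow> points \<Rightarrow> nat \<Rightarrow> nat \<Rightarrow> bool" where
  "tw n x a b \<longleftrightarrow> a \<in> {1..n} \<and> b \<in> {1..n} \<and> a \<noteq> b \<and> (\<forall>z\<in>{1..n}. near (x a) (x z) \<longleftrightarrow> near (x b) (x z))"

lemma tw_twin_relation: "twin_relation (tw n x)"
proof
  show "finite {p. tw n x (fst p) (snd p)}"
    by (rule finite_subset[of _ "{1..n} \<times> {1..n}"]) (auto simp: tw_def)
qed (auto simp: tw_def)

sublocale tw: twin_relation "tw n x" for n x by (rule tw_twin_relation)

lemma tw_measurable [measurable]:
  "Measurable.pred (\<Omega> n) (\<lambda>x. tw n x a b)"
proof (cases "a \<in> {1..n} \<and> b \<in> {1..n} \<and> a \<noteq> b")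
  case True
  then have "(\<lambda>x. tw n x a b) = (\<lambda>x. \<forall>z\<in>{1..n}. near (x a) (x z) \<longleftrightarrow> near (x b) (x z))"
    by (auto simp: tw_def)
  moreover have "Measurable.pred (\<Omega> n) (\<lambda>x. \<forall>z\<in>{1..n}. near (x a) (x z) \<longleftrightarrow> near (x b) (x z))"
    using True by (intro pred_intros_finite) (auto intro!: pred_intros_logic near_measurable measurable_component_singleton)
  ultimately show ?thesis by simp
next
  case False
  then have "(\<lambda>x. tw n x a b) = (\<lambda>x. False)" by (auto simp: tw_def fun_eq_iff)
  then show ?thesis by simp
qed

abbreviation cand :: "nat \<Rightarrow> nat \<Rightarrow> (nat \<times> nat) list set" where
  "cand n k \<equiv> matchings (\<lambda>a b. a \<in> {1..n} \<and> b \<in> {1..n}) k"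

lemma finite_cand: "finite (cand n k)"
  by (rule finite_matchings, rule finite_subset[of _ "{1..n} \<times> {1..n}"]) auto

definition all_tw :: "nat \<Rightarrow> (nat \<times> nat) list \<Rightarrow> points \<Rightarrow> bool" where
  "all_tw n ps x \<longleftrightarrow> (\<forall>p\<in>set ps. tw n x (fst p) (snd p))"

abbreviation prob_tw :: "nat \<Rightarrow> (nat \<times> nat) list \<Rightarrow> real" where
  "prob_tw n ps \<equiv> measure (\<Omega> n) {x \<in> space (\<Omega> n). all_tw n ps x}"

lemma all_tw_measurable [measurable]: "Measurable.pred (\<Omega> n) (all_tw n ps)"
  unfolding all_tw_def by (intro pred_intros_finite) auto

lemma card_matchings_tw: "real (card (matchings (tw n x) k)) = (\<Sum>ps\<in>cand n k. if all_tw n ps x then 1 else 0)"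
proof -
  have "matchings (tw n x) k = {ps \<in> cand n k. all_tw n ps x}"
    by (auto simp: matchings_def all_tw_def tw_def)
  then show ?thesis using finite_cand[of n k] by (simp add: sum.If_cases Int_def)
qed

abbreviation nmatch :: "nat \<Rightarrow> nat \<Rightarrow> points \<Rightarrow> real" where
  "nmatch n k x \<equiv> real (card (matchings (tw n x) k))"

lemma card_matchings_measurable [measurable]:
  "(\<lambda>x. nmatch n k x) \<in> borel_measurable (\<Omega> n)"
  unfolding card_matchings_tw by measurable

abbreviation mean_matchings :: "nat \<Rightarrow> nat \<Rightarrow> real" where
  "mean_matchings n k \<equiv> \<integral>x. nmatch n k x \<partial>\<Omega> n"

lemma expectation_matchings:
  "mean_matchings n k = (\<Sum>ps\<in>cand n k. prob_tw n ps)"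
  "integrable (\<Omega> n) (\<lambda>x. nmatch n k x)"
proof -
  interpret P: prob_space "\<Omega> n" by (rule prob_space_Omega)
  have i: "integrable (\<Omega> n) (\<lambda>x. if all_tw n ps x then 1 else 0 :: real)" for ps
    by (intro P.integrable_const_bound[where B=1]) auto
  have "(\<integral>x. (if all_tw n ps x then 1 else 0 :: real) \<partial>\<Omega> n) = prob_tw n ps" for ps
  proof -
    have "(\<integral>x. (if all_tw n ps x then 1 else 0 :: real) \<partial>\<Omega> n) = (\<integral>x. indicator {x \<in> space (\<Omega> n). all_tw n ps x} x \<partial>\<Omega> n)"
      by (intro Bochner_Integration.integral_cong) auto
    then show ?thesis by (simp add: Int_absorb2)
  qed
  then show "mean_matchings n k = (\<Sum>ps\<in>cand n k. prob_tw n ps)"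
    unfolding card_matchings_tw using i by (simp add: Bochner_Integration.integral_sum)
  show "integrable (\<Omega> n) (\<lambda>x. nmatch n k x)"
    unfolding card_matchings_tw using i by (intro Bochner_Integration.integrable_sum)
qed

text \<open>The list is read as a cluster with first components as base points and second components
  as partners. The other \<open>m = n - 2 k\<close> vertices form J, which is why the exponent is
  m.\<close>

lemma prob_all_tw_approx:
  assumes k: "k \<ge> 1" and m: "m \<ge> 2" and ps: "ps \<in> cand (m + 2 * k) k"
  defines "n \<equiv> m + 2 * k"
  shows "\<bar>prob_tw n ps - phi m ^ k\<bar>
    \<le> 72 * (real k)\<^sup>2 / real m * psi (real m / (4 * real k)) ^ k"
proof -
  define A where "A = fst ` set ps"
  define B where "B = snd ` set ps"
  define J where "J = {1..n} - (A \<union> B)"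
  \<comment> \<open>All entries of the list are distinct, so \<open>snd\<close> is injective on it
    and each partner determines its pair.\<close>
  define \<pi> where "\<pi> b = fst (inv_into (set ps) snd b)" for b
  have len: "length ps = k" and dist: "distinct (entries ps)" and V: "\<And>p. p \<in> set ps \<Longrightarrow> fst p \<in> {1..n} \<and> snd p \<in> {1..n}"
    using ps by (auto simp: matchings_def n_def)
  note d = distinct_flatD[OF dist]
  have pi_snd: "\<pi> (snd p) = fst p" if "p \<in> set ps" for p
    using that d(3) by (simp add: \<pi>_def)
  have cps: "card (set ps) = k" using d(1) len by (simp add: distinct_card)
  have cA: "card A = k" "card B = k" using d cps by (auto simp: A_def B_def card_image)
  have AB: "A \<inter> B = {}" using d(4) by (simp add: A_def B_def)
  have ABV: "A \<union> B \<subseteq> {1..n}" using V by (auto simp: A_def B_def)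
  have fin: "finite A" "finite B" by (auto simp: A_def B_def)
  have cJ: "card J = m"
    using fin AB ABV cA by (simp add: J_def card_Diff_subset card_Un_disjoint n_def)
  have un: "A \<union> B \<union> J = {1..n}" using ABV by (auto simp: J_def)
  have "card B \<noteq> 0" using cA k by simp
  then have Bne: "B \<noteq> {}" by auto
  interpret matching_cluster D r A B J \<pi>
  proof unfold_locales
    show "inj_on \<pi> B" unfolding B_def
    proof (rule inj_onI)
      fix x y assume "x \<in> snd ` set ps" "y \<in> snd ` set ps" "\<pi> x = \<pi> y"
      then show "x = y" using d(2) pi_snd by (auto simp: inj_on_def) (metis fst_conv snd_conv)
    qed
    show "A = \<pi> ` B" unfolding A_def B_def image_image by (intro image_cong refl pi_snd[symmetric])
    show "card J \<ge> 2" using cJ m by simp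
    show "\<And>b. b \<in> B \<Longrightarrow> \<pi> b \<in> A" using pi_snd by (force simp: A_def B_def)
  qed (use fin AB Bne in \<open>auto simp: J_def\<close>)
  have "all_tw n ps x \<longleftrightarrow> twins x" for x
  proof -
    have "twins x \<longleftrightarrow> (\<forall>p\<in>set ps. \<forall>z\<in>{1..n}. near (x (fst p)) (x z) \<longleftrightarrow> near (x (snd p)) (x z))"
      unfolding twins_def un by (simp add: B_def pi_snd)
    moreover have "fst p \<noteq> snd p" if "p \<in> set ps" for p
      using AB that by (auto simp: A_def B_def)
    ultimately show ?thesis unfolding all_tw_def tw_def using V by blast
  qed
  then show ?thesis
    using prob_twins_approx by (simp add: un cA cJ)
qed

lemma psi_bound':
  assumes "m \<ge> 1" "g > 0"
  shows "real m ^ D * psi (real m / g) \<le> (2 * g / kappa) ^ D"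
  using psi_bound[of "1 / g" "real m"] assms by simp

text \<open>The limit of \<open>n^D * phi n\<close>. It belongs to ordered pairs; the constant for
  the number of unordered pairs is half of it.\<close>

definition intensity :: real where "intensity = (1 / (2 * r) ^ (D - 1)) ^ D"

lemma intensity_pos: "intensity > 0" using r by (simp add: intensity_def)

text \<open>About \<open>m^(2 k)\<close> candidates, each of which consists of twins with
  probability \<open>phi m ^ k\<close> up to a relative error of order 1/m. Dividing by the exact
  number of candidates first keeps the two approximations apart.\<close>

lemma expectation_matchings_limit:
  assumes k: "k \<ge> 1"
  shows "(\<lambda>m. mean_matchings (m + 2 * k) k * real m ^ (D * k) / real m ^ (2 * k))
     \<longlonglongrightarrow> intensity ^ k"
proof -
  let ?n = "\<lambda>m. m + 2 * k"
  let ?E = "\<lambda>m. mean_matchings (?n m) k"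
  let ?c = "\<lambda>m. real (card (cand (?n m) k))"
  \<comment> \<open>\<open>72 k^2\<close> comes from \<open>prob_all_tw_approx\<close>, and
    \<open>8 k / kappa\<close> is the base in the bound for \<open>psi\<close> at rate
    \<open>1 / (4 k)\<close>.\<close>
  define C where "C = 72 * (real k)\<^sup>2 * ((8 * real k / kappa) ^ D) ^ k"
  have c: "real m ^ (2 * k) \<le> ?c m" "?c m \<le> real (?n m) ^ (2 * k)" for m
  proof -
    have "m ^ (2 * k) \<le> card (cand (?n m) k)" "card (cand (?n m) k) \<le> ?n m ^ (2 * k)"
      using card_free_matchings[of "{1..?n m}" k k] by simp_all
    then show "real m ^ (2 * k) \<le> ?c m" "?c m \<le> real (?n m) ^ (2 * k)"
      unfolding of_nat_power[symmetric] of_nat_le_iff by auto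
  qed
  have main: "\<bar>?E m * real m ^ (D * k) / ?c m - (real m ^ D * phi m) ^ k\<bar> \<le> C / real m" if m: "m \<ge> 2" for m
  proof -
    have m0: "real m > 0" using m by simp
    have c0: "?c m > 0" using c(1)[of m] m by (meson less_le_trans zero_less_power m0)
    let ?p = "\<lambda>ps. prob_tw (?n m) ps"
    have p: "\<bar>?p ps * real m ^ (D * k) - (real m ^ D * phi m) ^ k\<bar> \<le> C / real m" if "ps \<in> cand (?n m) k" for ps
    proof -
      have "\<bar>?p ps * real m ^ (D * k) - (real m ^ D * phi m) ^ k\<bar> = \<bar>?p ps - phi m ^ k\<bar> * real m ^ (D * k)"
      proof -
        have "?p ps * real m ^ (D * k) - (real m ^ D * phi m) ^ k = (?p ps - phi m ^ k) * real m ^ (D * k)"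
          by (simp add: power_mult_distrib power_mult algebra_simps)
        then show ?thesis by (simp add: abs_mult)
      qed
      also have "\<dots> \<le> 72 * (real k)\<^sup>2 / real m * psi (real m / (4 * real k)) ^ k * real m ^ (D * k)"
        by (intro mult_right_mono prob_all_tw_approx k m that) auto
      also have "\<dots> = 72 * (real k)\<^sup>2 / real m * (real m ^ D * psi (real m / (4 * real k))) ^ k"
        by (simp add: power_mult_distrib power_mult)
      also have "\<dots> \<le> 72 * (real k)\<^sup>2 / real m * ((2 * (4 * real k) / kappa) ^ D) ^ k"
        using m k psi_nonneg by (intro mult_left_mono power_mono psi_bound') auto
      finally show ?thesis by (simp add: C_def)
    qed
    have eq: "?E m * real m ^ (D * k) - ?c m * (real m ^ D * phi m) ^ k = (\<Sum>ps\<in>cand (?n m) k. ?p ps * real m ^ (D * k) - (real m ^ D * phi m) ^ k)"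
      by (simp add: expectation_matchings(1) sum_subtractf sum_distrib_right)
    have "\<bar>?E m * real m ^ (D * k) - ?c m * (real m ^ D * phi m) ^ k\<bar> \<le> (\<Sum>ps\<in>cand (?n m) k. C / real m)"
      unfolding eq by (intro order_trans[OF sum_abs] sum_mono p)
    then have "\<bar>?E m * real m ^ (D * k) - ?c m * (real m ^ D * phi m) ^ k\<bar> \<le> ?c m * (C / real m)" by simp
    moreover have "?E m * real m ^ (D * k) / ?c m - (real m ^ D * phi m) ^ k = (?E m * real m ^ (D * k) - ?c m * (real m ^ D * phi m) ^ k) / ?c m"
      using c0 by (simp add: diff_divide_distrib)
    ultimately show ?thesis using c0 by (simp add: abs_divide pos_divide_le_eq mult.commute)
  qed
  have "(\<lambda>m. (real m ^ D * phi m) ^ k) \<longlonglongrightarrow> intensity ^ k"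
    unfolding intensity_def using phi_limit[of 0] by (intro tendsto_power) simp
  moreover have "(\<lambda>m. ?E m * real m ^ (D * k) / ?c m - (real m ^ D * phi m) ^ k) \<longlonglongrightarrow> 0"
  proof (rule Lim_null_comparison)
    show "\<forall>\<^sub>F m in sequentially. norm (?E m * real m ^ (D * k) / ?c m - (real m ^ D * phi m) ^ k) \<le> C / real m"
      using eventually_ge_at_top[of 2] by eventually_elim (use main in simp)
    show "(\<lambda>m. C / real m) \<longlonglongrightarrow> 0" by (rule lim_const_over_n)
  qed
  ultimately have l1: "(\<lambda>m. ?E m * real m ^ (D * k) / ?c m) \<longlonglongrightarrow> intensity ^ k"
    using tendsto_add by fastforce
  have l2: "(\<lambda>m. ?c m / real m ^ (2 * k)) \<longlonglongrightarrow> 1"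
  proof (rule tendsto_sandwich)
    show "\<forall>\<^sub>F m in sequentially. 1 \<le> ?c m / real m ^ (2 * k)"
      using eventually_gt_at_top[of 0] by eventually_elim (use c in simp)
    show "\<forall>\<^sub>F m in sequentially. ?c m / real m ^ (2 * k) \<le> (real (?n m) / real m) ^ (2 * k)"
      using eventually_gt_at_top[of 0] by eventually_elim (use c in \<open>simp add: power_divide divide_right_mono\<close>)
    have "(\<lambda>m. (real (?n m) / real m) ^ (2 * k)) \<longlonglongrightarrow> 1 ^ (2 * k)" by (intro tendsto_power shifted_ratio_limit)
    then show "(\<lambda>m. (real (?n m) / real m) ^ (2 * k)) \<longlonglongrightarrow> 1" by simp
  qed simp
  have "(\<lambda>m. ?E m * real m ^ (D * k) / ?c m * (?c m / real m ^ (2 * k))) \<longlonglongrightarrow> intensity ^ k * 1"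
    by (intro tendsto_mult l1 l2)
  then have "(\<lambda>m. ?E m * real m ^ (D * k) / ?c m * (?c m / real m ^ (2 * k))) \<longlonglongrightarrow> intensity ^ k" by simp
  then show ?thesis
  proof (rule Lim_transform_eventually)
    show "\<forall>\<^sub>F m in sequentially. ?E m * real m ^ (D * k) / ?c m * (?c m / real m ^ (2 * k)) = ?E m * real m ^ (D * k) / real m ^ (2 * k)"
      using eventually_gt_at_top[of 0]
    proof eventually_elim
      case (elim m)
      then have "?c m > 0" using c(1)[of m] by (meson less_le_trans zero_less_power of_nat_0_less_iff)
      then show ?case by simp
    qed
  qed
qed

text \<open>A cluster with base point a and the two partners b and c. The differences to the base
  point are independent, hence the square.\<close>

lemma prob_triple_le:
  assumes abc: "a \<in> {1..n}" "b \<in> {1..n}" "c \<in> {1..n}" "a \<noteq> b" "a \<noteq> c" "b \<noteq> c"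
  shows "measure (\<Omega> n) {x \<in> space (\<Omega> n). tw n x a b \<and> tw n x a c} \<le> psi (real (n - 3) / 2) ^ 2"
proof -
  interpret cluster D r "{a}" "{b, c}" "{1..n} - {a, b, c}" "\<lambda>_. a"
    by unfold_locales (use abc in auto)
  have un: "{a} \<union> {b, c} \<union> ({1..n} - {a, b, c}) = {1..n}" using abc by auto
  have "tw n x a b \<and> tw n x a c \<longleftrightarrow> twins x" for x
    unfolding twins_def un tw_def using abc by auto
  moreover have "card ({1..n} - {a, b, c}) = n - 3" using abc by (simp add: card_Diff_subset)
  ultimately show ?thesis using prob_twins_le[unfolded un] abc by (simp add: power2_eq_square)
qed

lemma no_triple_measurable [measurable]: "Measurable.pred (\<Omega> n) (\<lambda>x. tw.no_triple n x)"
proof -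
  have eq: "tw.no_triple n x \<longleftrightarrow> (\<forall>a\<in>{1..n}. \<forall>b\<in>{1..n}. \<forall>c\<in>{1..n}. tw n x a b \<longrightarrow> tw n x a c \<longrightarrow> b = c)" for x
  proof -
    have "a \<in> {1..n} \<and> b \<in> {1..n}" if "tw n x a b" for a b
      using that unfolding tw_def by blast
    then show ?thesis unfolding tw.no_triple_def by blast
  qed
  show ?thesis unfolding eq by measurable
qed

abbreviation prob_triple :: "nat \<Rightarrow> real" where
  "prob_triple n \<equiv> measure (\<Omega> n) {x \<in> space (\<Omega> n). \<not> tw.no_triple n x}"

lemma prob_not_no_triple_le:
  "prob_triple n \<le> real n ^ 3 * psi (real (n - 3) / 2) ^ 2"
proof -
  interpret P: prob_space "\<Omega> n" by (rule prob_space_Omega)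
  let ?I = "{1..n} \<times> {1..n} \<times> {1..n}"
  let ?E = "\<lambda>(a, b, c). {x \<in> space (\<Omega> n). tw n x a b \<and> tw n x a c \<and> b \<noteq> c}"
  have "{x \<in> space (\<Omega> n). \<not> tw.no_triple n x} \<subseteq> (\<Union>i\<in>?I. ?E i)"
  proof
    fix x assume "x \<in> {x \<in> space (\<Omega> n). \<not> tw.no_triple n x}"
    then obtain a b c where "x \<in> space (\<Omega> n)" "tw n x a b" "tw n x a c" "b \<noteq> c" unfolding tw.no_triple_def by blast
    then show "x \<in> (\<Union>i\<in>?I. ?E i)" by (intro UN_I[of "(a, b, c)"]) (auto simp: tw_def)
  qed
  then have "prob_triple n \<le> measure (\<Omega> n) (\<Union>i\<in>?I. ?E i)"
    by (intro P.finite_measure_mono sets.finite_UN) auto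
  also have "\<dots> \<le> (\<Sum>i\<in>?I. measure (\<Omega> n) (?E i))"
    by (intro P.finite_measure_subadditive_finite) auto
  also have "\<dots> \<le> (\<Sum>i\<in>?I. psi (real (n - 3) / 2) ^ 2)"
  proof (intro sum_mono)
    fix i assume "i \<in> ?I"
    then obtain a b c where i: "i = (a, b, c)" "a \<in> {1..n}" "b \<in> {1..n}" "c \<in> {1..n}" by auto
    show "measure (\<Omega> n) (?E i) \<le> psi (real (n - 3) / 2) ^ 2"
    proof (cases "a \<noteq> b \<and> a \<noteq> c \<and> b \<noteq> c")
      case True
      then show ?thesis using prob_triple_le[of a n b c] i by simp
    next
      case False
      then have "?E i = {}" using i by (auto simp: tw_def)
      then show ?thesis by simp
    qed
  qed
  also have "\<dots> = real n ^ 3 * psi (real (n - 3) / 2) ^ 2"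
    by (simp add: card_cartesian_product power3_eq_cube)
  finally show ?thesis .
qed

end

lemma (in twin_relation) card_matchings_1: "card (matchings R 1) = 2 * num"
proof -
  have "ext R [] = {p. R (fst p) (snd p)}" using irrefl by (auto simp: ext_def)
  then show ?thesis using card_matchings_Suc[OF fin, of 0] by (simp add: card_ordered One_nat_def)
qed

section \<open>Moments of the number of twin pairs and the planar Poisson limit\<close>

context torus_box begin

lemma num_eq: "real (tw.num n x) = nmatch n 1 x / 2"
  by (simp add: tw.card_matchings_1)

lemma num_real_measurable [measurable]: "(\<lambda>x. real (tw.num n x)) \<in> borel_measurable (\<Omega> n)"
  unfolding num_eq by measurable

lemma num_measurable [measurable]: "(\<lambda>x. tw.num n x) \<in> \<Omega> n \<rightarrow>\<^sub>M count_space UNIV"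
proof (subst measurable_count_space_eq2_countable, intro conjI ballI)
  fix j
  have "{x \<in> space (\<Omega> n). real (tw.num n x) = real j} \<in> sets (\<Omega> n)" by measurable
  also have "{x \<in> space (\<Omega> n). real (tw.num n x) = real j} = (\<lambda>x. tw.num n x) -` {j} \<inter> space (\<Omega> n)" by auto
  finally show "(\<lambda>x. tw.num n x) -` {j} \<inter> space (\<Omega> n) \<in> sets (\<Omega> n)" .
qed auto

lemma num_le: "tw.num n x \<le> n\<^sup>2"
proof -
  have "card {p. tw n x (fst p) (snd p)} \<le> card ({1..n} \<times> {1..n})"
    by (intro card_mono) (auto simp: tw_def)
  then show ?thesis by (simp add: tw.card_ordered card_cartesian_product power2_eq_square)
qed

lemma integrable_num_fun:
  fixes f :: "nat \<Rightarrow> real"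
  shows "integrable (\<Omega> n) (\<lambda>x. f (tw.num n x))"
proof -
  interpret P: prob_space "\<Omega> n" by (rule prob_space_Omega)
  define K where "K = (\<Sum>t\<le>n\<^sup>2. \<bar>f t\<bar>)"
  have "\<bar>f (tw.num n x)\<bar> \<le> K" for x
    unfolding K_def using num_le[of n x] by (intro member_le_sum[where f="\<lambda>t. \<bar>f t\<bar>"]) auto
  then show ?thesis by (intro P.integrable_const_bound[where B=K]) auto
qed

lemma expectation_num_limit:
  "(\<lambda>m. (\<integral>x. real (tw.num (m + 2) x) \<partial>\<Omega> (m + 2)) * real m ^ D / real m ^ 2) \<longlonglongrightarrow> intensity / 2"
proof -
  have "(\<lambda>m. (\<integral>x. real (card (matchings (tw (m + 2 * 1) x) 1)) \<partial>\<Omega> (m + 2 * 1)) * real m ^ (D * 1) / real m ^ (2 * 1) / 2) \<longlonglongrightarrow> intensity ^ 1 / 2"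
    by (intro tendsto_divide expectation_matchings_limit tendsto_const) auto
  then show ?thesis unfolding num_eq by (simp add: mult_ac)
qed

text \<open>There are at most \<open>n^3\<close> triples, each with probability of order
  \<open>(n^(-2))^2\<close>.\<close>

lemma prob_not_no_triple_limit:
  assumes D2: "D = 2"
  shows "(\<lambda>n. prob_triple n) \<longlonglongrightarrow> 0"
proof (rule LIMSEQ_offset[where k=3], rule Lim_null_comparison)
  \<comment> \<open>\<open>64 = 4^3\<close> stems from \<open>m + 3 \<le> 4 m\<close>; the remaining
    factor is the squared bound for \<open>psi\<close> at rate 1/2.\<close>
  define C where "C = 64 * ((2 * 2 / kappa) ^ D) ^ 2"
  show "(\<lambda>m. C / real m) \<longlonglongrightarrow> 0" by (rule lim_const_over_n)
  show "\<forall>\<^sub>F m in sequentially. norm (prob_triple (m + 3)) \<le> C / real m"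
    using eventually_ge_at_top[of 1]
  proof eventually_elim
    case (elim m)
    have m0: "real m > 0" using elim by simp
    have "prob_triple (m + 3) \<le> real (m + 3) ^ 3 * psi (real m / 2) ^ 2"
      using prob_not_no_triple_le[of "m + 3"] by simp
    also have "\<dots> \<le> (4 * real m) ^ 3 * ((2 * 2 / kappa) ^ D / real m ^ 2) ^ 2"
    proof (intro mult_mono power_mono)
      have "real m ^ D * psi (real m / 2) \<le> (2 * 2 / kappa) ^ D" using elim by (intro psi_bound') auto
      moreover have "real m ^ D = real m ^ 2" using D2 by simp
      ultimately have "psi (real m / 2) * real m ^ 2 \<le> (2 * 2 / kappa) ^ D" by (simp only: mult.commute)
      then show "psi (real m / 2) \<le> (2 * 2 / kappa) ^ D / real m ^ 2"
        using m0 by (simp only: pos_le_divide_eq zero_less_power)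
    qed (use elim psi_nonneg in auto)
    also have "\<dots> = C / real m"
    proof -
      have "(4 * real m) ^ 3 * ((2 * 2 / kappa) ^ D / real m ^ 2) ^ 2 = 64 * ((2 * 2 / kappa) ^ D) ^ 2 * (real m ^ 3 / (real m ^ 2) ^ 2)"
        by (simp add: power_mult_distrib power_divide)
      also have "real m ^ 3 / (real m ^ 2) ^ 2 = 1 / real m"
        using m0 by (simp add: power2_eq_square power3_eq_cube)
      finally show ?thesis by (simp add: C_def)
    qed
    finally show ?case by simp
  qed
qed

lemma expectation_matchings_planar:
  assumes D2: "D = 2"
  shows "(\<lambda>n. \<integral>x. nmatch n k x \<partial>\<Omega> n) \<longlonglongrightarrow> intensity ^ k"
proof (cases "k = 0")
  case True
  have "mean_matchings n k = 1" for n
    using prob_space.prob_space[OF prob_space_Omega] True by simp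
  then show ?thesis using True by simp
next
  case False
  show ?thesis
  proof (rule LIMSEQ_offset[where k="2 * k"])
    have "(\<lambda>m. mean_matchings (m + 2 * k) k * real m ^ (D * k) / real m ^ (2 * k)) \<longlonglongrightarrow> intensity ^ k"
      using False by (intro expectation_matchings_limit) simp
    then show "(\<lambda>m. \<integral>x. real (card (matchings (tw (m + 2 * k) x) k)) \<partial>\<Omega> (m + 2 * k)) \<longlonglongrightarrow> intensity ^ k"
    proof (rule Lim_transform_eventually)
      show "\<forall>\<^sub>F m in sequentially. mean_matchings (m + 2 * k) k * real m ^ (D * k) / real m ^ (2 * k)
         = mean_matchings (m + 2 * k) k"
        using eventually_gt_at_top[of 0] by eventually_elim (use D2 in simp)
    qed
  qed
qed

text \<open>The expected numbers of \<open>2 q\<close>-matchings converge and are therefore bounded;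
  by \<open>num_power_le\<close> they control the q-th moment.\<close>

lemma moment_bound:
  assumes D2: "D = 2"
  shows "\<exists>C. \<forall>n. (\<integral>x. real (tw.num n x) ^ q \<partial>\<Omega> n) \<le> C"
proof -
  let ?E = "\<lambda>n. mean_matchings n (2 * q)"
  have "Bseq ?E"
    using expectation_matchings_planar[OF D2] by (intro convergent_imp_Bseq convergentI)
  then obtain K where K: "\<And>n. norm (?E n) \<le> K" by (auto simp: Bseq_def)
  have "(\<integral>x. real (tw.num n x) ^ q \<partial>\<Omega> n) \<le> real (12 * q) ^ (2 * q) + 2 ^ (2 * q) * K" for n
  proof -
    interpret P: prob_space "\<Omega> n" by (rule prob_space_Omega)
    have "(\<integral>x. real (tw.num n x) ^ q \<partial>\<Omega> n) \<le> (\<integral>x. real (12 * q) ^ (2 * q) + 2 ^ (2 * q) * nmatch n (2 * q) x \<partial>\<Omega> n)"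
    proof (rule integral_mono)
      show "integrable (\<Omega> n) (\<lambda>x. real (tw.num n x) ^ q)" by (rule integrable_num_fun)
      show "integrable (\<Omega> n) (\<lambda>x. real (12 * q) ^ (2 * q) + 2 ^ (2 * q) * nmatch n (2 * q) x)"
        by (intro Bochner_Integration.integrable_add integrable_mult_right expectation_matchings P.integrable_const)
      fix x
      have "real (tw.num n x ^ q) \<le> real ((12 * q) ^ (2 * q) + 2 ^ (2 * q) * card (matchings (tw n x) (2 * q)))"
        unfolding of_nat_le_iff by (rule tw.num_power_le)
      then show "real (tw.num n x) ^ q \<le> real (12 * q) ^ (2 * q) + 2 ^ (2 * q) * nmatch n (2 * q) x"
        by simp
    qed
    also have "\<dots> = real (12 * q) ^ (2 * q) + 2 ^ (2 * q) * ?E n"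
      using expectation_matchings(2) by (simp add: P.prob_space)
    also have "\<dots> \<le> real (12 * q) ^ (2 * q) + 2 ^ (2 * q) * K"
      using K[of n] by (intro add_left_mono mult_left_mono) auto
    finally show ?thesis .
  qed
  then show ?thesis by blast
qed

lemma binomial_le_power: "real (t choose k) \<le> real t ^ k"
  using binomial_le_pow[of k t] by (cases "k \<le> t") (simp_all add: binomial_eq_0 flip: of_nat_power)

text \<open>Matchings and factorial moments agree off the event of a triple, whose probability tends
  to 0. On that event the excess is at most a multiple of \<open>num ^ k\<close>, whose second
  moment is bounded; a weighted square inequality takes the place of Cauchy-Schwarz.\<close>

lemma binomial_moments_planar:
  assumes D2: "D = 2"
  shows "(\<lambda>n. \<integral>x. real (tw.num n x choose k) \<partial>\<Omega> n) \<longlonglongrightarrow> (intensity / 2) ^ k / fact k"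
proof -
  define c where "c = (2 ^ k * fact k :: real)"
  have c: "c > 0" by (simp add: c_def)
  let ?S = "\<lambda>n x. nmatch n k x"
  let ?EB = "\<lambda>n. \<integral>x. real (tw.num n x choose k) \<partial>\<Omega> n"
  let ?B = "\<lambda>n x. real (tw.num n x choose k)"
  obtain C where C: "\<And>n. (\<integral>x. real (tw.num n x) ^ (2 * k) \<partial>\<Omega> n) \<le> C"
    using moment_bound[OF D2] by blast
  have C0: "C \<ge> 0"
    using order_trans[OF Bochner_Integration.integral_nonneg C[of 0]] by simp
  have diff: "0 \<le> c * ?EB n - mean_matchings n k"
    "c * ?EB n - mean_matchings n k \<le> c * (h * C + prob_triple n / h)" if h: "h > 0" for n h
  proof -
    interpret P: prob_space "\<Omega> n" by (rule prob_space_Omega)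
    have iB: "integrable (\<Omega> n) (?B n)" by (rule integrable_num_fun)
    have iS: "integrable (\<Omega> n) (?S n)" by (rule expectation_matchings)
    have e: "c * ?EB n - mean_matchings n k = (\<integral>x. c * ?B n x - ?S n x \<partial>\<Omega> n)"
      using iB iS by simp
    have le: "?S n x \<le> c * ?B n x" for x
    proof -
      have "?S n x \<le> real (2 ^ k * fact k * (tw.num n x choose k))"
        unfolding of_nat_le_iff using tw.card_matchings_upper by blast
      then show ?thesis by (simp add: c_def)
    qed
    show "0 \<le> c * ?EB n - mean_matchings n k"
      unfolding e using le by (intro Bochner_Integration.integral_nonneg) auto
    let ?I = "\<lambda>x. indicator {x \<in> space (\<Omega> n). \<not> tw.no_triple n x} x :: real"
    have iI: "integrable (\<Omega> n) ?I" by (intro P.integrable_const_bound[where B=1]) auto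
    have "(\<integral>x. c * ?B n x - ?S n x \<partial>\<Omega> n) \<le> (\<integral>x. c * (h * real (tw.num n x) ^ (2 * k) + ?I x / h) \<partial>\<Omega> n)"
    proof (rule integral_mono)
      show "integrable (\<Omega> n) (\<lambda>x. c * ?B n x - ?S n x)" using iB iS by simp
      show "integrable (\<Omega> n) (\<lambda>x. c * (h * real (tw.num n x) ^ (2 * k) + ?I x / h))"
        using iI integrable_num_fun[of n "\<lambda>t. real t ^ (2 * k)"] by simp
      fix x assume x: "x \<in> space (\<Omega> n)"
      show "c * ?B n x - ?S n x \<le> c * (h * real (tw.num n x) ^ (2 * k) + ?I x / h)"
      proof (cases "tw.no_triple n x")
        case True
        then have "?S n x = real (2 ^ k * fact k * (tw.num n x choose k))"
          by (simp only: tw.card_matchings_upper)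
        then have "c * ?B n x - ?S n x = 0" by (simp add: c_def)
        also have "0 \<le> c * (h * real (tw.num n x) ^ (2 * k) + ?I x / h)" using c h by simp
        finally show ?thesis .
      next
        case False
        define y where "y = real (tw.num n x) ^ k"
        \<comment> \<open>This yields \<open>y \<le> h y^2 + 1 / h\<close>: the square is paid for
          by the bounded moment, the constant by the small probability of a triple.\<close>
        have "0 \<le> (h * y - 1)\<^sup>2 + h * y" using h by (simp add: y_def)
        then have "h * y \<le> h * y * (h * y) + 1" by (simp add: power2_eq_square algebra_simps)
        then have "y \<le> h * y\<^sup>2 + 1 / h" using h by (simp add: field_simps power2_eq_square)
        moreover have "?B n x \<le> y" unfolding y_def by (rule binomial_le_power)
        moreover have "y\<^sup>2 = real (tw.num n x) ^ (2 * k)" by (simp add: y_def mult.commute flip: power_mult)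
        ultimately have "?B n x \<le> h * real (tw.num n x) ^ (2 * k) + ?I x / h" using False x by simp
        then have "c * ?B n x \<le> c * (h * real (tw.num n x) ^ (2 * k) + ?I x / h)" using c by simp
        moreover have "0 \<le> ?S n x" by simp
        ultimately show ?thesis by linarith
      qed
    qed
    also have "\<dots> = c * (h * (\<integral>x. real (tw.num n x) ^ (2 * k) \<partial>\<Omega> n) + prob_triple n / h)"
      using iI integrable_num_fun[of n "\<lambda>t. real t ^ (2 * k)"] by (simp add: Int_absorb2)
    also have "\<dots> \<le> c * (h * C + prob_triple n / h)"
      using c h C[of n] by (intro mult_left_mono add_right_mono) auto
    finally show "c * ?EB n - mean_matchings n k \<le> c * (h * C + prob_triple n / h)" unfolding e .
  qed
  have "(\<lambda>n. c * ?EB n - mean_matchings n k) \<longlonglongrightarrow> 0"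
  \<comment> \<open>The weight is \<open>h = 1 / j\<close>: letting n grow removes the triples,
    letting j grow afterwards removes \<open>h * C\<close>.\<close>
  proof (rule tendsto_approx[where a="\<lambda>_ _. 0" and A="\<lambda>_. 0"])
    let ?e = "\<lambda>j n. c * (1 / real j * C + prob_triple n / (1 / real j))"
    show "\<bar>c * ?EB n - mean_matchings n k - 0\<bar> \<le> ?e j n" if "j \<ge> 1" for j n
      using diff[of "1 / real j" n] that by simp
    show "?e j \<longlonglongrightarrow> c * (1 / real j * C + 0 / (1 / real j))" for j
    \<comment> \<open>At j = 0 division by zero makes both \<open>?e j\<close> and the claimed limit
      equal to 0.\<close>
    proof (cases "j = 0")
      case False
      then show ?thesis by (intro tendsto_intros prob_not_no_triple_limit D2) auto
    qed simp
    have "(\<lambda>j. c * (C / real j)) \<longlonglongrightarrow> c * 0"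
      by (intro tendsto_mult_left lim_const_over_n)
    then show "(\<lambda>j. c * (1 / real j * C + 0 / (1 / real j))) \<longlonglongrightarrow> 0" by simp
  qed auto
  then have "(\<lambda>n. (c * ?EB n - mean_matchings n k + mean_matchings n k) / c) \<longlonglongrightarrow> (0 + intensity ^ k) / c"
    using c by (intro tendsto_divide tendsto_add expectation_matchings_planar D2) auto
  then show ?thesis using c by (simp add: c_def power_divide)
qed

lemma num_poisson:
  assumes D2: "D = 2"
  shows "(\<lambda>n. measure (\<Omega> n) {x \<in> space (\<Omega> n). tw.num n x = j}) \<longlonglongrightarrow> pmf (poisson_pmf (1 / (8 * r\<^sup>2))) j"
proof -
  have i: "intensity / 2 = 1 / (8 * r\<^sup>2)"
    unfolding intensity_def using D2 by (simp add: power2_eq_square One_nat_def)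
  have "(\<lambda>n. measure (\<Omega> n) {x \<in> space (\<Omega> n). tw.num n x = j}) \<longlonglongrightarrow> (intensity / 2) ^ j / fact j * exp (- (intensity / 2))"
    by (rule poisson_limit_from_binomial_moments)
       (auto intro: prob_space_Omega integrable_num_fun binomial_moments_planar[OF D2])
  then show ?thesis using r unfolding i by simp
qed

end

section \<open>The first-order sentence and the main theorem\<close>

definition fo_exists :: "nat \<Rightarrow> fo \<Rightarrow> fo" where
  "fo_exists i \<phi> = Neg (Forall i (Neg \<phi>))"

definition fo_or :: "fo \<Rightarrow> fo \<Rightarrow> fo" where
  "fo_or \<phi> \<psi> = Neg (Conj (Neg \<phi>) (Neg \<psi>))"

definition fo_iff :: "fo \<Rightarrow> fo \<Rightarrow> fo" where
  "fo_iff \<phi> \<psi> = Conj (fo_or (Neg \<phi>) \<psi>) (fo_or \<phi> (Neg \<psi>))"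

text \<open>Variables 0 and 1 denote the pair; the two \<open>Eq\<close> disjuncts exempt its own
  vertices from the comparison of neighbors.\<close>

definition twin_sentence :: fo where
  "twin_sentence = fo_exists 0 (fo_exists 1 (Conj (Edge 0 1)
     (Forall 2 (fo_or (Eq 2 0) (fo_or (Eq 2 1) (fo_iff (Edge 0 2) (Edge 1 2)))))))"

lemma sentence_twin_sentence: "sentence twin_sentence"
  by (auto simp: sentence_def twin_sentence_def fo_exists_def fo_or_def fo_iff_def)

lemma sat_derived [simp]:
  "sat G s (fo_exists i \<phi>) \<longleftrightarrow> (\<exists>v\<in>verts G. sat G (s(i := v)) \<phi>)"
  "sat G s (fo_or \<phi> \<psi>) \<longleftrightarrow> sat G s \<phi> \<or> sat G s \<psi>"
  "sat G s (fo_iff \<phi> \<psi>) \<longleftrightarrow> (sat G s \<phi> \<longleftrightarrow> sat G s \<psi>)"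
  by (auto simp: fo_exists_def fo_or_def fo_iff_def)

lemma models_twin_sentence:
  "models G twin_sentence \<longleftrightarrow> (\<exists>a\<in>verts G. \<exists>b\<in>verts G. adjacent_twins G a b)"
proof -
  have "neighbors G a - {a, b} = neighbors G b - {a, b} \<longleftrightarrow>
      (\<forall>z\<in>verts G. z = a \<or> z = b \<or> (adjacent G a z \<longleftrightarrow> adjacent G b z))" for a b
    by (auto simp: neighbors_def)
  then show ?thesis
    by (simp add: models_def twin_sentence_def adjacent_twins_def)
qed

context torus_box begin

abbreviation TG :: "nat \<Rightarrow> points \<Rightarrow> nat sgraph" where "TG n \<equiv> torus_graph D n r"

lemma verts_torus_graph: "verts (TG n x) = {1..n}"
  by (simp add: torus_graph_def)

lemma adjacent_torus_graph:
  "adjacent (TG n x) a b \<longleftrightarrow> a \<in> {1..n} \<and> b \<in> {1..n} \<and> a \<noteq> b \<and> near (x a) (x b)"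
  unfolding adjacent_def torus_graph_def torus_dist_le_iff
  by (auto simp: doubleton_eq_iff near_commute)

text \<open>One side compares neighbors outside the pair, the other compares closed neighborhoods
  over all vertices. At the two vertices of the pair the latter comparison holds by adjacency,
  symmetry and reflexivity of \<open>near\<close>.\<close>

lemma adjacent_twins_torus_graph:
  assumes "a \<in> {1..n}" "b \<in> {1..n}"
  shows "adjacent_twins (TG n x) a b \<longleftrightarrow> tw n x a b"
proof
  assume at: "adjacent_twins (TG n x) a b"
  then have ab: "a \<noteq> b" "near (x a) (x b)" by (auto simp: adjacent_twins_def adjacent_torus_graph)
  have "near (x a) (x z) \<longleftrightarrow> near (x b) (x z)" if z: "z \<in> {1..n}" for z
  proof (cases "z = a \<or> z = b")
    case True
    then show ?thesis using ab near_refl near_commute by blast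
  next
    case False
    have "z \<in> neighbors (TG n x) a - {a, b} \<longleftrightarrow> z \<in> neighbors (TG n x) b - {a, b}"
      using at by (simp add: adjacent_twins_def)
    then show ?thesis using False z assms by (simp add: neighbors_def verts_torus_graph adjacent_torus_graph)
  qed
  then show "tw n x a b" using assms ab by (simp add: tw_def)
next
  assume t: "tw n x a b"
  then have ab: "a \<noteq> b" and N: "\<And>z. z \<in> {1..n} \<Longrightarrow> near (x a) (x z) \<longleftrightarrow> near (x b) (x z)" by (auto simp: tw_def)
  have "near (x a) (x b)" using N[OF assms(2)] near_refl by blast
  moreover have "neighbors (TG n x) a - {a, b} = neighbors (TG n x) b - {a, b}"
    using N assms by (auto simp: neighbors_def verts_torus_graph adjacent_torus_graph)
  ultimately show "adjacent_twins (TG n x) a b"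
    using ab assms by (simp add: adjacent_twins_def adjacent_torus_graph)
qed

lemma num_adjacent_twins_torus_graph: "num_adjacent_twins (TG n x) = tw.num n x"
proof -
  have "{{a, b} | a b. a \<in> {1..n} \<and> b \<in> {1..n} \<and> adjacent_twins (TG n x) a b} = {{a, b} | a b. tw n x a b}"
  proof (intro Collect_cong ex_cong1 conj_cong refl)
    fix a b
    show "a \<in> {1..n} \<and> b \<in> {1..n} \<and> adjacent_twins (TG n x) a b \<longleftrightarrow> tw n x a b"
      using adjacent_twins_torus_graph[of a n b x] by (auto simp: tw_def)
  qed
  then show ?thesis by (simp add: num_adjacent_twins_def tw.num_def verts_torus_graph)
qed

lemma models_twin_sentence_torus_graph:
  "models (TG n x) twin_sentence \<longleftrightarrow> tw.num n x \<noteq> 0"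
proof -
  have "models (TG n x) twin_sentence \<longleftrightarrow> (\<exists>a b. tw n x a b)"
    unfolding models_twin_sentence verts_torus_graph using adjacent_twins_torus_graph[of _ n _ x] by (metis tw_def)
  also have "\<dots> \<longleftrightarrow> card {p. tw n x (fst p) (snd p)} \<noteq> 0"
    using tw.fin[of n x] by (auto simp: card_eq_0_iff)
  finally show ?thesis by (simp add: tw.card_ordered)
qed

lemma tw_cong:
  assumes "\<And>i. i \<in> {1..n} \<Longrightarrow> x i = y i"
  shows "tw n x = tw n y"
  using assms by (intro ext) (auto simp: tw_def)

text \<open>Transfers probabilities from arbitrary spaces carrying the points to the product space.
  The joint law is identified for a nonempty index set, hence \<open>n \<ge> 1\<close>; limits do
  not see n = 0.\<close>

lemma uniform_torus_points_distr:
  assumes "uniform_torus_points M D n X"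
  shows "(\<lambda>\<omega>. \<lambda>i\<in>{1..n}. X i \<omega>) \<in> M \<rightarrow>\<^sub>M \<Omega> n"
    "n \<ge> 1 \<Longrightarrow> distr M (\<Omega> n) (\<lambda>\<omega>. \<lambda>i\<in>{1..n}. X i \<omega>) = \<Omega> n"
proof -
  interpret uniform_torus_points M D n X by fact
  have rv: "X i \<in> M \<rightarrow>\<^sub>M \<mu>" if "i \<in> {1..n}" for i
    using indep that by (auto simp: indep_vars_def)
  then show "(\<lambda>\<omega>. \<lambda>i\<in>{1..n}. X i \<omega>) \<in> M \<rightarrow>\<^sub>M \<Omega> n" by (rule measurable_restrict)
  assume "n \<ge> 1"
  then have "{1..n} \<noteq> {}" by simp
  then have "distr M (\<Omega> n) (\<lambda>\<omega>. \<lambda>i\<in>{1..n}. X i \<omega>) = PiM {1..n} (\<lambda>i. distr M \<mu> (X i))"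
    by (rule iffD1[OF indep_vars_iff_distr_eq_PiM'[OF _ rv] indep])
  also have "\<dots> = \<Omega> n" by (intro PiM_cong refl uniform)
  finally show "distr M (\<Omega> n) (\<lambda>\<omega>. \<lambda>i\<in>{1..n}. X i \<omega>) = \<Omega> n" .
qed

lemma asymptotic_constant:
  "2 powi (int D - 1 - int D ^ 2) * r powi (- (int D * (int D - 1))) = intensity / 2"
proof -
  define N where "N = D * (D - 1)"
  have N: "int N = int D * (int D - 1)" using D by (simp add: N_def of_nat_diff)
  have "int D - 1 - int D ^ 2 = - int N + (- 1)" unfolding N by (simp add: power2_eq_square algebra_simps)
  then have "2 powi (int D - 1 - int D ^ 2) = (2::real) powi (- int N) * 2 powi (- 1)"
    by (simp only:) (rule power_int_add, simp)
  also have "\<dots> = 1 / 2 ^ N / 2" by (simp add: power_int_minus field_simps)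
  finally have e: "2 powi (int D - 1 - int D ^ 2) = 1 / (2::real) ^ N / 2" .
  have "2 powi (int D - 1 - int D ^ 2) * r powi (- (int D * (int D - 1))) = 1 / (2 * r) ^ N / 2"
    unfolding e N[symmetric] by (simp add: power_int_minus power_mult_distrib field_simps)
  also have "1 / (2 * r) ^ N = intensity"
  proof -
    have "(2 * r) ^ N = ((2 * r) ^ (D - 1)) ^ D" unfolding N_def by (metis mult.commute power_mult)
    then show ?thesis by (simp add: intensity_def power_divide)
  qed
  finally show ?thesis .
qed

lemma expectation_num_asymp:
  "(\<lambda>n. \<integral>x. real (tw.num n x) \<partial>\<Omega> n) \<sim>[sequentially]
     (\<lambda>n. 2 powi (int D - 1 - int D ^ 2) * r powi (- (int D * (int D - 1))) * real n powi (2 - int D))"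
  unfolding asymptotic_constant
proof (rule asymp_equivI', rule LIMSEQ_offset[where k=2])
  let ?E = "\<lambda>m. \<integral>x. real (tw.num (m + 2) x) \<partial>\<Omega> (m + 2)"
  \<comment> \<open>The known limit is normalised by powers of m = n - 2; the two extra ratios
    convert these into powers of n.\<close>
  have "(\<lambda>m. ?E m * real m ^ D / real m ^ 2 / (intensity / 2) * (real (m + 2) / real m) ^ D / (real (m + 2) / real m) ^ 2)
     \<longlonglongrightarrow> intensity / 2 / (intensity / 2) * 1 ^ D / 1 ^ 2"
    by (intro tendsto_divide tendsto_mult tendsto_power shifted_ratio_limit expectation_num_limit tendsto_const) (use intensity_pos in auto)
  then have "(\<lambda>m. ?E m * real m ^ D / real m ^ 2 / (intensity / 2) * (real (m + 2) / real m) ^ D / (real (m + 2) / real m) ^ 2) \<longlonglongrightarrow> 1"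
    using intensity_pos by simp
  then show "(\<lambda>m. ?E m / (intensity / 2 * real (m + 2) powi (2 - int D))) \<longlonglongrightarrow> 1"
  proof (rule Lim_transform_eventually)
    show "\<forall>\<^sub>F m in sequentially. ?E m * real m ^ D / real m ^ 2 / (intensity / 2) * (real (m + 2) / real m) ^ D / (real (m + 2) / real m) ^ 2
       = ?E m / (intensity / 2 * real (m + 2) powi (2 - int D))"
      using eventually_gt_at_top[of 0]
    proof eventually_elim
      case (elim m)
      have "real (m + 2) powi (2 - int D) = real (m + 2) powi 2 / real (m + 2) powi int D"
        by (rule power_int_diff) simp
      then have p: "real (m + 2) powi (2 - int D) = real (m + 2) ^ 2 / real (m + 2) ^ D" by simp
      define a where "a = real m"
      define b where "b = real (m + 2)"
      have ab: "a > 0" "b > 0" using elim by (auto simp: a_def b_def)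
      show ?case unfolding a_def[symmetric] b_def[symmetric] p[folded b_def]
        using ab intensity_pos by (simp add: power_divide field_simps)
    qed
  qed
qed

lemma expectation_num_vanishes:
  assumes "D \<ge> 3"
  shows "(\<lambda>n. \<integral>x. real (tw.num n x) \<partial>\<Omega> n) \<longlonglongrightarrow> 0"
proof (rule LIMSEQ_offset[where k=2])
  let ?E = "\<lambda>m. \<integral>x. real (tw.num (m + 2) x) \<partial>\<Omega> (m + 2)"
  \<comment> \<open>The factor \<open>(1 / m) ^ (D - 2)\<close> undoes the normalisation, and its
    exponent is positive for \<open>D \<ge> 3\<close>.\<close>
  have l: "(\<lambda>m. ?E m * real m ^ D / real m ^ 2 * (1 / real m) ^ (D - 2)) \<longlonglongrightarrow> intensity / 2 * 0 ^ (D - 2)"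
    by (intro tendsto_mult tendsto_power expectation_num_limit lim_const_over_n)
  have "intensity / 2 * 0 ^ (D - 2) = 0" using assms by simp
  then show "?E \<longlonglongrightarrow> 0"
  proof -
    have "\<forall>\<^sub>F m in sequentially. ?E m * real m ^ D / real m ^ 2 * (1 / real m) ^ (D - 2) = ?E m"
      using eventually_gt_at_top[of 0]
    proof eventually_elim
      case (elim m)
      have "2 + (D - 2) = D" using assms by linarith
      then have "real m ^ D = real m ^ 2 * real m ^ (D - 2)" by (metis power_add)
      then show ?case using elim by (simp add: power_divide)
    qed
    with l show ?thesis unfolding \<open>intensity / 2 * 0 ^ (D - 2) = 0\<close> by (rule Lim_transform_eventually)
  qed
qed

end

theorem theorem1p2:
  fixes D :: nat and r :: real
    and M :: "nat \<Rightarrow> 'a measure"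
    and X :: "nat \<Rightarrow> nat \<Rightarrow> 'a \<Rightarrow> (nat \<Rightarrow> circle)"
    and \<Gamma> :: "nat \<Rightarrow> 'a \<Rightarrow> nat sgraph"
    and T :: "nat \<Rightarrow> 'a \<Rightarrow> real"
  assumes "D \<ge> 1" and "0 < r" and "r < 1/2"
    and "\<And>n. uniform_torus_points (M n) D n (X n)"
  defines "\<Gamma> \<equiv> \<lambda>n \<omega>. torus_graph D n r (\<lambda>i. X n i \<omega>)"
    and "T \<equiv> \<lambda>n \<omega>. real (num_adjacent_twins (\<Gamma> n \<omega>))"
  shows "((\<lambda>n. \<integral>\<omega>. T n \<omega> \<partial>M n) \<sim>[sequentially]
           (\<lambda>n. 2 powi (int D - 1 - int D ^ 2) * r powi (- (int D * (int D - 1)))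
                  * real n powi (2 - int D)))
       \<and> (D = 2 \<longrightarrow> weak_conv_m (\<lambda>n. distr (M n) borel (T n))
                    (distr (measure_pmf (poisson_pmf (1 / (8 * r\<^sup>2)))) borel real))
       \<and> (D = 2 \<longrightarrow> \<not> fo_zero_one_law M \<Gamma>)
       \<and> (D \<ge> 3 \<longrightarrow> tendsto_in_prob M T 0)"
proof -
  interpret torus_box D r by unfold_locales (use assms in auto)
  \<comment> \<open>The restriction gives an element of the product space, and the twin count
    depends only on the retained indices.\<close>
  define \<Phi> where "\<Phi> n \<omega> = (\<lambda>i\<in>{1..n}. X n i \<omega>)" for n \<omega>
  define Y where "Y n \<omega> = tw.num n (\<Phi> n \<omega>)" for n \<omega>
  have M: "prob_space (M n)" for n
    using assms(4)[of n] by (simp add: uniform_torus_points_def)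
  have \<Phi>: "\<Phi> n \<in> M n \<rightarrow>\<^sub>M \<Omega> n" for n
    unfolding \<Phi>_def by (rule uniform_torus_points_distr(1)[OF assms(4)])
  have \<Phi>_distr: "distr (M n) (\<Omega> n) (\<Phi> n) = \<Omega> n" if "n \<ge> 1" for n
    unfolding \<Phi>_def by (rule uniform_torus_points_distr(2)[OF assms(4) that])
  have num: "tw.num n (\<lambda>i. X n i \<omega>) = Y n \<omega>" for n \<omega>
    unfolding Y_def by (subst tw_cong[of n "\<lambda>i. X n i \<omega>" "\<Phi> n \<omega>"]) (simp_all add: \<Phi>_def)
  have T: "T = (\<lambda>n \<omega>. real (Y n \<omega>))"
    unfolding T_def \<Gamma>_def num_adjacent_twins_torus_graph num ..
  have Y: "Y n \<in> M n \<rightarrow>\<^sub>M count_space UNIV" for n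
    unfolding Y_def by (rule measurable_compose[OF \<Phi> num_measurable])
  have Tm: "T n \<in> borel_measurable (M n)" for n
    unfolding T using Y[of n] by simp
  let ?ET = "\<lambda>n. \<integral>\<omega>. T n \<omega> \<partial>M n" and ?q = "\<lambda>n j. measure (M n) {\<omega> \<in> space (M n). Y n \<omega> = j}"
  have ET: "?ET n = (\<integral>x. real (tw.num n x) \<partial>\<Omega> n)" if "n \<ge> 1" for n
  proof -
    have "(\<integral>x. real (tw.num n x) \<partial>distr (M n) (\<Omega> n) (\<Phi> n)) = ?ET n"
      unfolding T Y_def by (rule integral_distr[OF \<Phi>]) measurable
    then show ?thesis using \<Phi>_distr[OF that] by simp
  qed
  have evET: "\<forall>\<^sub>F n in sequentially. (\<integral>x. real (tw.num n x) \<partial>\<Omega> n) = ?ET n"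
    using eventually_ge_at_top[of 1] by eventually_elim (simp add: ET)
  have lim: "(\<lambda>n. ?q n j) \<longlonglongrightarrow> pmf (poisson_pmf (1 / (8 * r\<^sup>2))) j"
    if D2: "D = 2" for j
  proof (rule Lim_transform_eventually[OF num_poisson[OF D2]])
    show "\<forall>\<^sub>F n in sequentially. measure (\<Omega> n) {x \<in> space (\<Omega> n). tw.num n x = j} = ?q n j"
      using eventually_ge_at_top[of 1]
    proof eventually_elim
      case (elim n)
      have "measure (distr (M n) (\<Omega> n) (\<Phi> n)) {x \<in> space (\<Omega> n). tw.num n x = j} = measure (M n) (\<Phi> n -` {x \<in> space (\<Omega> n). tw.num n x = j} \<inter> space (M n))"
        by (rule measure_distr[OF \<Phi>]) measurable
      also have "\<Phi> n -` {x \<in> space (\<Omega> n). tw.num n x = j} \<inter> space (M n) = {\<omega> \<in> space (M n). Y n \<omega> = j}"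
        using measurable_space[OF \<Phi>[of n]] by (auto simp: Y_def)
      finally show ?case using \<Phi>_distr[OF elim] by simp
    qed
  qed
  have 1: "(\<lambda>n. \<integral>\<omega>. T n \<omega> \<partial>M n) \<sim>[sequentially]
      (\<lambda>n. 2 powi (int D - 1 - int D ^ 2) * r powi (- (int D * (int D - 1))) * real n powi (2 - int D))"
    by (rule asymp_equiv_transfer[OF expectation_num_asymp evET]) simp
  have 2: "weak_conv_m (\<lambda>n. distr (M n) borel (T n)) (distr (measure_pmf (poisson_pmf (1 / (8 * r\<^sup>2)))) borel real)"
    if D2: "D = 2"
    unfolding T by (rule weak_conv_nat_valued[OF M Y lim[OF D2]])
  have 3: "\<not> fo_zero_one_law M \<Gamma>" if D2: "D = 2"
  proof
    let ?p = "\<lambda>n. measure (M n) {\<omega> \<in> space (M n). models (\<Gamma> n \<omega>) twin_sentence}"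
    assume "fo_zero_one_law M \<Gamma>"
    then have "?p \<longlonglongrightarrow> 0 \<or> ?p \<longlonglongrightarrow> 1"
      using sentence_twin_sentence unfolding fo_zero_one_law_def by blast
    moreover have p: "?p n = 1 - ?q n 0" for n
    proof -
      interpret prob_space "M n" by (rule M)
      have "{\<omega> \<in> space (M n). models (\<Gamma> n \<omega>) twin_sentence} = {\<omega> \<in> space (M n). Y n \<omega> \<noteq> 0}"
        unfolding \<Gamma>_def models_twin_sentence_torus_graph num ..
      moreover have "{\<omega> \<in> space (M n). Y n \<omega> = 0} \<in> events" using Y[of n] by measurable
      ultimately show ?thesis using prob_neg[of "\<lambda>\<omega>. Y n \<omega> = 0"] by simp
    qed
    have "?p \<longlonglongrightarrow> 1 - pmf (poisson_pmf (1 / (8 * r\<^sup>2))) 0"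
      unfolding p by (intro tendsto_diff tendsto_const lim[OF D2])
    then have "?p \<longlonglongrightarrow> 1 - exp (- (1 / (8 * r\<^sup>2)))" using r by simp
    ultimately have "1 - exp (- (1 / (8 * r\<^sup>2))) = 0 \<or> 1 - exp (- (1 / (8 * r\<^sup>2))) = 1"
      using LIMSEQ_unique by blast
    then show False using r by simp
  qed
  \<comment> \<open>Markov's inequality applied to the first moment, which tends to 0 in these
    dimensions.\<close>
  have 4: "tendsto_in_prob M T 0" if D3: "D \<ge> 3"
    unfolding tendsto_in_prob_def
  proof (intro allI impI)
    fix \<epsilon> :: real assume \<epsilon>: "\<epsilon> > 0"
    have "(\<lambda>n. \<integral>\<omega>. T n \<omega> \<partial>M n) \<longlonglongrightarrow> 0"
      by (rule Lim_transform_eventually[OF expectation_num_vanishes[OF D3] evET])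
    then have "(\<lambda>n. ?ET n / \<epsilon>) \<longlonglongrightarrow> 0 / \<epsilon>" by (intro tendsto_divide tendsto_const) (use \<epsilon> in auto)
    then have l: "(\<lambda>n. ?ET n / \<epsilon>) \<longlonglongrightarrow> 0" by simp
    show "(\<lambda>n. measure (M n) {\<omega> \<in> space (M n). \<bar>T n \<omega> - 0\<bar> > \<epsilon>}) \<longlonglongrightarrow> 0"
    proof (rule Lim_null_comparison[OF always_eventually[rule_format] l])
      fix n
      interpret prob_space "M n" by (rule M)
      have Yle: "T n \<omega> \<le> real (n\<^sup>2)" for \<omega>
        unfolding T Y_def of_nat_le_iff by (rule num_le)
      have T0: "0 \<le> T n \<omega>" for \<omega> by (simp add: T)
      have iT: "integrable (M n) (T n)"
        using Tm Yle T0 by (intro integrable_const_bound[where B="real (n\<^sup>2)"]) auto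
      have "measure (M n) {\<omega> \<in> space (M n). \<bar>T n \<omega> - 0\<bar> > \<epsilon>} \<le> measure (M n) {\<omega> \<in> space (M n). T n \<omega> \<ge> \<epsilon>}"
        using Tm[of n] T0 by (intro finite_measure_mono) auto
      also have "\<dots> \<le> ?ET n / \<epsilon>"
        using T0 \<epsilon> by (intro integral_Markov_inequality_measure[OF iT, of "{}"]) auto
      finally show "norm (measure (M n) {\<omega> \<in> space (M n). \<bar>T n \<omega> - 0\<bar> > \<epsilon>}) \<le> ?ET n / \<epsilon>" by simp
    qed
  qed
  show ?thesis using 1 2 3 4 by blast
qed

end
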